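(* Let $A$ be a finite-dimensional algebra over a field, and let $M, N$ be two finitely generated left $A$-modules with the property that the $\operatorname{HH}^*(A)$-module $\operatorname{Ext}_A^{\ge n_0}(M,N) = \bigoplus_{n \ge n_0} \operatorname{Ext}_A^n(M,N)$ is Noetherian for some integer $n_0$. Then either $\operatorname{Ext}_A^n(M,N) = 0$ for all $n \gg 0$, or there exist integers $d > 0$ and $m_0$ such that, for at least one integer $j$ with $0 \le j < d$, $\operatorname{Ext}_A^n(M,N) \neq 0$ for all $n \ge m_0$ with $n \equiv j \pmod d$.
   Context: For a finite-dimensional algebra $A$ over a field $k$, $\operatorname{HH}^*(A)$ denotes the Hochschild cohomology ring, with degree $n$ component $\operatorname{HH}^n(A) = \operatorname{Ext}^n_{A \otimes_k A^{\mathrm{op}}}(A,A)$ and multiplication given by the Yoneda product; it is a graded-commutative ring. For a finitely generated left $A$-module $M$, the tensor product $- \otimes_A M$ (applied to bimodule extensions of $A$ by itself) induces a homomorphism of graded rings $\varphi_M : \operatorname{HH}^*(A) \to \operatorname{Ext}_A^*(M,M)$. If $N$ is another finitely generated left $A$-module, then $\operatorname{Ext}_A^*(M,N) = \bigoplus_n \operatorname{Ext}_A^n(M,N)$ becomes a left $\operatorname{HH}^*(A)$-module via $\varphi_N$ and a right $\operatorname{HH}^*(A)$-module via $\varphi_M$ (using Yoneda products); the two module structures coincide up to a sign, so it does not matter which one is used when speaking of $\operatorname{Ext}_A^*(M,N)$, or of its submodule $\operatorname{Ext}_A^{\ge n_0}(M,N)$, as an $\operatorname{HH}^*(A)$-module.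 *)

theory Defs
  imports
    "HOL-Algebra.Module"
    "HOL-Algebra.Free_Abelian_Groups"
    "HOL-Number_Theory.Cong"
begin

section \<open>Modules over a not necessarily commutative ring\<close>

text \<open>
  The locale \<^locale>\<open>module\<close> requires a commutative ring of scalars.  We keep its record type
  (where the ring multiplication and unit of a module are irrelevant) and drop commutativity.
  A right module over \<open>S\<close> is written as a record of the same type, with \<open>s \<odot> x\<close> meaning \<open>x \<cdot> s\<close>.
\<close>

locale left_module = R?: ring R + M?: abelian_group M
  for R :: "('r, 'z) ring_scheme" (structure) and M :: "('r, 'm, 'w) module_scheme" (structure) +
  assumes smult_closed:
      "\<lbrakk>a \<in> carrier R; x \<in> carrier M\<rbrakk> \<Longrightarrow> a \<odot>\<^bsub>M\<^esub> x \<in> carrier M"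
    and smult_l_distr:
      "\<lbrakk>a \<in> carrier R; b \<in> carrier R; x \<in> carrier M\<rbrakk> \<Longrightarrow>
        (a \<oplus> b) \<odot>\<^bsub>M\<^esub> x = a \<odot>\<^bsub>M\<^esub> x \<oplus>\<^bsub>M\<^esub> b \<odot>\<^bsub>M\<^esub> x"
    and smult_r_distr:
      "\<lbrakk>a \<in> carrier R; x \<in> carrier M; y \<in> carrier M\<rbrakk> \<Longrightarrow>
        a \<odot>\<^bsub>M\<^esub> (x \<oplus>\<^bsub>M\<^esub> y) = a \<odot>\<^bsub>M\<^esub> x \<oplus>\<^bsub>M\<^esub> a \<odot>\<^bsub>M\<^esub> y"
    and smult_assoc:
      "\<lbrakk>a \<in> carrier R; b \<in> carrier R; x \<in> carrier M\<rbrakk> \<Longrightarrow>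
        (a \<otimes> b) \<odot>\<^bsub>M\<^esub> x = a \<odot>\<^bsub>M\<^esub> (b \<odot>\<^bsub>M\<^esub> x)"
    and smult_one: "x \<in> carrier M \<Longrightarrow> \<one> \<odot>\<^bsub>M\<^esub> x = x"

definition submodule_span ::
    "('r, 'z) ring_scheme \<Rightarrow> ('r, 'm, 'w) module_scheme \<Rightarrow> 'm set \<Rightarrow> 'm set" where
  "submodule_span R M S = \<Inter>{H. submodule H R M \<and> S \<subseteq> H}"

definition finitely_generated ::
    "('r, 'z) ring_scheme \<Rightarrow> ('r, 'm, 'w) module_scheme \<Rightarrow> bool" where
  "finitely_generated R M \<longleftrightarrow>
    (\<exists>S. finite S \<and> S \<subseteq> carrier M \<and> carrier M = submodule_span R M S)"

definition noetherian_module ::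
    "('r, 'z) ring_scheme \<Rightarrow> ('r, 'm, 'w) module_scheme \<Rightarrow> bool" where
  "noetherian_module R M \<longleftrightarrow>
    (\<forall>H. submodule H R M \<longrightarrow> (\<exists>S. finite S \<and> S \<subseteq> H \<and> H = submodule_span R M S))"

text \<open>Homomorphisms are extensional, so that equal homomorphisms are equal as functions.\<close>

definition module_hom ::
    "('r, 'z) ring_scheme \<Rightarrow> ('r, 'm, 'w) module_scheme \<Rightarrow> ('r, 'n, 'v) module_scheme \<Rightarrow> ('m \<Rightarrow> 'n) set" where
  "module_hom R M N =
    {f \<in> hom (add_monoid M) (add_monoid N) \<inter> extensional (carrier M).
      \<forall>a\<in>carrier R. \<forall>x\<in>carrier M. f (a \<odot>\<^bsub>M\<^esub> x) = a \<odot>\<^bsub>N\<^esub> f x}"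

definition free_module :: "('r, 'z) ring_scheme \<Rightarrow> 'i set \<Rightarrow> ('r, 'i \<Rightarrow> 'r) module" where
  "free_module R I =
    \<lparr>carrier = {f \<in> I \<rightarrow>\<^sub>E carrier R. finite {i \<in> I. f i \<noteq> \<zero>\<^bsub>R\<^esub>}},
     monoid.mult = undefined, one = undefined,
     ring.zero = (\<lambda>i\<in>I. \<zero>\<^bsub>R\<^esub>), ring.add = (\<lambda>f g. \<lambda>i\<in>I. f i \<oplus>\<^bsub>R\<^esub> g i),
     module.smult = (\<lambda>a f. \<lambda>i\<in>I. a \<otimes>\<^bsub>R\<^esub> f i)\<rparr>"

text \<open>
  Projective modules are the direct summands of free modules (the lifting property would quantify
  over modules of all types).  Indexing the basis by the type of \<open>P\<close> loses nothing, because
  a projective module is a summand of the free module on its own underlying set.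
\<close>

definition projective_module ::
    "('r, 'z) ring_scheme \<Rightarrow> ('r, 'p, 'w) module_scheme \<Rightarrow> bool" where
  "projective_module R P \<longleftrightarrow> left_module R P \<and>
    (\<exists>(I :: 'p set) s r. s \<in> module_hom R P (free_module R I) \<and>
       r \<in> module_hom R (free_module R I) P \<and> (\<forall>x\<in>carrier P. r (s x) = x))"

definition fin_dim_algebra ::
    "('k, 'z) ring_scheme \<Rightarrow> ('k, 'a, 'w) module_scheme \<Rightarrow> bool" where
  "fin_dim_algebra k A \<longleftrightarrow> field k \<and> ring A \<and> module k A \<and>
    (\<forall>c\<in>carrier k. \<forall>a\<in>carrier A. \<forall>b\<in>carrier A.
       c \<odot>\<^bsub>A\<^esub> (a \<otimes>\<^bsub>A\<^esub> b) = (c \<odot>\<^bsub>A\<^esub> a) \<otimes>\<^bsub>A\<^esub> b \<and>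
       c \<odot>\<^bsub>A\<^esub> (a \<otimes>\<^bsub>A\<^esub> b) = a \<otimes>\<^bsub>A\<^esub> (c \<odot>\<^bsub>A\<^esub> b)) \<and>
    finitely_generated k A"


section \<open>Resolutions and Ext\<close>

record ('r, 'p, 'm) resolution =
  res_mod :: "nat \<Rightarrow> ('r, 'p) module"
  res_diff :: "nat \<Rightarrow> 'p \<Rightarrow> 'p" \<comment> \<open>\<open>res_diff P n\<close> goes from degree \<open>n + 1\<close> to degree \<open>n\<close>\<close>
  res_aug :: "'p \<Rightarrow> 'm"

definition projective_resolution ::
    "('r, 'z) ring_scheme \<Rightarrow> ('r, 'm, 'w) module_scheme \<Rightarrow> ('r, 'p, 'm) resolution \<Rightarrow> bool" where
  "projective_resolution R M P \<longleftrightarrow>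
    (\<forall>n. projective_module R (res_mod P n)) \<and>
    (\<forall>n. res_diff P n \<in> module_hom R (res_mod P (Suc n)) (res_mod P n)) \<and>
    res_aug P \<in> module_hom R (res_mod P 0) M \<and>
    res_aug P ` carrier (res_mod P 0) = carrier M \<and>
    res_diff P 0 ` carrier (res_mod P (Suc 0)) =
      {x \<in> carrier (res_mod P 0). res_aug P x = \<zero>\<^bsub>M\<^esub>} \<and>
    (\<forall>n. res_diff P (Suc n) ` carrier (res_mod P (Suc (Suc n))) =
      {x \<in> carrier (res_mod P (Suc n)). res_diff P n x = \<zero>\<^bsub>res_mod P n\<^esub>})"

text \<open>
  The groups below are abelian but written multiplicatively, to match the quotient \<open>G Mod H\<close> and
  the direct sum \<^const>\<open>sum_group\<close> of the library.
\<close>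

definition hom_group ::
    "('r, 'z) ring_scheme \<Rightarrow> ('r, 'm, 'w) module_scheme \<Rightarrow> ('r, 'n, 'v) module_scheme \<Rightarrow> ('m \<Rightarrow> 'n) monoid" where
  "hom_group R M N =
    \<lparr>carrier = module_hom R M N,
     monoid.mult = (\<lambda>f g. \<lambda>x\<in>carrier M. f x \<oplus>\<^bsub>N\<^esub> g x),
     one = (\<lambda>x\<in>carrier M. \<zero>\<^bsub>N\<^esub>)\<rparr>"

definition cocycles ::
    "('r, 'z) ring_scheme \<Rightarrow> ('r, 'p, 'm) resolution \<Rightarrow> ('r, 'n, 'v) module_scheme \<Rightarrow> nat \<Rightarrow> ('p \<Rightarrow> 'n) set" where
  "cocycles R P N n =
    {f \<in> module_hom R (res_mod P n) N.
      \<forall>x\<in>carrier (res_mod P (Suc n)). f (res_diff P n x) = \<zero>\<^bsub>N\<^esub>}"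

definition coboundaries ::
    "('r, 'z) ring_scheme \<Rightarrow> ('r, 'p, 'm) resolution \<Rightarrow> ('r, 'n, 'v) module_scheme \<Rightarrow> nat \<Rightarrow> ('p \<Rightarrow> 'n) set" where
  "coboundaries R P N n =
    (case n of
       0 \<Rightarrow> {\<one>\<^bsub>hom_group R (res_mod P 0) N\<^esub>}
     | Suc m \<Rightarrow> (\<lambda>g. compose (carrier (res_mod P n)) g (res_diff P m)) ` module_hom R (res_mod P m) N)"

text \<open>
  If \<open>P\<close> is a projective resolution of \<open>M\<close>, then \<open>Ext R P N n\<close> is
  \<open>Ext\<^sup>n\<^sub>R(M, N)\<close>, the \<open>n\<close>-th cohomology of \<open>Hom\<^sub>R(P, N)\<close>.
\<close>

definition Ext ::
    "('r, 'z) ring_scheme \<Rightarrow> ('r, 'p, 'm) resolution \<Rightarrow> ('r, 'n, 'v) module_scheme \<Rightarrow> nat \<Rightarrow> ('p \<Rightarrow> 'n) set monoid" where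
  "Ext R P N n =
    (hom_group R (res_mod P n) N)\<lparr>carrier := cocycles R P N n\<rparr> Mod coboundaries R P N n"

definition ext_class ::
    "('r, 'z) ring_scheme \<Rightarrow> ('r, 'p, 'm) resolution \<Rightarrow> ('r, 'n, 'v) module_scheme \<Rightarrow> nat \<Rightarrow> ('p \<Rightarrow> 'n) \<Rightarrow> ('p \<Rightarrow> 'n) set" where
  "ext_class R P N n f = coboundaries R P N n #>\<^bsub>hom_group R (res_mod P n) N\<^esub> f"

text \<open>
  \<open>chain_lifts R P n Q e\<close> consists of the chain maps \<open>P\<^bsub>n+i\<^esub> \<rightarrow> Q\<^sub>i\<close> lifting a map \<open>e\<close> from
  \<open>P\<^sub>n\<close> to the module resolved by \<open>Q\<close>.  They commute with the differentials without signs.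
\<close>

definition chain_lifts ::
    "('r, 'z) ring_scheme \<Rightarrow> ('r, 'p, 'm) resolution \<Rightarrow> nat \<Rightarrow> ('r, 'q, 'l) resolution \<Rightarrow>
      ('p \<Rightarrow> 'l) \<Rightarrow> (nat \<Rightarrow> 'p \<Rightarrow> 'q) set" where
  "chain_lifts R P n Q e =
    {c. (\<forall>i. c i \<in> module_hom R (res_mod P (n + i)) (res_mod Q i)) \<and>
        (\<forall>x\<in>carrier (res_mod P n). res_aug Q (c 0 x) = e x) \<and>
        (\<forall>i. \<forall>x\<in>carrier (res_mod P (Suc (n + i))).
           res_diff Q i (c (Suc i) x) = c i (res_diff P (n + i) x))}"

text \<open>
  The Yoneda product \<open>Ext\<^sup>m(L, N) \<times> Ext\<^sup>n(M, L) \<rightarrow> Ext\<^bsup>n+m\<^esup>(M, N)\<close>, where \<open>P\<close> resolves \<open>M\<close> and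
  \<open>Q\<close> resolves \<open>L\<close>.  The class of \<open>f \<circ> c\<^sub>m\<close> does not depend on the representatives \<open>f\<close>, \<open>e\<close> nor
  on the lift \<open>c\<close> of \<open>e\<close>; as for products of cosets, we take the union over all choices.
\<close>

definition yoneda ::
    "('r, 'z) ring_scheme \<Rightarrow> ('r, 'p, 'm) resolution \<Rightarrow> ('r, 'q, 'l) resolution \<Rightarrow> ('r, 'n, 'v) module_scheme \<Rightarrow>
      nat \<Rightarrow> nat \<Rightarrow> ('q \<Rightarrow> 'n) set \<Rightarrow> ('p \<Rightarrow> 'l) set \<Rightarrow> ('p \<Rightarrow> 'n) set" where
  "yoneda R P Q N m n \<zeta> \<eta> =
    (\<Union>f\<in>\<zeta>. \<Union>e\<in>\<eta>. \<Union>c\<in>chain_lifts R P n Q e.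
       ext_class R P N (n + m) (compose (carrier (res_mod P (n + m))) f (c m)))"


section \<open>Tensor products\<close>

text \<open>\<open>X \<otimes>\<^sub>S Y\<close> for a right module \<open>X\<close> and a left module \<open>Y\<close> over \<open>S\<close>.\<close>

definition tensor_relations ::
    "('s, 'z) ring_scheme \<Rightarrow> ('s, 'x, 'w) module_scheme \<Rightarrow> ('s, 'y, 'v) module_scheme \<Rightarrow> ('x \<times> 'y \<Rightarrow>\<^sub>0 int) set" where
  "tensor_relations S X Y =
    {frag_of (x \<oplus>\<^bsub>X\<^esub> x', y) - frag_of (x, y) - frag_of (x', y) | x x' y.
       x \<in> carrier X \<and> x' \<in> carrier X \<and> y \<in> carrier Y} \<union>
    {frag_of (x, y \<oplus>\<^bsub>Y\<^esub> y') - frag_of (x, y) - frag_of (x, y') | x y y'.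
       x \<in> carrier X \<and> y \<in> carrier Y \<and> y' \<in> carrier Y} \<union>
    {frag_of (s \<odot>\<^bsub>X\<^esub> x, y) - frag_of (x, s \<odot>\<^bsub>Y\<^esub> y) | s x y.
       s \<in> carrier S \<and> x \<in> carrier X \<and> y \<in> carrier Y}"

definition tensor_kernel ::
    "('s, 'z) ring_scheme \<Rightarrow> ('s, 'x, 'w) module_scheme \<Rightarrow> ('s, 'y, 'v) module_scheme \<Rightarrow> ('x \<times> 'y \<Rightarrow>\<^sub>0 int) set" where
  "tensor_kernel S X Y =
    generate (free_Abelian_group (carrier X \<times> carrier Y)) (tensor_relations S X Y)"

definition pure_tensor ::
    "('s, 'z) ring_scheme \<Rightarrow> ('s, 'x, 'w) module_scheme \<Rightarrow> ('s, 'y, 'v) module_scheme \<Rightarrow>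
      'x \<Rightarrow> 'y \<Rightarrow> ('x \<times> 'y \<Rightarrow>\<^sub>0 int) set" where
  "pure_tensor S X Y x y =
    tensor_kernel S X Y #>\<^bsub>free_Abelian_group (carrier X \<times> carrier Y)\<^esub> frag_of (x, y)"

text \<open>The underlying additive group; its multiplication and unit are irrelevant.\<close>

definition tensor_group ::
    "('s, 'z) ring_scheme \<Rightarrow> ('s, 'x, 'w) module_scheme \<Rightarrow> ('s, 'y, 'v) module_scheme \<Rightarrow> ('x \<times> 'y \<Rightarrow>\<^sub>0 int) set ring" where
  "tensor_group S X Y =
    (let G = free_Abelian_group (carrier X \<times> carrier Y) Mod tensor_kernel S X Y in
     \<lparr>carrier = carrier G, monoid.mult = undefined, one = undefined,
      ring.zero = \<one>\<^bsub>G\<^esub>, ring.add = monoid.mult G\<rparr>)"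

text \<open>
  The additive map \<open>X \<otimes>\<^sub>S Y \<rightarrow> Z\<close> with \<open>x \<otimes> y \<mapsto> \<beta> x y\<close>, for a balanced biadditive \<open>\<beta>\<close>.  Elements
  of the tensor product are cosets of formal sums, on which the value is then constant.
\<close>

definition tensor_lift ::
    "('z, 'w) ring_scheme \<Rightarrow> ('x \<Rightarrow> 'y \<Rightarrow> 'z) \<Rightarrow> ('x \<times> 'y \<Rightarrow>\<^sub>0 int) set \<Rightarrow> 'z" where
  "tensor_lift Z \<beta> U =
    the_elem ((\<lambda>u. \<Oplus>\<^bsub>Z\<^esub>p\<in>Poly_Mapping.keys u.
       [Poly_Mapping.lookup u p] \<cdot>\<^bsub>Z\<^esub> \<beta> (fst p) (snd p)) ` U)"

definition opposite :: "('k, 'a, 'w) module_scheme \<Rightarrow> ('k, 'a, 'w) module_scheme" where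
  "opposite A = A\<lparr>monoid.mult := (\<lambda>a b. b \<otimes>\<^bsub>A\<^esub> a)\<rparr>"

definition tensor_algebra ::
    "('k, 'z) ring_scheme \<Rightarrow> ('k, 'a, 'w) module_scheme \<Rightarrow> ('k, 'b, 'v) module_scheme \<Rightarrow> ('a \<times> 'b \<Rightarrow>\<^sub>0 int) set ring" where
  "tensor_algebra k A B =
    (tensor_group k A B)
      \<lparr>monoid.mult := (\<lambda>U V.
         tensor_lift (tensor_group k A B) (\<lambda>a b.
           tensor_lift (tensor_group k A B) (\<lambda>a' b'.
             pure_tensor k A B (a \<otimes>\<^bsub>A\<^esub> a') (b \<otimes>\<^bsub>B\<^esub> b')) V) U),
       one := pure_tensor k A B \<one>\<^bsub>A\<^esub> \<one>\<^bsub>B\<^esub>\<rparr>"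

definition enveloping_algebra ::
    "('k, 'z) ring_scheme \<Rightarrow> ('k, 'a, 'w) module_scheme \<Rightarrow> ('a \<times> 'a \<Rightarrow>\<^sub>0 int) set ring" where
  "enveloping_algebra k A = tensor_algebra k A (opposite A)"

text \<open>
  A left module \<open>X\<close> over the enveloping algebra is a bimodule via \<open>a \<cdot> x = (a \<otimes> 1) x\<close> and
  \<open>x \<cdot> a = (1 \<otimes> a) x\<close>.
\<close>

definition bimodule_left ::
    "('k, 'z) ring_scheme \<Rightarrow> ('k, 'a, 'w) module_scheme \<Rightarrow>
      (('a \<times> 'a \<Rightarrow>\<^sub>0 int) set, 'x, 'v) module_scheme \<Rightarrow> 'a \<Rightarrow> 'x \<Rightarrow> 'x" where
  "bimodule_left k A X a x = pure_tensor k A (opposite A) a \<one>\<^bsub>A\<^esub> \<odot>\<^bsub>X\<^esub> x"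

definition bimodule_right ::
    "('k, 'z) ring_scheme \<Rightarrow> ('k, 'a, 'w) module_scheme \<Rightarrow>
      (('a \<times> 'a \<Rightarrow>\<^sub>0 int) set, 'x, 'v) module_scheme \<Rightarrow> ('a, 'x) module" where
  "bimodule_right k A X =
    \<lparr>carrier = carrier X, monoid.mult = monoid.mult X, one = \<one>\<^bsub>X\<^esub>, ring.zero = \<zero>\<^bsub>X\<^esub>, ring.add = ring.add X,
     module.smult = (\<lambda>a x. pure_tensor k A (opposite A) \<one>\<^bsub>A\<^esub> a \<odot>\<^bsub>X\<^esub> x)\<rparr>"

definition regular_bimodule ::
    "('k, 'a, 'w) module_scheme \<Rightarrow> (('a \<times> 'a \<Rightarrow>\<^sub>0 int) set, 'a) module" where
  "regular_bimodule A =
    \<lparr>carrier = carrier A, monoid.mult = monoid.mult A, one = \<one>\<^bsub>A\<^esub>, ring.zero = \<zero>\<^bsub>A\<^esub>, ring.add = ring.add A,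
     module.smult = (\<lambda>U x. tensor_lift A (\<lambda>a b. a \<otimes>\<^bsub>A\<^esub> x \<otimes>\<^bsub>A\<^esub> b) U)\<rparr>"

text \<open>The left \<open>A\<close>-module \<open>X \<otimes>\<^sub>A M\<close> for a bimodule \<open>X\<close>\<close>

definition bimodule_tensor ::
    "('k, 'z) ring_scheme \<Rightarrow> ('k, 'a, 'w) module_scheme \<Rightarrow>
      (('a \<times> 'a \<Rightarrow>\<^sub>0 int) set, 'x, 'v) module_scheme \<Rightarrow> ('a, 'm, 'u) module_scheme \<Rightarrow>
      ('a, ('x \<times> 'm \<Rightarrow>\<^sub>0 int) set) module" where
  "bimodule_tensor k A X M =
    (let T = tensor_group A (bimodule_right k A X) M in
     \<lparr>carrier = carrier T, monoid.mult = monoid.mult T, one = \<one>\<^bsub>T\<^esub>, ring.zero = \<zero>\<^bsub>T\<^esub>, ring.add = ring.add T,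
      module.smult = (\<lambda>a. tensor_lift T (\<lambda>x m.
        pure_tensor A (bimodule_right k A X) M (bimodule_left k A X a x) m))\<rparr>)"

text \<open>
  If \<open>P\<close> is a bimodule resolution of \<open>A\<close>, then \<open>P \<otimes>\<^sub>A M\<close> is a resolution of \<open>A \<otimes>\<^sub>A M = M\<close>.
\<close>

definition tensor_resolution ::
    "('k, 'z) ring_scheme \<Rightarrow> ('k, 'a, 'w) module_scheme \<Rightarrow>
      (('a \<times> 'a \<Rightarrow>\<^sub>0 int) set, 'p, 'a) resolution \<Rightarrow> ('a, 'm, 'u) module_scheme \<Rightarrow>
      ('a, ('p \<times> 'm \<Rightarrow>\<^sub>0 int) set, 'm) resolution" where
  "tensor_resolution k A P M =
    \<lparr>res_mod = (\<lambda>n. bimodule_tensor k A (res_mod P n) M),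
     res_diff = (\<lambda>n. tensor_lift (bimodule_tensor k A (res_mod P n) M) (\<lambda>x m.
       pure_tensor A (bimodule_right k A (res_mod P n)) M (res_diff P n x) m)),
     res_aug = tensor_lift M (\<lambda>x m. res_aug P x \<odot>\<^bsub>M\<^esub> m)\<rparr>"


section \<open>Hochschild cohomology and its action on Ext\<close>

text \<open>In this section \<open>P\<close> is a projective resolution of \<open>A\<close> over the enveloping algebra.\<close>

definition HH ::
    "('k, 'z) ring_scheme \<Rightarrow> ('k, 'a, 'w) module_scheme \<Rightarrow>
      (('a \<times> 'a \<Rightarrow>\<^sub>0 int) set, 'p, 'a) resolution \<Rightarrow> nat \<Rightarrow> ('p \<Rightarrow> 'a) set monoid" where
  "HH k A P n = Ext (enveloping_algebra k A) P (regular_bimodule A) n"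

definition HH_ring ::
    "('k, 'z) ring_scheme \<Rightarrow> ('k, 'a, 'w) module_scheme \<Rightarrow>
      (('a \<times> 'a \<Rightarrow>\<^sub>0 int) set, 'p, 'a) resolution \<Rightarrow> (nat \<Rightarrow> ('p \<Rightarrow> 'a) set) ring" where
  "HH_ring k A P =
    (let S = sum_group UNIV (HH k A P) in
     \<lparr>carrier = carrier S,
      monoid.mult = (\<lambda>\<zeta> \<xi> n. finprod (HH k A P n)
        (\<lambda>i. yoneda (enveloping_algebra k A) P P (regular_bimodule A) i (n - i) (\<zeta> i) (\<xi> (n - i)))
        {..n}),
      one = (\<lambda>n. if n = 0
        then ext_class (enveloping_algebra k A) P (regular_bimodule A) 0 (res_aug P)
        else \<one>\<^bsub>HH k A P n\<^esub>),
      ring.zero = \<one>\<^bsub>S\<^esub>, ring.add = monoid.mult S\<rparr>)"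

text \<open>
  The map \<open>\<phi>\<^sub>M\<close> in degree \<open>n\<close>, where \<open>Q\<close> is a projective resolution of \<open>M\<close>.  Tensoring with \<open>M\<close>
  turns a cocycle \<open>f : P\<^sub>n \<rightarrow> A\<close> into \<open>f \<otimes> M : P\<^sub>n \<otimes>\<^sub>A M \<rightarrow> A \<otimes>\<^sub>A M = M\<close>, which is then transported
  to \<open>Q\<close> along a comparison map \<open>Q \<rightarrow> P \<otimes>\<^sub>A M\<close> over the identity of \<open>M\<close>.  In terms of extensions:
  if \<open>f\<close> is part of a chain map from \<open>P\<close> to an \<open>n\<close>-fold bimodule extension \<open>E\<close> of \<open>A\<close> by \<open>A\<close>, then
  the composite \<open>Q \<rightarrow> P \<otimes>\<^sub>A M \<rightarrow> E \<otimes>\<^sub>A M\<close> represents the class of \<open>E \<otimes>\<^sub>A M\<close>.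
\<close>

definition HH_to_Ext ::
    "('k, 'z) ring_scheme \<Rightarrow> ('k, 'a, 'w) module_scheme \<Rightarrow>
      (('a \<times> 'a \<Rightarrow>\<^sub>0 int) set, 'p, 'a) resolution \<Rightarrow> ('a, 'm, 'u) module_scheme \<Rightarrow>
      ('a, 'q, 'm) resolution \<Rightarrow> nat \<Rightarrow> ('p \<Rightarrow> 'a) set \<Rightarrow> ('q \<Rightarrow> 'm) set" where
  "HH_to_Ext k A P M Q n \<zeta> =
    (\<Union>f\<in>\<zeta>. \<Union>c\<in>chain_lifts A Q 0 (tensor_resolution k A P M) (res_aug Q).
       ext_class A Q M n
         (compose (carrier (res_mod Q n)) (tensor_lift M (\<lambda>x m. f x \<odot>\<^bsub>M\<^esub> m)) (c n)))"

text \<open>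
  The left module \<open>\<Oplus>\<^bsub>n \<ge> n0\<^esub> Ext\<^sup>n\<^sub>A(M, N)\<close> over the Hochschild cohomology ring, with action through
  \<open>\<phi>\<^sub>N\<close> and the Yoneda product.  Here \<open>QM\<close> resolves \<open>M\<close> and \<open>QN\<close> resolves \<open>N\<close>.
\<close>

definition Ext_from ::
    "('k, 'z) ring_scheme \<Rightarrow> ('k, 'a, 'w) module_scheme \<Rightarrow>
      (('a \<times> 'a \<Rightarrow>\<^sub>0 int) set, 'p, 'a) resolution \<Rightarrow> ('a, 'q, 'm) resolution \<Rightarrow>
      ('a, 'n, 'v) module_scheme \<Rightarrow> ('a, 'r, 'n) resolution \<Rightarrow> int \<Rightarrow>
      (nat \<Rightarrow> ('p \<Rightarrow> 'a) set, nat \<Rightarrow> ('q \<Rightarrow> 'n) set) module" where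
  "Ext_from k A P QM N QN n0 =
    (let I = {n. n0 \<le> int n}; S = sum_group I (Ext A QM N) in
     \<lparr>carrier = carrier S, monoid.mult = undefined, one = undefined,
      ring.zero = \<one>\<^bsub>S\<^esub>, ring.add = monoid.mult S,
      module.smult = (\<lambda>\<zeta> \<eta>. \<lambda>n\<in>I. finprod (Ext A QM N n)
        (\<lambda>i. yoneda A QM QN N i (n - i) (HH_to_Ext k A P N QN i (\<zeta> i)) (\<eta> (n - i)))
        {i. i \<le> n \<and> n - i \<in> I})\<rparr>)"

end

theory Submission
  imports Defs
begin

text \<open>
  Write \<open>E\<close> for the graded group \<open>Ext\<^bsup>\<ge>n0\<^esup>(M, N)\<close>.  A class of degree \<open>d\<close> in Hochschild cohomology acts on \<open>E\<close>
  as an operator of degree \<open>d\<close>, and any two such operators commute up to sign.  If some operator \<open>\<zeta>\<close> of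
  degree \<open>d > 0\<close> has an element \<open>y\<close> of degree \<open>n\<close> with \<open>\<zeta>\<^sup>m y \<noteq> 0\<close> for all \<open>m\<close>, then \<open>Ext\<^bsup>n+md\<^esup>(M, N) \<noteq> 0\<close> for all
  \<open>m\<close>, and this is the required progression.

  Suppose there is none, so that all operators of positive degree are locally nilpotent, and suppose
  that \<open>E\<close> is nonzero in arbitrarily high degrees.  As \<open>E\<close> is Noetherian, some graded submodule \<open>F\<close> is
  maximal among those for which \<open>E/F\<close> is nonzero in arbitrarily high degrees.  Let \<open>\<zeta>\<close> have positive
  degree.  Since the operators commute up to sign, \<open>F + \<zeta>E\<close> is a submodule; if it were larger than
  \<open>F\<close>, then \<open>E = F + \<zeta>E\<close> in high degrees, and by iteration \<open>E = F + \<zeta>\<^sup>m E\<close> in still higher degrees.  But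
  a power of \<open>\<zeta>\<close> kills the finitely many generators of \<open>E\<close>, hence all of \<open>E\<close>, so \<open>E = F\<close> in high degrees,
  a contradiction.  Hence all operators of positive degree map \<open>E\<close> into \<open>F\<close>, and finite generation
  of \<open>E\<close> forces \<open>E = F\<close> above the degrees of the generators, which is again a contradiction.  This is
  \<open>exists_non_nilpotent\<close>.

  It remains to see that the operators commute up to sign (\<open>act_commute\<close>).  Let \<open>P\<close> be a projective
  bimodule resolution of the algebra \<open>A\<close> and \<open>Q\<close> a projective resolution of \<open>M\<close>.  The complex of right
  modules \<open>P \<rightarrow> A\<close> is contractible, so \<open>P \<otimes>\<^sub>A L\<close> is a resolution of \<open>L\<close> for every module \<open>L\<close>
  (\<open>tensor_resolution_exact\<close>).  Therefore the action of the class of a cocycle \<open>f : P\<^sub>i \<rightarrow> A\<close> on the class of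
  a cocycle \<open>e : Q\<^sub>n \<rightarrow> N\<close> can be computed by lifting \<open>e\<close> in any way to a chain map from \<open>Q\<close>, shifted by \<open>n\<close>, to
  \<open>P \<otimes>\<^sub>A N\<close> and composing with \<open>f \<otimes> N\<close> (\<open>HH_action\<close>).  A comparison \<open>\<Delta>\<close> of \<open>Q\<close> with the total complex of
  \<open>P \<otimes>\<^sub>A Q\<close> (\<open>double_complex\<close>) yields the lift \<open>(1 \<otimes> e)\<Delta>\<close> for all \<open>e\<close> simultaneously, so \<open>f\<close> acts as
  \<open>e \<mapsto> e \<circ> g\<close> with \<open>g = (f \<otimes> 1)\<Delta>\<close>, which is a chain map \<open>Q \<rightarrow> Q\<close> of degree \<open>-i\<close> up to sign
  (\<open>cocycle_chain_map\<close>).  Finally, a lift of \<open>e\<close> composed with \<open>g\<close> is up to signs a lift of \<open>e \<circ> g\<close>; acting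
  on it with a second cocycle \<open>f'\<close> shows that \<open>f'\<close> and \<open>f\<close> may be exchanged at the cost of a sign.
\<close>

section \<open>Linear maps and projective modules\<close>

abbreviation add_hom :: "('a, 'z) ring_scheme \<Rightarrow> ('b, 'w) ring_scheme \<Rightarrow> ('a \<Rightarrow> 'b) set" where
  "add_hom M N \<equiv> hom (add_monoid M) (add_monoid N)"

definition linear_map ::
    "('r, 'z) ring_scheme \<Rightarrow> ('r, 'm, 'w) module_scheme \<Rightarrow> ('r, 'n, 'v) module_scheme \<Rightarrow> ('m \<Rightarrow> 'n) set" where
  "linear_map R M N =
    {f \<in> add_hom M N. \<forall>a\<in>carrier R. \<forall>x\<in>carrier M. f (a \<odot>\<^bsub>M\<^esub> x) = a \<odot>\<^bsub>N\<^esub> f x}"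

lemma add_homI:
  assumes "\<And>x. x \<in> carrier M \<Longrightarrow> f x \<in> carrier N"
    and "\<And>x y. x \<in> carrier M \<Longrightarrow> y \<in> carrier M \<Longrightarrow> f (x \<oplus>\<^bsub>M\<^esub> y) = f x \<oplus>\<^bsub>N\<^esub> f y"
  shows "f \<in> add_hom M N"
  using assms by (auto simp: hom_def)

lemma add_hom_closed: "f \<in> add_hom M N \<Longrightarrow> x \<in> carrier M \<Longrightarrow> f x \<in> carrier N"
  by (auto simp: hom_def)

lemma add_hom_add:
  "f \<in> add_hom M N \<Longrightarrow> x \<in> carrier M \<Longrightarrow> y \<in> carrier M \<Longrightarrow> f (x \<oplus>\<^bsub>M\<^esub> y) = f x \<oplus>\<^bsub>N\<^esub> f y"
  by (auto simp: hom_def)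

lemma add_hom_zero:
  assumes "abelian_group M" "abelian_group N" "f \<in> add_hom M N"
  shows "f \<zero>\<^bsub>M\<^esub> = \<zero>\<^bsub>N\<^esub>"
  using hom_one[OF assms(3)] assms(1,2)[THEN abelian_group.a_group] by simp

lemma add_hom_minus:
  assumes "abelian_group M" "abelian_group N" "f \<in> add_hom M N" "x \<in> carrier M"
  shows "f (\<ominus>\<^bsub>M\<^esub> x) = \<ominus>\<^bsub>N\<^esub> f x"
  using group_hom.hom_inv[of "add_monoid M" "add_monoid N" f x]
    assms(1,2)[THEN abelian_group.a_group] assms(3,4)
  by (simp add: group_hom_def group_hom_axioms_def a_inv_def)

lemma add_hom_comp:
  "f \<in> add_hom L M \<Longrightarrow> g \<in> add_hom M N \<Longrightarrow> (\<lambda>x. g (f x)) \<in> add_hom L N"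
  by (auto simp: hom_def Pi_iff)

lemma linear_mapI:
  assumes "\<And>x. x \<in> carrier M \<Longrightarrow> f x \<in> carrier N"
    and "\<And>x y. x \<in> carrier M \<Longrightarrow> y \<in> carrier M \<Longrightarrow> f (x \<oplus>\<^bsub>M\<^esub> y) = f x \<oplus>\<^bsub>N\<^esub> f y"
    and "\<And>a x. a \<in> carrier R \<Longrightarrow> x \<in> carrier M \<Longrightarrow> f (a \<odot>\<^bsub>M\<^esub> x) = a \<odot>\<^bsub>N\<^esub> f x"
  shows "f \<in> linear_map R M N"
  using assms by (auto simp: hom_def linear_map_def)

lemma linear_map_add_hom: "f \<in> linear_map R M N \<Longrightarrow> f \<in> add_hom M N"
  by (simp add: linear_map_def)

lemma linear_map_smult:
  "f \<in> linear_map R M N \<Longrightarrow> a \<in> carrier R \<Longrightarrow> x \<in> carrier M \<Longrightarrow> f (a \<odot>\<^bsub>M\<^esub> x) = a \<odot>\<^bsub>N\<^esub> f x"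
  by (simp add: linear_map_def)

lemmas linear_map_closed = add_hom_closed[OF linear_map_add_hom]
lemmas linear_map_add = add_hom_add[OF linear_map_add_hom]

lemma linear_map_comp:
  "f \<in> linear_map R L M \<Longrightarrow> g \<in> linear_map R M N \<Longrightarrow> (\<lambda>x. g (f x)) \<in> linear_map R L N"
  by (auto simp: linear_map_def hom_def Pi_iff)

lemma linear_map_id: "(\<lambda>x. x) \<in> linear_map R M M"
  by (auto simp: linear_map_def hom_def)

lemma module_hom_iff: "f \<in> module_hom R M N \<longleftrightarrow> f \<in> linear_map R M N \<and> f \<in> extensional (carrier M)"
  by (auto simp: module_hom_def linear_map_def)

lemma module_hom_linear: "f \<in> module_hom R M N \<Longrightarrow> f \<in> linear_map R M N"
  by (simp add: module_hom_iff)

lemma left_module_abelian_group: "left_module R M \<Longrightarrow> abelian_group M"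
  by (simp add: left_module_def)

lemma left_module_ring: "left_module R M \<Longrightarrow> ring R"
  by (simp add: left_module_def)

lemma module_hom_restrict:
  assumes "abelian_group M" "\<And>a x. a \<in> carrier R \<Longrightarrow> x \<in> carrier M \<Longrightarrow> a \<odot>\<^bsub>M\<^esub> x \<in> carrier M"
    and "f \<in> linear_map R M N"
  shows "restrict f (carrier M) \<in> module_hom R M N"
proof -
  interpret M: abelian_group M by fact
  show ?thesis
    using assms(2,3) by (auto simp: module_hom_iff linear_map_def hom_def Pi_iff)
qed

lemma left_module_hom_restrict:
  "left_module R M \<Longrightarrow> f \<in> linear_map R M N \<Longrightarrow> restrict f (carrier M) \<in> module_hom R M N"
  by (rule module_hom_restrict) (auto intro: left_module_abelian_group left_module.smult_closed)

lemma linear_map_zero: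
  "left_module R M \<Longrightarrow> left_module R N \<Longrightarrow> f \<in> linear_map R M N \<Longrightarrow> f \<zero>\<^bsub>M\<^esub> = \<zero>\<^bsub>N\<^esub>"
  by (meson add_hom_zero left_module_abelian_group linear_map_add_hom)

lemma linear_map_minus:
  "left_module R M \<Longrightarrow> left_module R N \<Longrightarrow> f \<in> linear_map R M N \<Longrightarrow> x \<in> carrier M \<Longrightarrow>
    f (\<ominus>\<^bsub>M\<^esub> x) = \<ominus>\<^bsub>N\<^esub> f x"
  by (meson add_hom_minus left_module_abelian_group linear_map_add_hom)

lemma smult_add_hom: "left_module R M \<Longrightarrow> a \<in> carrier R \<Longrightarrow> (\<lambda>x. a \<odot>\<^bsub>M\<^esub> x) \<in> add_hom M M"
  by (rule add_homI) (auto intro: left_module.smult_closed left_module.smult_r_distr)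

lemma smult_zero: "left_module R M \<Longrightarrow> a \<in> carrier R \<Longrightarrow> a \<odot>\<^bsub>M\<^esub> \<zero>\<^bsub>M\<^esub> = \<zero>\<^bsub>M\<^esub>"
  using add_hom_zero[OF _ _ smult_add_hom] by (metis left_module_abelian_group)

lemma smult_minus:
  "left_module R M \<Longrightarrow> a \<in> carrier R \<Longrightarrow> x \<in> carrier M \<Longrightarrow> a \<odot>\<^bsub>M\<^esub> (\<ominus>\<^bsub>M\<^esub> x) = \<ominus>\<^bsub>M\<^esub> (a \<odot>\<^bsub>M\<^esub> x)"
  using add_hom_minus[OF _ _ smult_add_hom] by (metis left_module_abelian_group)

lemma linear_map_sum:
  assumes "left_module R M" "left_module R N" "f \<in> linear_map R M N" "g \<in> linear_map R M N"
  shows "(\<lambda>x. f x \<oplus>\<^bsub>N\<^esub> g x) \<in> linear_map R M N"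
proof -
  interpret N: abelian_group N using assms by (simp add: left_module_abelian_group)
  show ?thesis
    using assms
    by (intro linear_mapI)
       (auto simp: linear_map_closed linear_map_add linear_map_smult left_module.smult_r_distr N.a_ac)
qed

lemma linear_map_uminus:
  assumes "left_module R M" "left_module R N" "f \<in> linear_map R M N"
  shows "(\<lambda>x. \<ominus>\<^bsub>N\<^esub> f x) \<in> linear_map R M N"
proof -
  interpret N: abelian_group N using assms by (simp add: left_module_abelian_group)
  show ?thesis
    using assms
    by (intro linear_mapI)
       (auto simp: linear_map_closed linear_map_add linear_map_smult smult_minus N.minus_add)
qed

lemma linear_map_zero_map:
  assumes "left_module R M" "left_module R N"
  shows "(\<lambda>x. \<zero>\<^bsub>N\<^esub>) \<in> linear_map R M N"
proof -
  interpret N: abelian_group N using assms by (simp add: left_module_abelian_group)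
  show ?thesis by (intro linear_mapI) (auto simp: smult_zero[OF assms(2)])
qed

definition free_single :: "('r, 'z) ring_scheme \<Rightarrow> 'i set \<Rightarrow> 'i \<Rightarrow> 'r \<Rightarrow> 'i \<Rightarrow> 'r" where
  "free_single R I i u = (\<lambda>j\<in>I. if j = i then u else \<zero>\<^bsub>R\<^esub>)"

lemma free_module_simps:
  "carrier (free_module R I) = {f \<in> I \<rightarrow>\<^sub>E carrier R. finite {i \<in> I. f i \<noteq> \<zero>\<^bsub>R\<^esub>}}"
  "x \<oplus>\<^bsub>free_module R I\<^esub> y = (\<lambda>i\<in>I. x i \<oplus>\<^bsub>R\<^esub> y i)"
  "a \<odot>\<^bsub>free_module R I\<^esub> x = (\<lambda>i\<in>I. a \<otimes>\<^bsub>R\<^esub> x i)"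
  "\<zero>\<^bsub>free_module R I\<^esub> = (\<lambda>i\<in>I. \<zero>\<^bsub>R\<^esub>)"
  by (simp_all add: free_module_def)

context ring begin

lemma free_single_closed: "i \<in> I \<Longrightarrow> u \<in> carrier R \<Longrightarrow> free_single R I i u \<in> carrier (free_module R I)"
  by (auto simp: free_single_def free_module_simps intro!: finite_subset[of _ "{i}"])

lemma free_single_add:
  "u \<in> carrier R \<Longrightarrow> v \<in> carrier R \<Longrightarrow>
    free_single R I i (u \<oplus> v) = free_single R I i u \<oplus>\<^bsub>free_module R I\<^esub> free_single R I i v"
  by (auto simp: free_single_def free_module_simps)

lemma free_single_smult:
  "a \<in> carrier R \<Longrightarrow> u \<in> carrier R \<Longrightarrow>
    free_single R I i (a \<otimes> u) = a \<odot>\<^bsub>free_module R I\<^esub> free_single R I i u"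
  by (auto simp: free_single_def free_module_simps)

lemma free_module_add_closed:
  assumes "x \<in> carrier (free_module R I)" "y \<in> carrier (free_module R I)"
  shows "x \<oplus>\<^bsub>free_module R I\<^esub> y \<in> carrier (free_module R I)"
proof -
  have "finite {i \<in> I. x i \<oplus> y i \<noteq> \<zero>}"
    by (rule finite_subset[of _ "{i \<in> I. x i \<noteq> \<zero>} \<union> {i \<in> I. y i \<noteq> \<zero>}"])
       (use assms in \<open>auto simp: free_module_simps\<close>)
  then show ?thesis
    using assms by (auto simp: free_module_simps PiE_iff extensional_def cong: conj_cong)
qed

lemma free_module_smult_closed:
  assumes "a \<in> carrier R" "y \<in> carrier (free_module R I)"
  shows "a \<odot>\<^bsub>free_module R I\<^esub> y \<in> carrier (free_module R I)"
proof -
  have "finite {i \<in> I. a \<otimes> y i \<noteq> \<zero>}"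
    by (rule finite_subset[of _ "{i \<in> I. y i \<noteq> \<zero>}"])
       (use assms in \<open>auto simp: free_module_simps\<close>)
  then show ?thesis
    using assms by (auto simp: free_module_simps PiE_iff extensional_def cong: conj_cong)
qed

lemma free_module_smult_add_hom:
  assumes "a \<in> carrier R"
  shows "(\<lambda>y. a \<odot>\<^bsub>free_module R I\<^esub> y) \<in> add_hom (free_module R I) (free_module R I)"
proof (rule add_homI)
  fix x y assume "x \<in> carrier (free_module R I)" "y \<in> carrier (free_module R I)"
  then show "a \<odot>\<^bsub>free_module R I\<^esub> (x \<oplus>\<^bsub>free_module R I\<^esub> y) =
      a \<odot>\<^bsub>free_module R I\<^esub> x \<oplus>\<^bsub>free_module R I\<^esub> a \<odot>\<^bsub>free_module R I\<^esub> y"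
    using assms by (auto simp: free_module_simps PiE_iff r_distr)
qed (use assms in \<open>simp add: free_module_smult_closed\<close>)

text \<open>
  Induction over a finite set containing the support: splitting off one coordinate writes an
  element as a basis multiple plus an element of smaller support.
\<close>

lemma free_module_add_hom_eqI:
  assumes Z: "abelian_group Z"
    and f: "f \<in> add_hom (free_module R I) Z" and g: "g \<in> add_hom (free_module R I) Z"
    and eq: "\<And>i u. i \<in> I \<Longrightarrow> u \<in> carrier R \<Longrightarrow> f (free_single R I i u) = g (free_single R I i u)"
    and x: "x \<in> carrier (free_module R I)"
  shows "f x = g x"
proof -
  interpret Z: abelian_group Z by fact
  let ?F = "free_module R I"
  have "\<forall>x\<in>carrier ?F. {i \<in> I. x i \<noteq> \<zero>} \<subseteq> J \<longrightarrow> f x = g x" if "finite J" for J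
    using that
  proof (induction J rule: finite_induct)
    case empty
    have z: "\<zero>\<^bsub>?F\<^esub> \<in> carrier ?F" "\<zero>\<^bsub>?F\<^esub> \<oplus>\<^bsub>?F\<^esub> \<zero>\<^bsub>?F\<^esub> = \<zero>\<^bsub>?F\<^esub>"
      by (auto simp: free_module_simps)
    have h0: "h \<zero>\<^bsub>?F\<^esub> = \<zero>\<^bsub>Z\<^esub>" if h: "h \<in> add_hom ?F Z" for h
      using add_hom_add[OF h z(1) z(1)] add_hom_closed[OF h z(1)] z(2)
      by (metis Z.add.l_cancel_one)
    have "x = \<zero>\<^bsub>?F\<^esub>" if "x \<in> carrier ?F" "{i \<in> I. x i \<noteq> \<zero>} \<subseteq> {}" for x
      using that by (force simp: free_module_simps PiE_iff extensional_def)
    then show ?case using h0[OF f] h0[OF g] by auto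
  next
    case (insert i J)
    show ?case
    proof (intro ballI impI)
      fix x assume x: "x \<in> carrier ?F" and supp: "{j \<in> I. x j \<noteq> \<zero>} \<subseteq> insert i J"
      show "f x = g x"
      proof (cases "i \<in> I")
        case False
        then have "{j \<in> I. x j \<noteq> \<zero>} \<subseteq> J" using supp by auto
        then show ?thesis using insert x by blast
      next
        case True
        define y where "y = x(i := \<zero>)"
        have y: "y \<in> carrier ?F"
          using x True
          by (auto simp: y_def free_module_simps PiE_iff extensional_def
              intro: finite_subset[of _ "{i \<in> I. x i \<noteq> \<zero>}"])
        have xi: "x i \<in> carrier R" using x True by (auto simp: free_module_simps)
        have "{j \<in> I. y j \<noteq> \<zero>} \<subseteq> J" using supp by (auto simp: y_def)
        then have "f y = g y" using insert.IH y by blast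
        moreover have "x = free_single R I i (x i) \<oplus>\<^bsub>?F\<^esub> y"
        proof
          fix j show "x j = (free_single R I i (x i) \<oplus>\<^bsub>?F\<^esub> y) j"
            using x True by (auto simp: free_module_simps free_single_def y_def PiE_iff extensional_def)
        qed
        ultimately show ?thesis
          using eq[OF True xi] add_hom_add[OF f free_single_closed[OF True xi] y]
            add_hom_add[OF g free_single_closed[OF True xi] y] by simp
      qed
    qed
  qed
  from this[of "{i \<in> I. x i \<noteq> \<zero>}"] show ?thesis using x by (auto simp: free_module_simps)
qed

text \<open>
  The extension sums the values over the support.  The supports of \<open>x\<close>, \<open>y\<close> and \<open>x + y\<close> differ, so
  additivity is read off from sums over a common finite superset.
\<close>

lemma free_module_universal:
  assumes Z: "abelian_group Z" and l: "\<And>i. i \<in> I \<Longrightarrow> l i \<in> add_hom R Z"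
  shows "\<exists>h\<in>add_hom (free_module R I) Z. \<forall>i\<in>I. \<forall>u\<in>carrier R. h (free_single R I i u) = l i u"
proof -
  interpret Z: abelian_group Z by fact
  let ?F = "free_module R I"
  define h where "h x = finsum Z (\<lambda>i. l i (x i)) {i \<in> I. x i \<noteq> \<zero>}" for x
  have ab: "abelian_group R" ..
  have l0: "l i \<zero> = \<zero>\<^bsub>Z\<^esub>" if "i \<in> I" for i
    using add_hom_zero[OF ab Z l[OF that]] .
  have cl: "l i (x i) \<in> carrier Z" if "i \<in> I" "x \<in> carrier ?F" for i x
    using that l[OF that(1)] by (auto simp: free_module_simps PiE_iff intro: add_hom_closed)
  have h_eq: "h x = finsum Z (\<lambda>i. l i (x i)) J"
    if "finite J" "J \<subseteq> I" "{i \<in> I. x i \<noteq> \<zero>} \<subseteq> J" "x \<in> carrier ?F" for x J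
    unfolding h_def
    by (rule Z.add.finprod_mono_neutral_cong_left) (use that l0 cl in \<open>auto\<close>)
  have "h \<in> add_hom ?F Z"
  proof (rule add_homI)
    fix x y assume x: "x \<in> carrier ?F" and y: "y \<in> carrier ?F"
    let ?J = "{i \<in> I. x i \<noteq> \<zero>} \<union> {i \<in> I. y i \<noteq> \<zero>}"
    have fin: "finite ?J" using x y by (auto simp: free_module_simps)
    have "h (x \<oplus>\<^bsub>?F\<^esub> y) = finsum Z (\<lambda>i. l i ((x \<oplus>\<^bsub>?F\<^esub> y) i)) ?J"
      by (rule h_eq) (use fin x y in \<open>auto simp: free_module_add_closed, auto simp: free_module_simps\<close>)
    also have "\<dots> = finsum Z (\<lambda>i. l i (x i) \<oplus>\<^bsub>Z\<^esub> l i (y i)) ?J"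
      by (rule Z.finsum_cong')
         (use x y cl l in \<open>auto simp: free_module_simps PiE_iff intro!: add_hom_add\<close>)
    also have "\<dots> = finsum Z (\<lambda>i. l i (x i)) ?J \<oplus>\<^bsub>Z\<^esub> finsum Z (\<lambda>i. l i (y i)) ?J"
      by (rule Z.finsum_addf) (use x y cl in auto)
    also have "\<dots> = h x \<oplus>\<^bsub>Z\<^esub> h y"
      using h_eq[of ?J x] h_eq[of ?J y] fin x y by auto
    finally show "h (x \<oplus>\<^bsub>?F\<^esub> y) = h x \<oplus>\<^bsub>Z\<^esub> h y" .
  qed (auto simp: h_def intro!: Z.finsum_closed cl)
  moreover have "h (free_single R I i u) = l i u" if i: "i \<in> I" and u: "u \<in> carrier R" for i u
  proof -
    have "h (free_single R I i u) = finsum Z (\<lambda>j. l j (free_single R I i u j)) {i}"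
      by (rule h_eq) (use i u in \<open>auto simp: free_single_closed, auto simp: free_single_def split: if_splits\<close>)
    also have "\<dots> = l i (free_single R I i u i) \<oplus>\<^bsub>Z\<^esub> \<zero>\<^bsub>Z\<^esub>"
      by (subst Z.finsum_insert) (use i u l in \<open>auto simp: free_single_def intro: add_hom_closed\<close>)
    also have "\<dots> = l i u"
      using i u add_hom_closed[OF l[OF i] u] by (simp add: free_single_def)
    finally show ?thesis .
  qed
  ultimately show ?thesis by blast
qed

end

text \<open>
  The lifting property of a direct summand of a free module: prescribe the lift on the basis, extend
  it linearly to the free module and restrict it to the summand.
\<close>

lemma projective_lift:
  fixes P :: "('r, 'p, 'w) module_scheme"
  assumes P: "projective_module R P"
    and X: "left_module R X" and Y: "left_module R Y"
    and h: "h \<in> linear_map R P Y" and g: "g \<in> linear_map R X Y"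
    and im: "\<And>p. p \<in> carrier P \<Longrightarrow> h p \<in> g ` carrier X"
  shows "\<exists>l\<in>module_hom R P X. \<forall>p\<in>carrier P. g (l p) = h p"
proof -
  have PM: "left_module R P" using P by (simp add: projective_module_def)
  interpret R: ring R using PM by (simp add: left_module_def)
  obtain I s r where s: "s \<in> module_hom R P (free_module R (I :: 'p set))"
    and r: "r \<in> module_hom R (free_module R I) P" and rs: "\<And>x. x \<in> carrier P \<Longrightarrow> r (s x) = x"
    using P unfolding projective_module_def by blast
  let ?F = "free_module R I"
  note rl = module_hom_linear[OF r] and sl = module_hom_linear[OF s]
  have "\<exists>x\<in>carrier X. g x = h (r (free_single R I i \<one>\<^bsub>R\<^esub>))" if "i \<in> I" for i
    using im[OF linear_map_closed[OF rl R.free_single_closed[OF that R.one_closed]]] by (metis imageE)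
  then obtain x where x: "\<And>i. i \<in> I \<Longrightarrow> x i \<in> carrier X"
    and gx: "\<And>i. i \<in> I \<Longrightarrow> g (x i) = h (r (free_single R I i \<one>\<^bsub>R\<^esub>))" by metis
  have abX: "abelian_group X" and abY: "abelian_group Y"
    using X Y by (auto intro: left_module_abelian_group)
  have "\<exists>L\<in>add_hom ?F X. \<forall>i\<in>I. \<forall>u\<in>carrier R. L (free_single R I i u) = u \<odot>\<^bsub>X\<^esub> x i"
    by (rule R.free_module_universal[OF abX])
       (auto intro!: add_homI left_module.smult_closed[OF X] left_module.smult_l_distr[OF X] x)
  then obtain L where L: "L \<in> add_hom ?F X"
    and Ld: "\<And>i u. i \<in> I \<Longrightarrow> u \<in> carrier R \<Longrightarrow> L (free_single R I i u) = u \<odot>\<^bsub>X\<^esub> x i" by blast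
  have L_smult: "L (a \<odot>\<^bsub>?F\<^esub> y) = a \<odot>\<^bsub>X\<^esub> L y" if a: "a \<in> carrier R" and y: "y \<in> carrier ?F" for a y
  proof (rule R.free_module_add_hom_eqI[OF abX, of "\<lambda>y. L (a \<odot>\<^bsub>?F\<^esub> y)" I "\<lambda>y. a \<odot>\<^bsub>X\<^esub> L y" y, OF _ _ _ y])
    from add_hom_comp[OF R.free_module_smult_add_hom[OF a] L] show "(\<lambda>y. L (a \<odot>\<^bsub>?F\<^esub> y)) \<in> add_hom ?F X" .
    show "(\<lambda>y. a \<odot>\<^bsub>X\<^esub> L y) \<in> add_hom ?F X"
      using add_hom_comp[OF L smult_add_hom[OF X a]] .
    show "L (a \<odot>\<^bsub>?F\<^esub> free_single R I i u) = a \<odot>\<^bsub>X\<^esub> L (free_single R I i u)" if "i \<in> I" "u \<in> carrier R" for i u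
      using that a x by (simp add: Ld left_module.smult_assoc[OF X] flip: R.free_single_smult)
  qed
  have gL: "g (L y) = h (r y)" if y: "y \<in> carrier ?F" for y
  proof (rule R.free_module_add_hom_eqI[OF abY, of "\<lambda>y. g (L y)" I "\<lambda>y. h (r y)" y, OF _ _ _ y])
    show "(\<lambda>y. g (L y)) \<in> add_hom ?F Y" using add_hom_comp[OF L linear_map_add_hom[OF g]] .
    show "(\<lambda>y. h (r y)) \<in> add_hom ?F Y"
      using linear_map_add_hom[OF linear_map_comp[OF rl h]] .
    fix i u assume i: "i \<in> I" and u: "u \<in> carrier R"
    have "g (L (free_single R I i u)) = u \<odot>\<^bsub>Y\<^esub> h (r (free_single R I i \<one>\<^bsub>R\<^esub>))"
      using i u x gx by (simp add: Ld linear_map_smult[OF g])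
    also have "\<dots> = h (r (u \<odot>\<^bsub>?F\<^esub> free_single R I i \<one>\<^bsub>R\<^esub>))"
      using i u R.free_single_closed[OF i R.one_closed]
      by (simp add: linear_map_smult[OF h] linear_map_smult[OF rl] linear_map_closed[OF rl])
    also have "\<dots> = h (r (free_single R I i u))"
      using u by (simp flip: R.free_single_smult)
    finally show "g (L (free_single R I i u)) = h (r (free_single R I i u))" .
  qed
  have "L \<in> linear_map R ?F X" using L L_smult by (simp add: linear_map_def)
  from linear_map_comp[OF sl this] have "(\<lambda>p. L (s p)) \<in> linear_map R P X" .
  then show ?thesis
    by (intro bexI[of _ "restrict (\<lambda>p. L (s p)) (carrier P)"] left_module_hom_restrict[OF PM])
       (auto simp: gL linear_map_closed[OF sl] rs)
qed

section \<open>The universal property of the tensor product\<close>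

definition balanced_map ::
    "('s, 'z) ring_scheme \<Rightarrow> ('s, 'x, 'w) module_scheme \<Rightarrow> ('s, 'y, 'v) module_scheme \<Rightarrow>
      ('t, 'u) ring_scheme \<Rightarrow> ('x \<Rightarrow> 'y \<Rightarrow> 't) \<Rightarrow> bool" where
  "balanced_map S X Y Z \<beta> \<longleftrightarrow>
    (\<forall>x\<in>carrier X. \<beta> x \<in> add_hom Y Z) \<and>
    (\<forall>y\<in>carrier Y. (\<lambda>x. \<beta> x y) \<in> add_hom X Z) \<and>
    (\<forall>s\<in>carrier S. \<forall>x\<in>carrier X. \<forall>y\<in>carrier Y. \<beta> (s \<odot>\<^bsub>X\<^esub> x) y = \<beta> x (s \<odot>\<^bsub>Y\<^esub> y))"

lemma balanced_mapI:
  assumes "\<And>x y. x \<in> carrier X \<Longrightarrow> y \<in> carrier Y \<Longrightarrow> \<beta> x y \<in> carrier Z"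
    and "\<And>x y y'. x \<in> carrier X \<Longrightarrow> y \<in> carrier Y \<Longrightarrow> y' \<in> carrier Y \<Longrightarrow>
      \<beta> x (y \<oplus>\<^bsub>Y\<^esub> y') = \<beta> x y \<oplus>\<^bsub>Z\<^esub> \<beta> x y'"
    and "\<And>x x' y. x \<in> carrier X \<Longrightarrow> x' \<in> carrier X \<Longrightarrow> y \<in> carrier Y \<Longrightarrow>
      \<beta> (x \<oplus>\<^bsub>X\<^esub> x') y = \<beta> x y \<oplus>\<^bsub>Z\<^esub> \<beta> x' y"
    and "\<And>s x y. s \<in> carrier S \<Longrightarrow> x \<in> carrier X \<Longrightarrow> y \<in> carrier Y \<Longrightarrow>
      \<beta> (s \<odot>\<^bsub>X\<^esub> x) y = \<beta> x (s \<odot>\<^bsub>Y\<^esub> y)"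
  shows "balanced_map S X Y Z \<beta>"
  using assms by (auto simp: balanced_map_def hom_def)

text \<open>
  The value that \<^const>\<open>tensor_lift\<close> takes on the coset of a formal sum.
\<close>

definition free_eval :: "('z, 'w) ring_scheme \<Rightarrow> ('x \<Rightarrow> 'y \<Rightarrow> 'z) \<Rightarrow> ('x \<times> 'y \<Rightarrow>\<^sub>0 int) \<Rightarrow> 'z" where
  "free_eval Z \<beta> u =
    (\<Oplus>\<^bsub>Z\<^esub>p\<in>Poly_Mapping.keys u. [Poly_Mapping.lookup u p] \<cdot>\<^bsub>Z\<^esub> \<beta> (fst p) (snd p))"

lemma free_eval_hom:
  fixes \<beta> :: "'x \<Rightarrow> 'y \<Rightarrow> 'z" and Z :: "('z, 'w) ring_scheme"
  assumes Z: "abelian_group Z" and cl: "\<And>x y. (x, y) \<in> D \<Longrightarrow> \<beta> x y \<in> carrier Z"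
  shows "free_eval Z \<beta> \<in> hom (free_Abelian_group D) (add_monoid Z)"
proof -
  interpret Z: abelian_group Z by fact
  let ?t = "\<lambda>(u :: 'x \<times> 'y \<Rightarrow>\<^sub>0 int) p. [Poly_Mapping.lookup u p] \<cdot>\<^bsub>Z\<^esub> \<beta> (fst p) (snd p)"
  have pow: "[n] \<cdot>\<^bsub>Z\<^esub> z \<in> carrier Z" if "z \<in> carrier Z" for n :: int and z
    using group.int_pow_closed[OF Z.a_group] that by (simp add: add_pow_def)
  have tcl: "?t u p \<in> carrier Z" if "p \<in> D" for u p
    using that cl[of "fst p" "snd p"] by (auto intro: pow)
  have eq: "free_eval Z \<beta> u = (\<Oplus>\<^bsub>Z\<^esub>p\<in>J. ?t u p)"
    if "finite J" "J \<subseteq> D" "Poly_Mapping.keys u \<subseteq> J" for u J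
    unfolding free_eval_def
    by (rule Z.add.finprod_mono_neutral_cong_left)
       (use that tcl in \<open>auto simp: in_keys_iff add_pow_def int_pow_0\<close>)
  show ?thesis
  proof (rule homI)
    fix u v assume "u \<in> carrier (free_Abelian_group D)" "v \<in> carrier (free_Abelian_group D)"
    then have uv: "Poly_Mapping.keys u \<subseteq> D" "Poly_Mapping.keys v \<subseteq> D" by auto
    let ?J = "Poly_Mapping.keys u \<union> Poly_Mapping.keys v"
    have "free_eval Z \<beta> (u + v) = (\<Oplus>\<^bsub>Z\<^esub>p\<in>?J. ?t (u + v) p)"
      by (rule eq) (use uv keys_add[of u v] in auto)
    also have "\<dots> = (\<Oplus>\<^bsub>Z\<^esub>p\<in>?J. ?t u p \<oplus>\<^bsub>Z\<^esub> ?t v p)"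
    proof (rule Z.finsum_cong')
      fix p assume "p \<in> ?J"
      then have "\<beta> (fst p) (snd p) \<in> carrier Z" using uv cl[of "fst p" "snd p"] by auto
      then show "?t (u + v) p = ?t u p \<oplus>\<^bsub>Z\<^esub> ?t v p"
        using group.int_pow_mult[OF Z.a_group] by (simp add: Poly_Mapping.lookup_add add_pow_def)
    qed (use uv tcl in auto)
    also have "\<dots> = (\<Oplus>\<^bsub>Z\<^esub>p\<in>?J. ?t u p) \<oplus>\<^bsub>Z\<^esub> (\<Oplus>\<^bsub>Z\<^esub>p\<in>?J. ?t v p)"
      by (rule Z.finsum_addf) (use uv tcl in auto)
    also have "\<dots> = free_eval Z \<beta> u \<oplus>\<^bsub>Z\<^esub> free_eval Z \<beta> v"
      using eq[of ?J u] eq[of ?J v] uv by auto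
    finally show "free_eval Z \<beta> (u \<otimes>\<^bsub>free_Abelian_group D\<^esub> v) =
        free_eval Z \<beta> u \<otimes>\<^bsub>add_monoid Z\<^esub> free_eval Z \<beta> v" by simp
  next
    fix u assume "u \<in> carrier (free_Abelian_group D)"
    then show "free_eval Z \<beta> u \<in> carrier (add_monoid Z)"
      unfolding free_eval_def using tcl by (auto intro!: Z.finsum_closed)
  qed
qed

lemma free_eval_frag_of:
  assumes Z: "abelian_group Z" and cl: "\<beta> x y \<in> carrier Z"
  shows "free_eval Z \<beta> (frag_of (x, y)) = \<beta> x y"
proof -
  interpret Z: abelian_group Z by fact
  have "free_eval Z \<beta> (frag_of (x, y)) = (\<Oplus>\<^bsub>Z\<^esub>p\<in>{(x, y)}. \<beta> x y)"
    unfolding free_eval_def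
    by (rule Z.finsum_cong') (use cl group.int_pow_1[OF Z.a_group] in \<open>auto simp: add_pow_def\<close>)
  also have "\<dots> = \<beta> x y"
    by (subst Z.finsum_insert) (use cl in auto)
  finally show ?thesis .
qed

locale tensor_pair = X: abelian_group X + Y: abelian_group Y
  for S :: "('s, 'z) ring_scheme" and X :: "('s, 'x, 'w) module_scheme"
    and Y :: "('s, 'y, 'v) module_scheme" +
  assumes smult_X: "s \<in> carrier S \<Longrightarrow> x \<in> carrier X \<Longrightarrow> s \<odot>\<^bsub>X\<^esub> x \<in> carrier X"
    and smult_Y: "s \<in> carrier S \<Longrightarrow> y \<in> carrier Y \<Longrightarrow> s \<odot>\<^bsub>Y\<^esub> y \<in> carrier Y"
begin

abbreviation FG where "FG \<equiv> free_Abelian_group (carrier X \<times> carrier Y)"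
abbreviation TG where "TG \<equiv> tensor_group S X Y"

definition tensor_class where "tensor_class u = tensor_kernel S X Y #>\<^bsub>FG\<^esub> u"

lemma pure_tensor_class: "pure_tensor S X Y x y = tensor_class (frag_of (x, y))"
  by (simp add: pure_tensor_def tensor_class_def)

sublocale FG: comm_group FG
  by (rule abelian_free_Abelian_group)

lemma relations_subset: "tensor_relations S X Y \<subseteq> carrier FG"
proof
  have frag: "frag_of p \<in> carrier FG" if "p \<in> carrier X \<times> carrier Y" for p
    using that by simp
  have diff: "v - w \<in> carrier FG" if "v \<in> carrier FG" "w \<in> carrier FG" for v w
    using that keys_diff[of v w] by auto
  fix u assume "u \<in> tensor_relations S X Y"
  then show "u \<in> carrier FG"
    unfolding tensor_relations_def
    by (elim UnE CollectE exE conjE) (simp_all only:, (intro diff frag; simp add: smult_X smult_Y)+)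
qed

lemma kernel_subgroup: "subgroup (tensor_kernel S X Y) FG"
  unfolding tensor_kernel_def by (rule FG.generate_is_subgroup[OF relations_subset])

lemma kernel_normal: "tensor_kernel S X Y \<lhd> FG"
  by (rule FG.subgroup_imp_normal[OF kernel_subgroup])

lemma add_monoid_T: "add_monoid TG = FG Mod tensor_kernel S X Y"
  by (simp add: tensor_group_def Let_def FactGroup_def)

lemma T_abelian_group: "abelian_group TG"
  using FG.abelian_FactGroup[OF kernel_subgroup] unfolding add_monoid_T[symmetric]
  by (rule comm_group_abelian_groupI)

sublocale TG: abelian_group TG by (rule T_abelian_group)

lemma carrier_T: "carrier TG = tensor_class ` carrier FG"
  using carrier_FactGroup[of FG "tensor_kernel S X Y"]
  by (simp add: tensor_group_def Let_def tensor_class_def[abs_def])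

lemma tensor_class_hom: "tensor_class \<in> hom FG (add_monoid TG)"
  unfolding add_monoid_T tensor_class_def[abs_def]
  by (rule normal.r_coset_hom_Mod[OF kernel_normal])

lemma tensor_class_eqI:
  assumes "r \<in> tensor_kernel S X Y" "v \<in> carrier FG"
  shows "tensor_class (r + v) = tensor_class v"
proof -
  interpret K: subgroup "tensor_kernel S X Y" FG by (rule kernel_subgroup)
  have "tensor_class r = \<one>\<^bsub>FG Mod tensor_kernel S X Y\<^esub>"
    unfolding tensor_class_def using assms(1)
    by (simp add: FG.coset_join2 kernel_subgroup K.mem_carrier del: mult_free_Abelian_group carrier_free_Abelian_group_iff)
  then have r: "tensor_class r = \<zero>\<^bsub>TG\<^esub>"
    by (metis add_monoid_T monoid.simps(2))
  have "tensor_class (r + v) = tensor_class r \<oplus>\<^bsub>TG\<^esub> tensor_class v"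
    using hom_mult[OF tensor_class_hom K.mem_carrier[OF assms(1)] assms(2)] by simp
  also have "\<dots> = tensor_class v"
    using r assms(2) carrier_T by simp
  finally show ?thesis .
qed

lemma pure_closed [simp, intro]:
  "x \<in> carrier X \<Longrightarrow> y \<in> carrier Y \<Longrightarrow> pure_tensor S X Y x y \<in> carrier TG"
  by (auto simp: pure_tensor_class carrier_T)

lemma pure_add_left:
  assumes "x \<in> carrier X" "x' \<in> carrier X" "y \<in> carrier Y"
  shows "pure_tensor S X Y (x \<oplus>\<^bsub>X\<^esub> x') y = pure_tensor S X Y x y \<oplus>\<^bsub>TG\<^esub> pure_tensor S X Y x' y"
proof -
  have r: "frag_of (x \<oplus>\<^bsub>X\<^esub> x', y) - frag_of (x, y) - frag_of (x', y) \<in> tensor_kernel S X Y"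
    unfolding tensor_kernel_def
    by (rule generate.incl) (use assms in \<open>auto simp: tensor_relations_def\<close>)
  have v: "frag_of (x, y) + frag_of (x', y) \<in> carrier FG"
    using assms keys_add[of "frag_of (x, y)" "frag_of (x', y)"] by auto
  have "tensor_class (frag_of (x \<oplus>\<^bsub>X\<^esub> x', y)) = tensor_class (frag_of (x, y) + frag_of (x', y))"
    using tensor_class_eqI[OF r v] by simp
  also have "\<dots> = tensor_class (frag_of (x, y)) \<oplus>\<^bsub>TG\<^esub> tensor_class (frag_of (x', y))"
    using hom_mult[OF tensor_class_hom, of "frag_of (x, y)" "frag_of (x', y)"] assms by simp
  finally show ?thesis by (simp add: pure_tensor_class)
qed

lemma pure_add_right:
  assumes "x \<in> carrier X" "y \<in> carrier Y" "y' \<in> carrier Y"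
  shows "pure_tensor S X Y x (y \<oplus>\<^bsub>Y\<^esub> y') = pure_tensor S X Y x y \<oplus>\<^bsub>TG\<^esub> pure_tensor S X Y x y'"
proof -
  have r: "frag_of (x, y \<oplus>\<^bsub>Y\<^esub> y') - frag_of (x, y) - frag_of (x, y') \<in> tensor_kernel S X Y"
    unfolding tensor_kernel_def
    by (rule generate.incl) (use assms in \<open>auto simp: tensor_relations_def\<close>)
  have v: "frag_of (x, y) + frag_of (x, y') \<in> carrier FG"
    using assms keys_add[of "frag_of (x, y)" "frag_of (x, y')"] by auto
  have "tensor_class (frag_of (x, y \<oplus>\<^bsub>Y\<^esub> y')) = tensor_class (frag_of (x, y) + frag_of (x, y'))"
    using tensor_class_eqI[OF r v] by simp
  also have "\<dots> = tensor_class (frag_of (x, y)) \<oplus>\<^bsub>TG\<^esub> tensor_class (frag_of (x, y'))"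
    using hom_mult[OF tensor_class_hom, of "frag_of (x, y)" "frag_of (x, y')"] assms by simp
  finally show ?thesis by (simp add: pure_tensor_class)
qed

lemma pure_smult:
  assumes "s \<in> carrier S" "x \<in> carrier X" "y \<in> carrier Y"
  shows "pure_tensor S X Y (s \<odot>\<^bsub>X\<^esub> x) y = pure_tensor S X Y x (s \<odot>\<^bsub>Y\<^esub> y)"
proof -
  have r: "frag_of (s \<odot>\<^bsub>X\<^esub> x, y) - frag_of (x, s \<odot>\<^bsub>Y\<^esub> y) \<in> tensor_kernel S X Y"
    unfolding tensor_kernel_def
    by (rule generate.incl) (use assms in \<open>auto simp: tensor_relations_def\<close>)
  have v: "frag_of (x, s \<odot>\<^bsub>Y\<^esub> y) \<in> carrier FG"
    using assms smult_Y by auto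
  show ?thesis
    using tensor_class_eqI[OF r v] by (simp add: pure_tensor_class)
qed

text \<open>
  For a balanced biadditive map the evaluation of formal sums kills the defining relations, hence
  the subgroup generated by them, so it is constant on cosets and \<^const>\<open>the_elem\<close> returns its value.
\<close>

lemma tensor_lift_class:
  assumes Z: "abelian_group Z" and \<beta>: "balanced_map S X Y Z \<beta>" and u: "u \<in> carrier FG"
  shows "tensor_lift Z \<beta> (tensor_class u) = free_eval Z \<beta> u"
proof -
  interpret Z: abelian_group Z by fact
  let ?h = "free_eval Z \<beta>"
  have cl: "\<beta> x y \<in> carrier Z" if "(x, y) \<in> carrier X \<times> carrier Y" for x y
    using \<beta> that by (auto simp: balanced_map_def hom_def)
  have h: "?h \<in> hom FG (add_monoid Z)" by (rule free_eval_hom[OF Z cl])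
  interpret h: group_hom FG "add_monoid Z" ?h
    using h by (auto simp: group_hom_def group_hom_axioms_def Z.a_group)
  have hdiff: "?h (v - w) = ?h v \<oplus>\<^bsub>Z\<^esub> \<ominus>\<^bsub>Z\<^esub> ?h w" if "v \<in> carrier FG" "w \<in> carrier FG" for v w
    using that h.hom_mult[of v "- w"] h.hom_inv[of w] by (simp add: a_inv_def)
  have frag: "?h (frag_of (x, y)) = \<beta> x y" if "x \<in> carrier X" "y \<in> carrier Y" for x y
    using that by (simp add: free_eval_frag_of[OF Z] cl)
  have d3: "?h (frag_of (x, y) - frag_of (x', y') - frag_of (x'', y'')) = \<zero>\<^bsub>Z\<^esub>"
    if m: "x \<in> carrier X" "y \<in> carrier Y" "x' \<in> carrier X" "y' \<in> carrier Y" "x'' \<in> carrier X" "y'' \<in> carrier Y"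
      and e: "\<beta> x y = \<beta> x' y' \<oplus>\<^bsub>Z\<^esub> \<beta> x'' y''" for x y x' y' x'' y''
  proof -
    have "frag_of (x, y) - frag_of (x', y') \<in> carrier FG"
      using keys_diff[of "frag_of (x, y)" "frag_of (x', y')"] m by auto
    then have "?h (frag_of (x, y) - frag_of (x', y') - frag_of (x'', y'')) =
      (\<beta> x y \<oplus>\<^bsub>Z\<^esub> \<ominus>\<^bsub>Z\<^esub> \<beta> x' y') \<oplus>\<^bsub>Z\<^esub> \<ominus>\<^bsub>Z\<^esub> \<beta> x'' y''"
      using m by (simp add: hdiff frag)
    then show ?thesis
      using m e by (simp add: cl Z.a_ac Z.r_neg Z.r_neg1 Z.r_neg2)
  qed
  have "tensor_relations S X Y \<subseteq> kernel FG (add_monoid Z) ?h"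
  proof
    fix r assume r: "r \<in> tensor_relations S X Y"
    then have "?h r = \<zero>\<^bsub>Z\<^esub>"
      unfolding tensor_relations_def
    proof (elim UnE CollectE exE conjE)
      fix x x' y assume "r = frag_of (x \<oplus>\<^bsub>X\<^esub> x', y) - frag_of (x, y) - frag_of (x', y)"
        "x \<in> carrier X" "x' \<in> carrier X" "y \<in> carrier Y"
      then show ?thesis using d3[of "x \<oplus>\<^bsub>X\<^esub> x'" y x y x' y] \<beta> by (auto simp: balanced_map_def hom_def)
    next
      fix x y y' assume "r = frag_of (x, y \<oplus>\<^bsub>Y\<^esub> y') - frag_of (x, y) - frag_of (x, y')"
        "x \<in> carrier X" "y \<in> carrier Y" "y' \<in> carrier Y"
      then show ?thesis using d3[of x "y \<oplus>\<^bsub>Y\<^esub> y'" x y x y'] \<beta> by (auto simp: balanced_map_def hom_def)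
    next
      fix s x y assume "r = frag_of (s \<odot>\<^bsub>X\<^esub> x, y) - frag_of (x, s \<odot>\<^bsub>Y\<^esub> y)"
        "s \<in> carrier S" "x \<in> carrier X" "y \<in> carrier Y"
      then show ?thesis
        using \<beta> by (simp add: hdiff frag smult_X smult_Y balanced_map_def cl Z.r_neg)
    qed
    then show "r \<in> kernel FG (add_monoid Z) ?h"
      using r relations_subset by (auto simp: kernel_def simp del: carrier_free_Abelian_group_iff)
  qed
  then have ker: "tensor_kernel S X Y \<subseteq> kernel FG (add_monoid Z) ?h"
    unfolding tensor_kernel_def
    by (rule FG.generate_subgroup_incl) (rule h.subgroup_kernel)
  have "?h ` tensor_class u = {?h u}"
  proof -
    have val: "?h (r + u) = ?h u" if "r \<in> tensor_kernel S X Y" for r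
    proof -
      have "r \<in> carrier FG" "?h r = \<zero>\<^bsub>Z\<^esub>" using that ker by (auto simp: kernel_def)
      then show ?thesis using h.hom_mult[of r u] h.hom_closed[OF u] u by simp
    qed
    have "tensor_kernel S X Y \<noteq> {}" using subgroup.one_closed[OF kernel_subgroup] by blast
    then show ?thesis unfolding tensor_class_def r_coset_def using val by (auto simp: image_iff)
  qed
  then show ?thesis unfolding tensor_lift_def free_eval_def by simp
qed

lemma tensor_lift_hom:
  assumes Z: "abelian_group Z" and \<beta>: "balanced_map S X Y Z \<beta>"
  shows "tensor_lift Z \<beta> \<in> add_hom TG Z"
proof (rule add_homI)
  have h: "free_eval Z \<beta> \<in> hom FG (add_monoid Z)"
    by (rule free_eval_hom[OF Z]) (use \<beta> in \<open>auto simp: balanced_map_def hom_def\<close>)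
  fix U assume "U \<in> carrier TG"
  then obtain u where u: "u \<in> carrier FG" "U = tensor_class u" using carrier_T by auto
  then show "tensor_lift Z \<beta> U \<in> carrier Z"
    using hom_in_carrier[OF h u(1)] by (simp add: tensor_lift_class[OF Z \<beta> u(1)])
  fix V assume "V \<in> carrier TG"
  then obtain v where v: "v \<in> carrier FG" "V = tensor_class v" using carrier_T by auto
  have uv: "u + v \<in> carrier FG" using u(1) v(1) keys_add[of u v] by auto
  have "U \<oplus>\<^bsub>TG\<^esub> V = tensor_class (u + v)"
    using hom_mult[OF tensor_class_hom u(1) v(1)] u v by simp
  then show "tensor_lift Z \<beta> (U \<oplus>\<^bsub>TG\<^esub> V) = tensor_lift Z \<beta> U \<oplus>\<^bsub>Z\<^esub> tensor_lift Z \<beta> V"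
    using hom_mult[OF h u(1) v(1)] u v
    by (simp add: tensor_lift_class[OF Z \<beta>] uv[simplified])
qed

lemma tensor_lift_pure:
  assumes Z: "abelian_group Z" and \<beta>: "balanced_map S X Y Z \<beta>"
    and "x \<in> carrier X" "y \<in> carrier Y"
  shows "tensor_lift Z \<beta> (pure_tensor S X Y x y) = \<beta> x y"
  using assms tensor_lift_class[OF Z \<beta>, of "frag_of (x, y)"]
  by (auto simp: pure_tensor_class balanced_map_def hom_def intro!: free_eval_frag_of)

text \<open>
  Pure tensors generate.  All identities between additive maps on tensor products are checked on
  pure tensors by this rule.
\<close>

lemma tensor_add_hom_eqI:
  assumes Z: "abelian_group Z" and f: "f \<in> add_hom TG Z" and g: "g \<in> add_hom TG Z"
    and eq: "\<And>x y. x \<in> carrier X \<Longrightarrow> y \<in> carrier Y \<Longrightarrow>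
      f (pure_tensor S X Y x y) = g (pure_tensor S X Y x y)"
    and U: "U \<in> carrier TG"
  shows "f U = g U"
proof -
  interpret Z: abelian_group Z by fact
  interpret f: group_hom FG "add_monoid Z" "f \<circ> tensor_class"
    using hom_compose[OF tensor_class_hom f] by (auto simp: group_hom_def group_hom_axioms_def Z.a_group)
  interpret g: group_hom FG "add_monoid Z" "g \<circ> tensor_class"
    using hom_compose[OF tensor_class_hom g] by (auto simp: group_hom_def group_hom_axioms_def Z.a_group)
  obtain u where u: "Poly_Mapping.keys u \<subseteq> carrier X \<times> carrier Y" "U = tensor_class u"
    using U carrier_T by auto
  have "(f \<circ> tensor_class) u = (g \<circ> tensor_class) u"
  proof (rule free_Abelian_group_induct[OF u(1)])
    show "(f \<circ> tensor_class) 0 = (g \<circ> tensor_class) 0" using f.hom_one g.hom_one by simp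
  next
    fix x y assume 2: "Poly_Mapping.keys x \<subseteq> carrier X \<times> carrier Y" "Poly_Mapping.keys y \<subseteq> carrier X \<times> carrier Y"
      "(f \<circ> tensor_class) x = (g \<circ> tensor_class) x" "(f \<circ> tensor_class) y = (g \<circ> tensor_class) y"
    have "x - y = x \<otimes>\<^bsub>FG\<^esub> inv\<^bsub>FG\<^esub> y" using 2 by simp
    moreover have "x \<in> carrier FG" "y \<in> carrier FG" using 2 by auto
    ultimately show "(f \<circ> tensor_class) (x - y) = (g \<circ> tensor_class) (x - y)"
      using 2(3,4) f.hom_mult[of x "inv\<^bsub>FG\<^esub> y", OF _ FG.inv_closed] f.hom_inv[of y]
        g.hom_mult[of x "inv\<^bsub>FG\<^esub> y", OF _ FG.inv_closed] g.hom_inv[of y] by metis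
  next
    fix a assume "a \<in> carrier X \<times> carrier Y"
    then show "(f \<circ> tensor_class) (frag_of a) = (g \<circ> tensor_class) (frag_of a)" using eq by (cases a) (auto simp: pure_tensor_class)
  qed
  then show ?thesis using u by simp
qed

end

section \<open>Bimodules and their tensor products with modules\<close>

lemma opposite_simps [simp]:
  "carrier (opposite A) = carrier A" "\<one>\<^bsub>opposite A\<^esub> = \<one>\<^bsub>A\<^esub>" "\<zero>\<^bsub>opposite A\<^esub> = \<zero>\<^bsub>A\<^esub>"
  "x \<otimes>\<^bsub>opposite A\<^esub> y = y \<otimes>\<^bsub>A\<^esub> x" "ring.add (opposite A) = ring.add A"
  "module.smult (opposite A) = module.smult A"
  by (simp_all add: opposite_def)

text \<open>
  The records \<open>G\<close> and \<open>H\<close> may have different types, as for a bimodule and its right module.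
\<close>

lemma abelian_group_transfer:
  assumes "abelian_group G" "carrier H = carrier G" "ring.add H = ring.add G" "\<zero>\<^bsub>H\<^esub> = \<zero>\<^bsub>G\<^esub>"
  shows "abelian_group H"
proof -
  interpret G: abelian_group G by fact
  show ?thesis
    by (rule abelian_groupI) (use assms(2-4) G.l_neg G.a_inv_closed in \<open>auto simp: G.a_ac\<close>)
qed

locale fd_algebra =
  fixes k :: "('k, 'z) ring_scheme" and A :: "('k, 'a, 'w) module_scheme"
  assumes fd: "fin_dim_algebra k A"
begin

sublocale k: field k using fd by (simp add: fin_dim_algebra_def)
sublocale A: ring A using fd by (simp add: fin_dim_algebra_def)
sublocale kA: module k A using fd by (simp add: fin_dim_algebra_def)

lemma scalar_mult_left:
  "c \<in> carrier k \<Longrightarrow> a \<in> carrier A \<Longrightarrow> b \<in> carrier A \<Longrightarrow>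
    (c \<odot>\<^bsub>A\<^esub> a) \<otimes>\<^bsub>A\<^esub> b = c \<odot>\<^bsub>A\<^esub> (a \<otimes>\<^bsub>A\<^esub> b)"
  using fd by (simp add: fin_dim_algebra_def)

lemma scalar_mult_right:
  "c \<in> carrier k \<Longrightarrow> a \<in> carrier A \<Longrightarrow> b \<in> carrier A \<Longrightarrow>
    a \<otimes>\<^bsub>A\<^esub> (c \<odot>\<^bsub>A\<^esub> b) = c \<odot>\<^bsub>A\<^esub> (a \<otimes>\<^bsub>A\<^esub> b)"
  using fd unfolding fin_dim_algebra_def by metis

abbreviation E where "E \<equiv> enveloping_algebra k A"
abbreviation env where "env \<equiv> pure_tensor k A (opposite A)"

sublocale env: tensor_pair k A "opposite A"
proof (intro tensor_pair.intro tensor_pair_axioms.intro)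
  show "abelian_group (opposite A)" by (rule abelian_group_transfer[OF A.is_abelian_group]) auto
qed (auto simp: A.is_abelian_group)

lemma E_simps:
  "carrier E = carrier (tensor_group k A (opposite A))"
  "ring.add E = ring.add (tensor_group k A (opposite A))"
  "\<zero>\<^bsub>E\<^esub> = \<zero>\<^bsub>tensor_group k A (opposite A)\<^esub>"
  "\<one>\<^bsub>E\<^esub> = env \<one>\<^bsub>A\<^esub> \<one>\<^bsub>A\<^esub>"
  by (simp_all add: enveloping_algebra_def tensor_algebra_def)

lemma env_closed [simp, intro]: "a \<in> carrier A \<Longrightarrow> b \<in> carrier A \<Longrightarrow> env a b \<in> carrier E"
  by (simp add: E_simps)

lemma env_add_left:
  "a \<in> carrier A \<Longrightarrow> a' \<in> carrier A \<Longrightarrow> b \<in> carrier A \<Longrightarrow> env (a \<oplus>\<^bsub>A\<^esub> a') b = env a b \<oplus>\<^bsub>E\<^esub> env a' b"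
  using env.pure_add_left by (simp add: E_simps)

lemma env_add_right:
  "a \<in> carrier A \<Longrightarrow> b \<in> carrier A \<Longrightarrow> b' \<in> carrier A \<Longrightarrow> env a (b \<oplus>\<^bsub>A\<^esub> b') = env a b \<oplus>\<^bsub>E\<^esub> env a b'"
  using env.pure_add_right by (simp add: E_simps)

lemma env_scalar:
  "c \<in> carrier k \<Longrightarrow> a \<in> carrier A \<Longrightarrow> b \<in> carrier A \<Longrightarrow> env (c \<odot>\<^bsub>A\<^esub> a) b = env a (c \<odot>\<^bsub>A\<^esub> b)"
  using env.pure_smult by simp

text \<open>
  The product is defined by two nested lifts.  The inner one can be evaluated because \<open>a'\<close> and \<open>b'\<close>
  enter biadditively, and the resulting formula shows that the outer one is balanced too.
\<close>

lemma env_mult: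
  assumes "a \<in> carrier A" "b \<in> carrier A" "a' \<in> carrier A" "b' \<in> carrier A"
  shows "env a b \<otimes>\<^bsub>E\<^esub> env a' b' = env (a \<otimes>\<^bsub>A\<^esub> a') (b' \<otimes>\<^bsub>A\<^esub> b)"
proof -
  let ?T = "tensor_group k A (opposite A)"
  let ?\<beta> = "\<lambda>a b a' b'. env (a \<otimes>\<^bsub>A\<^esub> a') (b \<otimes>\<^bsub>opposite A\<^esub> b')"
  let ?\<gamma> = "\<lambda>a b. tensor_lift ?T (?\<beta> a b) (env a' b')"
  have inner: "balanced_map k A (opposite A) ?T (?\<beta> a b)" if "a \<in> carrier A" "b \<in> carrier A" for a b
    using that
    by (intro balanced_mapI)
       (auto simp: A.l_distr A.r_distr env.pure_add_left[simplified] env.pure_add_right[simplified]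
          scalar_mult_left scalar_mult_right env.pure_smult[simplified])
  have \<gamma>: "?\<gamma> a b = env (a \<otimes>\<^bsub>A\<^esub> a') (b' \<otimes>\<^bsub>A\<^esub> b)" if "a \<in> carrier A" "b \<in> carrier A" for a b
    using env.tensor_lift_pure[OF env.T_abelian_group inner[OF that], of a' b'] assms by simp
  note [simp] = \<gamma>[simplified]
  have outer: "balanced_map k A (opposite A) ?T ?\<gamma>"
    using assms
    by (intro balanced_mapI)
       (auto simp: A.l_distr A.r_distr env.pure_add_left[simplified] env.pure_add_right[simplified]
          scalar_mult_left scalar_mult_right env.pure_smult[simplified])
  have "env a b \<otimes>\<^bsub>E\<^esub> env a' b' = tensor_lift ?T ?\<gamma> (env a b)"
    by (simp add: enveloping_algebra_def tensor_algebra_def)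
  also have "\<dots> = ?\<gamma> a b"
    using env.tensor_lift_pure[OF env.T_abelian_group outer, of a b] assms by simp
  finally show ?thesis using \<gamma> assms by simp
qed

abbreviation lact where "lact \<equiv> bimodule_left k A"
abbreviation rmod where "rmod \<equiv> bimodule_right k A"

lemma rmod_simps [simp]:
  "carrier (rmod X) = carrier X" "ring.add (rmod X) = ring.add X" "\<zero>\<^bsub>rmod X\<^esub> = \<zero>\<^bsub>X\<^esub>"
  by (simp_all add: bimodule_right_def)

lemma rmod_smult: "a \<odot>\<^bsub>rmod X\<^esub> x = env \<one>\<^bsub>A\<^esub> a \<odot>\<^bsub>X\<^esub> x"
  by (simp add: bimodule_right_def)

lemma rmod_abelian_group: "left_module E X \<Longrightarrow> abelian_group (rmod X)"
  by (rule abelian_group_transfer[OF left_module_abelian_group]) auto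

lemma rmod_closed: "left_module E X \<Longrightarrow> a \<in> carrier A \<Longrightarrow> x \<in> carrier X \<Longrightarrow> a \<odot>\<^bsub>rmod X\<^esub> x \<in> carrier X"
  by (simp add: rmod_smult left_module.smult_closed)

lemma rmod_add: "left_module E X \<Longrightarrow> a \<in> carrier A \<Longrightarrow> x \<in> carrier X \<Longrightarrow> y \<in> carrier X \<Longrightarrow>
    a \<odot>\<^bsub>rmod X\<^esub> (x \<oplus>\<^bsub>X\<^esub> y) = a \<odot>\<^bsub>rmod X\<^esub> x \<oplus>\<^bsub>X\<^esub> a \<odot>\<^bsub>rmod X\<^esub> y"
  by (simp add: rmod_smult left_module.smult_r_distr)

lemma rmod_scalar_add: "left_module E X \<Longrightarrow> a \<in> carrier A \<Longrightarrow> b \<in> carrier A \<Longrightarrow> x \<in> carrier X \<Longrightarrow>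
    (a \<oplus>\<^bsub>A\<^esub> b) \<odot>\<^bsub>rmod X\<^esub> x = a \<odot>\<^bsub>rmod X\<^esub> x \<oplus>\<^bsub>X\<^esub> b \<odot>\<^bsub>rmod X\<^esub> x"
  by (simp add: rmod_smult env_add_right left_module.smult_l_distr)

lemma rmod_mult: "left_module E X \<Longrightarrow> a \<in> carrier A \<Longrightarrow> b \<in> carrier A \<Longrightarrow> x \<in> carrier X \<Longrightarrow>
    (a \<otimes>\<^bsub>A\<^esub> b) \<odot>\<^bsub>rmod X\<^esub> x = b \<odot>\<^bsub>rmod X\<^esub> (a \<odot>\<^bsub>rmod X\<^esub> x)"
  by (simp add: rmod_smult env_mult flip: left_module.smult_assoc)

lemma rmod_one: "left_module E X \<Longrightarrow> x \<in> carrier X \<Longrightarrow> \<one>\<^bsub>A\<^esub> \<odot>\<^bsub>rmod X\<^esub> x = x"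
  using left_module.smult_one[of E X x] by (simp add: rmod_smult E_simps)

lemma lact_closed: "left_module E X \<Longrightarrow> a \<in> carrier A \<Longrightarrow> x \<in> carrier X \<Longrightarrow> lact X a x \<in> carrier X"
  by (simp add: bimodule_left_def left_module.smult_closed)

lemma lact_add: "left_module E X \<Longrightarrow> a \<in> carrier A \<Longrightarrow> x \<in> carrier X \<Longrightarrow> y \<in> carrier X \<Longrightarrow>
    lact X a (x \<oplus>\<^bsub>X\<^esub> y) = lact X a x \<oplus>\<^bsub>X\<^esub> lact X a y"
  by (simp add: bimodule_left_def left_module.smult_r_distr)

lemma lact_scalar_add: "left_module E X \<Longrightarrow> a \<in> carrier A \<Longrightarrow> b \<in> carrier A \<Longrightarrow> x \<in> carrier X \<Longrightarrow>
    lact X (a \<oplus>\<^bsub>A\<^esub> b) x = lact X a x \<oplus>\<^bsub>X\<^esub> lact X b x"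
  by (simp add: bimodule_left_def env_add_left left_module.smult_l_distr)

lemma lact_mult: "left_module E X \<Longrightarrow> a \<in> carrier A \<Longrightarrow> b \<in> carrier A \<Longrightarrow> x \<in> carrier X \<Longrightarrow>
    lact X (a \<otimes>\<^bsub>A\<^esub> b) x = lact X a (lact X b x)"
  by (simp add: bimodule_left_def env_mult flip: left_module.smult_assoc)

lemma lact_one: "left_module E X \<Longrightarrow> x \<in> carrier X \<Longrightarrow> lact X \<one>\<^bsub>A\<^esub> x = x"
  using left_module.smult_one[of E X x] by (simp add: bimodule_left_def E_simps)

lemma lact_rmod: "left_module E X \<Longrightarrow> a \<in> carrier A \<Longrightarrow> b \<in> carrier A \<Longrightarrow> x \<in> carrier X \<Longrightarrow>
    lact X a (b \<odot>\<^bsub>rmod X\<^esub> x) = b \<odot>\<^bsub>rmod X\<^esub> (lact X a x)"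
  by (simp add: rmod_smult bimodule_left_def env_mult flip: left_module.smult_assoc)

lemma linear_map_rmod:
  "p \<in> linear_map E X Y \<Longrightarrow> p \<in> linear_map A (rmod X) (rmod Y)"
  unfolding linear_map_def hom_def by (auto simp: rmod_smult)

lemma linear_map_lact:
  "p \<in> linear_map E X Y \<Longrightarrow> a \<in> carrier A \<Longrightarrow> x \<in> carrier X \<Longrightarrow> p (lact X a x) = lact Y a (p x)"
  unfolding linear_map_def by (auto simp: bimodule_left_def)

lemma regular_bimodule_simps [simp]:
  "carrier (regular_bimodule A) = carrier A" "ring.add (regular_bimodule A) = ring.add A"
  "\<zero>\<^bsub>regular_bimodule A\<^esub> = \<zero>\<^bsub>A\<^esub>"
  by (simp_all add: regular_bimodule_def)

lemma regular_bimodule_smult: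
  assumes "a \<in> carrier A" "b \<in> carrier A" "x \<in> carrier A"
  shows "env a b \<odot>\<^bsub>regular_bimodule A\<^esub> x = a \<otimes>\<^bsub>A\<^esub> x \<otimes>\<^bsub>A\<^esub> b"
proof -
  have "balanced_map k A (opposite A) A (\<lambda>a b. a \<otimes>\<^bsub>A\<^esub> x \<otimes>\<^bsub>A\<^esub> b)"
    using assms by (intro balanced_mapI) (auto simp: A.l_distr A.r_distr scalar_mult_left scalar_mult_right)
  then show ?thesis
    using env.tensor_lift_pure[OF A.is_abelian_group, of _ a b] assms by (simp add: regular_bimodule_def)
qed

lemma regular_lact:
  "a \<in> carrier A \<Longrightarrow> x \<in> carrier A \<Longrightarrow> lact (regular_bimodule A) a x = a \<otimes>\<^bsub>A\<^esub> x"
  by (simp add: bimodule_left_def regular_bimodule_smult)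

lemma regular_rmod:
  "a \<in> carrier A \<Longrightarrow> x \<in> carrier A \<Longrightarrow> a \<odot>\<^bsub>rmod (regular_bimodule A)\<^esub> x = x \<otimes>\<^bsub>A\<^esub> a"
  by (simp add: rmod_smult regular_bimodule_smult)

abbreviation T where "T \<equiv> bimodule_tensor k A"
abbreviation pt where "pt X \<equiv> pure_tensor A (rmod X)"

lemma T_simps:
  "carrier (T X L) = carrier (tensor_group A (rmod X) L)"
  "ring.add (T X L) = ring.add (tensor_group A (rmod X) L)"
  "\<zero>\<^bsub>T X L\<^esub> = \<zero>\<^bsub>tensor_group A (rmod X) L\<^esub>"
  by (simp_all add: bimodule_tensor_def Let_def)

lemma T_pair:
  assumes "left_module E X" "left_module A L"
  shows "tensor_pair A (rmod X) L"
  using assms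
  by (intro tensor_pair.intro tensor_pair_axioms.intro)
     (auto simp: rmod_abelian_group left_module_abelian_group rmod_closed left_module.smult_closed)

lemma T_abelian_group: "left_module E X \<Longrightarrow> left_module A L \<Longrightarrow> abelian_group (T X L)"
  by (rule abelian_group_transfer[OF tensor_pair.T_abelian_group[OF T_pair]]) (auto simp: T_simps)

lemma pt_closed:
  "left_module E X \<Longrightarrow> left_module A L \<Longrightarrow> x \<in> carrier X \<Longrightarrow> m \<in> carrier L \<Longrightarrow> pt X L x m \<in> carrier (T X L)"
  using tensor_pair.pure_closed[OF T_pair] by (simp add: T_simps)

lemma pt_balanced:
  assumes "left_module E X" "left_module A L"
  shows "balanced_map A (rmod X) L (T X L) (pt X L)"
proof -
  interpret tensor_pair A "rmod X" L by (rule T_pair[OF assms])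
  show ?thesis
    by (rule balanced_mapI)
       (auto simp: T_simps pure_add_left[simplified] pure_add_right[simplified] pure_smult[simplified])
qed

lemma pt_add_left:
  "left_module E X \<Longrightarrow> left_module A L \<Longrightarrow> x \<in> carrier X \<Longrightarrow> x' \<in> carrier X \<Longrightarrow> m \<in> carrier L \<Longrightarrow>
    pt X L (x \<oplus>\<^bsub>X\<^esub> x') m = pt X L x m \<oplus>\<^bsub>T X L\<^esub> pt X L x' m"
  using pt_balanced[of X L] by (simp add: balanced_map_def hom_def)

lemma pt_add_right:
  "left_module E X \<Longrightarrow> left_module A L \<Longrightarrow> x \<in> carrier X \<Longrightarrow> m \<in> carrier L \<Longrightarrow> m' \<in> carrier L \<Longrightarrow>
    pt X L x (m \<oplus>\<^bsub>L\<^esub> m') = pt X L x m \<oplus>\<^bsub>T X L\<^esub> pt X L x m'"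
  using pt_balanced[of X L] by (simp add: balanced_map_def hom_def)

lemma pt_swap:
  "left_module E X \<Longrightarrow> left_module A L \<Longrightarrow> a \<in> carrier A \<Longrightarrow> x \<in> carrier X \<Longrightarrow> m \<in> carrier L \<Longrightarrow>
    pt X L (a \<odot>\<^bsub>rmod X\<^esub> x) m = pt X L x (a \<odot>\<^bsub>L\<^esub> m)"
  using pt_balanced[of X L] by (simp add: balanced_map_def)

lemma pt_zero_left:
  assumes "left_module E X" "left_module A L" "m \<in> carrier L"
  shows "pt X L \<zero>\<^bsub>X\<^esub> m = \<zero>\<^bsub>T X L\<^esub>"
  using add_hom_zero[of X "T X L" "\<lambda>x. pt X L x m"] assms
  by (simp add: left_module_abelian_group T_abelian_group add_homI pt_closed pt_add_left)

lemma pt_zero_right: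
  assumes "left_module E X" "left_module A L" "x \<in> carrier X"
  shows "pt X L x \<zero>\<^bsub>L\<^esub> = \<zero>\<^bsub>T X L\<^esub>"
  using add_hom_zero[of L "T X L" "\<lambda>m. pt X L x m"] assms
  by (simp add: left_module_abelian_group T_abelian_group add_homI pt_closed pt_add_right)

lemma T_lift_hom:
  "left_module E X \<Longrightarrow> left_module A L \<Longrightarrow> abelian_group Z \<Longrightarrow> balanced_map A (rmod X) L Z \<beta> \<Longrightarrow>
    tensor_lift Z \<beta> \<in> add_hom (T X L) Z"
  using tensor_pair.tensor_lift_hom[OF T_pair] by (simp add: T_simps hom_def)

lemma T_lift_pt:
  "left_module E X \<Longrightarrow> left_module A L \<Longrightarrow> abelian_group Z \<Longrightarrow> balanced_map A (rmod X) L Z \<beta> \<Longrightarrow>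
    x \<in> carrier X \<Longrightarrow> m \<in> carrier L \<Longrightarrow> tensor_lift Z \<beta> (pt X L x m) = \<beta> x m"
  using tensor_pair.tensor_lift_pure[OF T_pair] by simp

lemma T_eqI:
  assumes "left_module E X" "left_module A L" "abelian_group Z"
    and "f \<in> add_hom (T X L) Z" "g \<in> add_hom (T X L) Z"
    and "\<And>x m. x \<in> carrier X \<Longrightarrow> m \<in> carrier L \<Longrightarrow> f (pt X L x m) = g (pt X L x m)"
    and "u \<in> carrier (T X L)"
  shows "f u = g u"
  using tensor_pair.tensor_add_hom_eqI[OF T_pair[OF assms(1,2)] assms(3), of f g u] assms
  by (simp add: T_simps hom_def)

lemma T_smult:
  assumes X: "left_module E X" and L: "left_module A L" and a: "a \<in> carrier A"
  shows T_smult_hom: "(\<lambda>u. a \<odot>\<^bsub>T X L\<^esub> u) \<in> add_hom (T X L) (T X L)" (is ?A)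
    and T_smult_pt: "x \<in> carrier X \<Longrightarrow> m \<in> carrier L \<Longrightarrow>
      a \<odot>\<^bsub>T X L\<^esub> pt X L x m = pt X L (lact X a x) m"
proof -
  interpret P: tensor_pair A "rmod X" L by (rule T_pair[OF X L])
  let ?\<beta> = "\<lambda>x m. pt X L (lact X a x) m"
  have \<beta>: "balanced_map A (rmod X) L (tensor_group A (rmod X) L) ?\<beta>"
    using X L a
    by (intro balanced_mapI)
       (auto simp: lact_closed lact_add lact_rmod P.pure_add_left[simplified] P.pure_add_right[simplified]
        P.pure_smult[simplified])
  have eq: "a \<odot>\<^bsub>T X L\<^esub> u = tensor_lift (tensor_group A (rmod X) L) ?\<beta> u" for u
    by (simp add: bimodule_tensor_def Let_def)
  show ?A
    using P.tensor_lift_hom[OF P.T_abelian_group \<beta>] by (simp add: eq T_simps hom_def)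
  show "a \<odot>\<^bsub>T X L\<^esub> pt X L x m = pt X L (lact X a x) m" if "x \<in> carrier X" "m \<in> carrier L"
    using P.tensor_lift_pure[OF P.T_abelian_group \<beta>] that by (simp add: eq)
qed

lemma T_left_module:
  assumes X: "left_module E X" and L: "left_module A L"
  shows "left_module A (T X L)"
proof (intro left_module.intro left_module_axioms.intro A.ring_axioms T_abelian_group[OF X L])
  note ab = T_abelian_group[OF X L]
  interpret TT: abelian_group "T X L" by fact
  note sh = T_smult_hom[OF X L]
  note sp = T_smult_pt[OF X L]
  fix a u assume a: "a \<in> carrier A" and u: "u \<in> carrier (T X L)"
  show "a \<odot>\<^bsub>T X L\<^esub> u \<in> carrier (T X L)"
    using add_hom_closed[OF sh[OF a] u] .
  fix v assume v: "v \<in> carrier (T X L)"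
  show "a \<odot>\<^bsub>T X L\<^esub> (u \<oplus>\<^bsub>T X L\<^esub> v) = a \<odot>\<^bsub>T X L\<^esub> u \<oplus>\<^bsub>T X L\<^esub> a \<odot>\<^bsub>T X L\<^esub> v"
    using add_hom_add[OF sh[OF a] u v] .
next
  note ab = T_abelian_group[OF X L]
  interpret TT: abelian_group "T X L" by fact
  note sh = T_smult_hom[OF X L]
  note sp = T_smult_pt[OF X L]
  fix a b u assume a: "a \<in> carrier A" and b: "b \<in> carrier A" and u: "u \<in> carrier (T X L)"
  show "(a \<oplus>\<^bsub>A\<^esub> b) \<odot>\<^bsub>T X L\<^esub> u = a \<odot>\<^bsub>T X L\<^esub> u \<oplus>\<^bsub>T X L\<^esub> b \<odot>\<^bsub>T X L\<^esub> u"
  proof (rule T_eqI[OF X L ab _ _ _ u])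
    show "(\<lambda>u. (a \<oplus>\<^bsub>A\<^esub> b) \<odot>\<^bsub>T X L\<^esub> u) \<in> add_hom (T X L) (T X L)" using sh a b by simp
    show "(\<lambda>u. a \<odot>\<^bsub>T X L\<^esub> u \<oplus>\<^bsub>T X L\<^esub> b \<odot>\<^bsub>T X L\<^esub> u) \<in> add_hom (T X L) (T X L)"
      using add_hom_closed[OF sh[OF a]] add_hom_closed[OF sh[OF b]] add_hom_add[OF sh[OF a]] add_hom_add[OF sh[OF b]]
      by (intro add_homI) (auto simp: TT.a_ac)
  qed (use X L a b in \<open>simp add: sp lact_scalar_add lact_closed pt_add_left\<close>)
  show "(a \<otimes>\<^bsub>A\<^esub> b) \<odot>\<^bsub>T X L\<^esub> u = a \<odot>\<^bsub>T X L\<^esub> (b \<odot>\<^bsub>T X L\<^esub> u)"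
  proof (rule T_eqI[OF X L ab _ _ _ u])
    show "(\<lambda>u. (a \<otimes>\<^bsub>A\<^esub> b) \<odot>\<^bsub>T X L\<^esub> u) \<in> add_hom (T X L) (T X L)" using sh a b by simp
    show "(\<lambda>u. a \<odot>\<^bsub>T X L\<^esub> (b \<odot>\<^bsub>T X L\<^esub> u)) \<in> add_hom (T X L) (T X L)"
      using add_hom_comp[OF sh[OF b] sh[OF a]] .
  qed (use X L a b in \<open>simp add: sp lact_mult lact_closed\<close>)
next
  note ab = T_abelian_group[OF X L]
  note sh = T_smult_hom[OF X L]
  note sp = T_smult_pt[OF X L]
  fix u assume u: "u \<in> carrier (T X L)"
  show "\<one>\<^bsub>A\<^esub> \<odot>\<^bsub>T X L\<^esub> u = u"
  proof (rule T_eqI[OF X L ab, of _ "\<lambda>u. u", OF _ _ _ u])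
    show "(\<lambda>u. \<one>\<^bsub>A\<^esub> \<odot>\<^bsub>T X L\<^esub> u) \<in> add_hom (T X L) (T X L)" using sh by simp
    show "(\<lambda>u. u) \<in> add_hom (T X L) (T X L)" by (rule linear_map_add_hom[OF linear_map_id])
  qed (use X L in \<open>simp add: sp lact_one\<close>)
qed

text \<open>
  The map \<open>p \<otimes> e\<close>.  Right linearity of \<open>p\<close> is enough for it to exist as a map of groups, which is what
  a contracting homotopy needs; if \<open>p\<close> is a bimodule map, it is \<open>A\<close>-linear.
\<close>

definition tensor_map where
  "tensor_map X' L' p e = tensor_lift (T X' L') (\<lambda>x m. pt X' L' (p x) (e m))"

lemma tensor_map:
  assumes X: "left_module E X" and X': "left_module E X'" and L: "left_module A L" and L': "left_module A L'"
    and p: "p \<in> linear_map A (rmod X) (rmod X')" and e: "e \<in> linear_map A L L'"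
  shows tensor_map_hom: "tensor_map X' L' p e \<in> add_hom (T X L) (T X' L')"
    and tensor_map_pt: "x \<in> carrier X \<Longrightarrow> m \<in> carrier L \<Longrightarrow>
      tensor_map X' L' p e (pt X L x m) = pt X' L' (p x) (e m)"
proof -
  note [simp] = linear_map_closed[OF p, simplified] linear_map_closed[OF e]
    linear_map_add[OF p, simplified] linear_map_add[OF e]
    linear_map_smult[OF p, simplified] linear_map_smult[OF e]
  have \<beta>: "balanced_map A (rmod X) L (T X' L') (\<lambda>x m. pt X' L' (p x) (e m))"
    using X' L' by (intro balanced_mapI) (auto simp: pt_closed pt_add_left pt_add_right pt_swap)
  show "tensor_map X' L' p e \<in> add_hom (T X L) (T X' L')"
    unfolding tensor_map_def by (rule T_lift_hom[OF X L T_abelian_group[OF X' L'] \<beta>])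
  show "tensor_map X' L' p e (pt X L x m) = pt X' L' (p x) (e m)" if "x \<in> carrier X" "m \<in> carrier L"
    unfolding tensor_map_def by (rule T_lift_pt[OF X L T_abelian_group[OF X' L'] \<beta> that])
qed

lemma tensor_map_linear:
  assumes X: "left_module E X" and X': "left_module E X'" and L: "left_module A L" and L': "left_module A L'"
    and p: "p \<in> linear_map E X X'" and e: "e \<in> linear_map A L L'"
  shows "tensor_map X' L' p e \<in> linear_map A (T X L) (T X' L')"
proof -
  note pr = linear_map_rmod[OF p]
  note h = tensor_map_hom[OF X X' L L' pr e]
  have "tensor_map X' L' p e (a \<odot>\<^bsub>T X L\<^esub> u) = a \<odot>\<^bsub>T X' L'\<^esub> tensor_map X' L' p e u"
    if a: "a \<in> carrier A" and u: "u \<in> carrier (T X L)" for a u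
    by (rule T_eqI[OF X L T_abelian_group[OF X' L'] _ _ _ u, of "\<lambda>u. tensor_map X' L' p e (a \<odot>\<^bsub>T X L\<^esub> u)"])
       (use X X' L L' a add_hom_comp[OF T_smult_hom[OF X L a] h] add_hom_comp[OF h T_smult_hom[OF X' L' a]]
         linear_map_closed[OF p] linear_map_closed[OF e]
        in \<open>simp_all add: T_smult_pt tensor_map_pt[OF X X' L L' pr e] lact_closed linear_map_lact[OF p]\<close>)
  then show ?thesis using h by (simp add: linear_map_def)
qed

text \<open>
  For a bimodule map \<open>f : X \<rightarrow> A\<close> this is \<open>f \<otimes> L : X \<otimes>\<^sub>A L \<rightarrow> A \<otimes>\<^sub>A L = L\<close>.
\<close>

definition eval_map where
  "eval_map L f = tensor_lift L (\<lambda>x m. f x \<odot>\<^bsub>L\<^esub> m)"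

lemma eval_map:
  assumes X: "left_module E X" and L: "left_module A L" and f: "f \<in> linear_map E X (regular_bimodule A)"
  shows eval_map_linear: "eval_map L f \<in> linear_map A (T X L) L"
    and eval_map_pt: "x \<in> carrier X \<Longrightarrow> m \<in> carrier L \<Longrightarrow> eval_map L f (pt X L x m) = f x \<odot>\<^bsub>L\<^esub> m"
proof -
  note ab = left_module_abelian_group[OF L]
  note fc [simp] = linear_map_closed[OF f, simplified]
  have fl: "f (lact X a x) = a \<otimes>\<^bsub>A\<^esub> f x" if "a \<in> carrier A" "x \<in> carrier X" for a x
    using that linear_map_lact[OF f that] by (simp add: regular_lact)
  have fr: "f (a \<odot>\<^bsub>rmod X\<^esub> x) = f x \<otimes>\<^bsub>A\<^esub> a" if "a \<in> carrier A" "x \<in> carrier X" for a x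
    using that linear_map_smult[OF linear_map_rmod[OF f]] by (simp add: regular_rmod)
  have \<beta>: "balanced_map A (rmod X) L L (\<lambda>x m. f x \<odot>\<^bsub>L\<^esub> m)"
    using L by (intro balanced_mapI)
      (auto simp: fr left_module.smult_closed left_module.smult_r_distr left_module.smult_l_distr
        left_module.smult_assoc linear_map_add[OF f, simplified])
  have pt: "eval_map L f (pt X L x m) = f x \<odot>\<^bsub>L\<^esub> m" if "x \<in> carrier X" "m \<in> carrier L" for x m
    unfolding eval_map_def by (rule T_lift_pt[OF X L ab \<beta> that])
  have h: "eval_map L f \<in> add_hom (T X L) L"
    unfolding eval_map_def by (rule T_lift_hom[OF X L ab \<beta>])
  have "eval_map L f (a \<odot>\<^bsub>T X L\<^esub> u) = a \<odot>\<^bsub>L\<^esub> eval_map L f u"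
    if a: "a \<in> carrier A" and u: "u \<in> carrier (T X L)" for a u
    by (rule T_eqI[OF X L ab _ _ _ u, of "\<lambda>u. eval_map L f (a \<odot>\<^bsub>T X L\<^esub> u)"])
       (use X L a add_hom_comp[OF T_smult_hom[OF X L a] h] add_hom_comp[OF h smult_add_hom[OF L a]]
        in \<open>simp_all add: T_smult_pt pt fl lact_closed left_module.smult_assoc\<close>)
  then show "eval_map L f \<in> linear_map A (T X L) L" using h by (simp add: linear_map_def)
  show "eval_map L f (pt X L x m) = f x \<odot>\<^bsub>L\<^esub> m" if "x \<in> carrier X" "m \<in> carrier L"
    by (rule pt[OF that])
qed

end

section \<open>Lifting linear maps over a field\<close>

lemma left_module_minus_scalar:
  assumes "left_module R M" "a \<in> carrier R" "x \<in> carrier M"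
  shows "(\<ominus>\<^bsub>R\<^esub> a) \<odot>\<^bsub>M\<^esub> x = \<ominus>\<^bsub>M\<^esub> (a \<odot>\<^bsub>M\<^esub> x)"
  by (rule add_hom_minus[of R M "\<lambda>a. a \<odot>\<^bsub>M\<^esub> x"])
     (use assms in \<open>auto simp: left_module_abelian_group left_module.smult_closed left_module.smult_l_distr
        ring.is_abelian_group[OF left_module_ring] intro!: add_homI\<close>)

lemma left_module_zero_scalar:
  assumes "left_module R M" "x \<in> carrier M"
  shows "\<zero>\<^bsub>R\<^esub> \<odot>\<^bsub>M\<^esub> x = \<zero>\<^bsub>M\<^esub>"
  by (rule add_hom_zero[of R M "\<lambda>a. a \<odot>\<^bsub>M\<^esub> x"])
     (use assms in \<open>auto simp: left_module_abelian_group left_module.smult_closed left_module.smult_l_distr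
        ring.is_abelian_group[OF left_module_ring] intro!: add_homI\<close>)

lemma linear_map_diff_zero:
  assumes "left_module R M" "left_module R N" "f \<in> linear_map R M N"
    and "x \<in> carrier M" "y \<in> carrier M" "f x = f y"
  shows "f (x \<oplus>\<^bsub>M\<^esub> \<ominus>\<^bsub>M\<^esub> y) = \<zero>\<^bsub>N\<^esub>"
proof -
  interpret M: abelian_group M using assms by (simp add: left_module_abelian_group)
  interpret N: abelian_group N using assms by (simp add: left_module_abelian_group)
  show ?thesis
    using assms by (simp add: linear_map_add[OF assms(3)] linear_map_minus[OF assms(1-3)]
        linear_map_closed[OF assms(3)] N.r_neg)
qed

text \<open>
  A lift of \<open>h : V \<rightarrow> Y\<close> along \<open>g : X \<rightarrow> Y\<close>, defined on a subspace \<open>W\<close> of \<open>V\<close> only.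
\<close>

definition lift_on where
  "lift_on k V X h g W \<theta> \<longleftrightarrow> submodule W k V \<and> \<theta> \<in> linear_map k (V\<lparr>carrier := W\<rparr>) X \<and> (\<forall>w\<in>W. g (\<theta> w) = h w)"

lemma left_submoduleI:
  assumes M: "left_module R M" and "H \<subseteq> carrier M" "\<zero>\<^bsub>M\<^esub> \<in> H"
    and "\<And>a b. a \<in> H \<Longrightarrow> b \<in> H \<Longrightarrow> a \<oplus>\<^bsub>M\<^esub> b \<in> H"
    and sm: "\<And>a x. a \<in> carrier R \<Longrightarrow> x \<in> H \<Longrightarrow> a \<odot>\<^bsub>M\<^esub> x \<in> H"
  shows "submodule H R M"
proof -
  interpret R: ring R by (rule left_module_ring[OF M])
  have "\<ominus>\<^bsub>M\<^esub> x \<in> H" if "x \<in> H" for x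
  proof -
    have "x \<in> carrier M" using that assms by auto
    then have "\<ominus>\<^bsub>M\<^esub> x = (\<ominus>\<^bsub>R\<^esub> \<one>\<^bsub>R\<^esub>) \<odot>\<^bsub>M\<^esub> x"
      using left_module_minus_scalar[OF M] left_module.smult_one[OF M] by simp
    then show ?thesis using sm[OF _ that] by simp
  qed
  then show ?thesis
    using assms by (intro submodule.intro subgroup.intro submodule_axioms.intro) (auto simp: a_inv_def)
qed

lemma submoduleD:
  assumes "submodule H R M"
  shows "H \<subseteq> carrier M" "\<zero>\<^bsub>M\<^esub> \<in> H" "\<And>a b. a \<in> H \<Longrightarrow> b \<in> H \<Longrightarrow> a \<oplus>\<^bsub>M\<^esub> b \<in> H"
    "\<And>a x. a \<in> carrier R \<Longrightarrow> x \<in> H \<Longrightarrow> a \<odot>\<^bsub>M\<^esub> x \<in> H" "\<And>x. x \<in> H \<Longrightarrow> \<ominus>\<^bsub>M\<^esub> x \<in> H"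
  using subgroup.subset[OF submodule.axioms(1)[OF assms]] subgroup.one_closed[OF submodule.axioms(1)[OF assms]]
    subgroup.m_closed[OF submodule.axioms(1)[OF assms]] submodule.smult_closed[OF assms]
    subgroup.m_inv_closed[OF submodule.axioms(1)[OF assms]]
  by (auto simp: a_inv_def)

text \<open>
  Over a field, if \<open>v\<close> is not in \<open>W\<close>, every element of \<open>kv + W\<close> is uniquely of the form \<open>cv + w\<close>; any
  preimage of \<open>h v\<close> may serve as the value at \<open>v\<close>.
\<close>

lemma lift_on_insert:
  assumes k: "field k" and V: "left_module k V" and X: "left_module k X" and Y: "left_module k Y"
    and h: "h \<in> linear_map k V Y" and g: "g \<in> linear_map k X Y"
    and im: "\<And>v. v \<in> carrier V \<Longrightarrow> h v \<in> g ` carrier X"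
    and W: "lift_on k V X h g W \<theta>" and v: "v \<in> carrier V"
  shows "\<exists>W' \<theta>'. lift_on k V X h g W' \<theta>' \<and> insert v W \<subseteq> W'"
proof (cases "v \<in> W")
  case True
  then show ?thesis using W by blast
next
  case False
  interpret k: field k by fact
  interpret V: left_module k V by fact
  interpret X: left_module k X by fact
  interpret Y: left_module k Y by fact
  have sub: "submodule W k V" and \<theta>: "\<theta> \<in> linear_map k (V\<lparr>carrier := W\<rparr>) X"
    and g\<theta>: "\<And>w. w \<in> W \<Longrightarrow> g (\<theta> w) = h w" using W by (auto simp: lift_on_def)
  note Wd = submoduleD[OF sub]
  have \<theta>c [simp]: "\<theta> w \<in> carrier X" if "w \<in> W" for w
    using linear_map_closed[OF \<theta>] that by simp
  have \<theta>a: "\<theta> (w \<oplus>\<^bsub>V\<^esub> w') = \<theta> w \<oplus>\<^bsub>X\<^esub> \<theta> w'" if "w \<in> W" "w' \<in> W" for w w'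
    using linear_map_add[OF \<theta>] that by simp
  have \<theta>s: "\<theta> (c \<odot>\<^bsub>V\<^esub> w) = c \<odot>\<^bsub>X\<^esub> \<theta> w" if "w \<in> W" "c \<in> carrier k" for w c
    using linear_map_smult[OF \<theta>] that by simp
  have WV [simp]: "w \<in> carrier V" if "w \<in> W" for w using that Wd(1) by auto
  obtain x where x: "x \<in> carrier X" "g x = h v" using im[OF v] by (metis imageE)
  have uniq: "c = c' \<and> w = w'"
    if c: "c \<in> carrier k" "c' \<in> carrier k" "w \<in> W" "w' \<in> W" and e: "c \<odot>\<^bsub>V\<^esub> v \<oplus>\<^bsub>V\<^esub> w = c' \<odot>\<^bsub>V\<^esub> v \<oplus>\<^bsub>V\<^esub> w'"
    for c c' w w'
  proof -
    have cl: "c \<odot>\<^bsub>V\<^esub> v \<in> carrier V" "c' \<odot>\<^bsub>V\<^esub> v \<in> carrier V" using c v by (auto intro: V.smult_closed)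
    have "(c \<ominus>\<^bsub>k\<^esub> c') \<odot>\<^bsub>V\<^esub> v = c \<odot>\<^bsub>V\<^esub> v \<oplus>\<^bsub>V\<^esub> \<ominus>\<^bsub>V\<^esub> (c' \<odot>\<^bsub>V\<^esub> v)"
      using c v by (simp add: k.minus_eq V.smult_l_distr left_module_minus_scalar[OF V])
    also have "\<dots> = w' \<oplus>\<^bsub>V\<^esub> \<ominus>\<^bsub>V\<^esub> w"
    proof -
      have "c \<odot>\<^bsub>V\<^esub> v = (c' \<odot>\<^bsub>V\<^esub> v \<oplus>\<^bsub>V\<^esub> w') \<oplus>\<^bsub>V\<^esub> \<ominus>\<^bsub>V\<^esub> w"
        using cl c by (simp add: V.a_assoc V.r_neg flip: e)
      then show ?thesis using cl c by (simp add: V.a_ac V.r_neg V.r_neg1 V.r_neg2)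
    qed
    also have "\<dots> \<in> W" using c Wd by simp
    finally have inW: "(c \<ominus>\<^bsub>k\<^esub> c') \<odot>\<^bsub>V\<^esub> v \<in> W" .
    have "c = c'"
    proof (rule ccontr)
      assume "c \<noteq> c'"
      have "c \<ominus>\<^bsub>k\<^esub> c' \<noteq> \<zero>\<^bsub>k\<^esub>"
      proof
        assume "c \<ominus>\<^bsub>k\<^esub> c' = \<zero>\<^bsub>k\<^esub>"
        then have "\<ominus>\<^bsub>k\<^esub> (\<ominus>\<^bsub>k\<^esub> c') = c" using c by (intro k.minus_equality) (auto simp: k.minus_eq)
        then show False using c \<open>c \<noteq> c'\<close> by simp
      qed
      then have nz: "c \<ominus>\<^bsub>k\<^esub> c' \<in> Units k" using c by (simp add: k.field_Units)
      then have "inv\<^bsub>k\<^esub> (c \<ominus>\<^bsub>k\<^esub> c') \<odot>\<^bsub>V\<^esub> ((c \<ominus>\<^bsub>k\<^esub> c') \<odot>\<^bsub>V\<^esub> v) \<in> W"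
        using inW Wd(4) by simp
      moreover have "inv\<^bsub>k\<^esub> (c \<ominus>\<^bsub>k\<^esub> c') \<odot>\<^bsub>V\<^esub> ((c \<ominus>\<^bsub>k\<^esub> c') \<odot>\<^bsub>V\<^esub> v) = v"
        using nz c v by (simp add: k.Units_l_inv V.smult_one flip: V.smult_assoc)
      ultimately show False using False by simp
    qed
    then show ?thesis using e cl c by simp
  qed
  define W' where "W' = {c \<odot>\<^bsub>V\<^esub> v \<oplus>\<^bsub>V\<^esub> w | c w. c \<in> carrier k \<and> w \<in> W}"
  define \<theta>' where "\<theta>' u = (THE t. \<exists>c\<in>carrier k. \<exists>w\<in>W. u = c \<odot>\<^bsub>V\<^esub> v \<oplus>\<^bsub>V\<^esub> w \<and> t = c \<odot>\<^bsub>X\<^esub> x \<oplus>\<^bsub>X\<^esub> \<theta> w)" for u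
  have \<theta>': "\<theta>' (c \<odot>\<^bsub>V\<^esub> v \<oplus>\<^bsub>V\<^esub> w) = c \<odot>\<^bsub>X\<^esub> x \<oplus>\<^bsub>X\<^esub> \<theta> w" if "c \<in> carrier k" "w \<in> W" for c w
    unfolding \<theta>'_def
    by (rule the_equality) (use that uniq in \<open>blast+\<close>)
  have addV: "(c \<odot>\<^bsub>V\<^esub> v \<oplus>\<^bsub>V\<^esub> w) \<oplus>\<^bsub>V\<^esub> (c' \<odot>\<^bsub>V\<^esub> v \<oplus>\<^bsub>V\<^esub> w') = (c \<oplus>\<^bsub>k\<^esub> c') \<odot>\<^bsub>V\<^esub> v \<oplus>\<^bsub>V\<^esub> (w \<oplus>\<^bsub>V\<^esub> w')"
    if "c \<in> carrier k" "c' \<in> carrier k" "w \<in> W" "w' \<in> W" for c c' w w'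
    using that v by (simp add: V.smult_l_distr V.smult_closed V.a_ac)
  have smV: "a \<odot>\<^bsub>V\<^esub> (c \<odot>\<^bsub>V\<^esub> v \<oplus>\<^bsub>V\<^esub> w) = (a \<otimes>\<^bsub>k\<^esub> c) \<odot>\<^bsub>V\<^esub> v \<oplus>\<^bsub>V\<^esub> a \<odot>\<^bsub>V\<^esub> w"
    if "a \<in> carrier k" "c \<in> carrier k" "w \<in> W" for a c w
    using that v by (simp add: V.smult_r_distr V.smult_closed V.smult_assoc)
  have el: "c \<odot>\<^bsub>V\<^esub> v \<oplus>\<^bsub>V\<^esub> w \<in> W'" if "c \<in> carrier k" "w \<in> W" for c w
    using that by (auto simp: W'_def)
  have W'V: "W' \<subseteq> carrier V" using v by (auto simp: W'_def V.smult_closed)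
  have WW': "W \<subseteq> W'"
  proof
    fix w assume w: "w \<in> W"
    have "\<zero>\<^bsub>k\<^esub> \<odot>\<^bsub>V\<^esub> v \<oplus>\<^bsub>V\<^esub> w = w" using w v by (simp add: left_module_zero_scalar[OF V])
    then show "w \<in> W'" using el[OF k.zero_closed w] by simp
  qed
  have vW': "v \<in> W'" using el[OF k.one_closed Wd(2)] v by (simp add: V.smult_one)
  have sub': "submodule W' k V"
  proof (rule left_submoduleI[OF V W'V])
    show "\<zero>\<^bsub>V\<^esub> \<in> W'" using WW' Wd(2) by auto
    show "a \<oplus>\<^bsub>V\<^esub> b \<in> W'" if "a \<in> W'" "b \<in> W'" for a b
      using that Wd(3) el unfolding W'_def by (auto simp: addV)
    show "a \<odot>\<^bsub>V\<^esub> b \<in> W'" if "a \<in> carrier k" "b \<in> W'" for a b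
      using that Wd(4) el unfolding W'_def by (auto simp: smV)
  qed
  have "\<theta>' \<in> linear_map k (V\<lparr>carrier := W'\<rparr>) X"
  proof (rule linear_mapI)
    fix u assume "u \<in> carrier (V\<lparr>carrier := W'\<rparr>)"
    then obtain c w where u: "u = c \<odot>\<^bsub>V\<^esub> v \<oplus>\<^bsub>V\<^esub> w" "c \<in> carrier k" "w \<in> W" by (auto simp: W'_def)
    show "\<theta>' u \<in> carrier X" using u x by (simp add: \<theta>' X.smult_closed)
    show "\<theta>' (a \<odot>\<^bsub>V\<lparr>carrier := W'\<rparr>\<^esub> u) = a \<odot>\<^bsub>X\<^esub> \<theta>' u" if a: "a \<in> carrier k" for a
      using u x a Wd(4) by (simp add: smV \<theta>' X.smult_closed X.smult_r_distr X.smult_assoc \<theta>s)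
    fix u' assume "u' \<in> carrier (V\<lparr>carrier := W'\<rparr>)"
    then obtain c' w' where u': "u' = c' \<odot>\<^bsub>V\<^esub> v \<oplus>\<^bsub>V\<^esub> w'" "c' \<in> carrier k" "w' \<in> W" by (auto simp: W'_def)
    show "\<theta>' (u \<oplus>\<^bsub>V\<lparr>carrier := W'\<rparr>\<^esub> u') = \<theta>' u \<oplus>\<^bsub>X\<^esub> \<theta>' u'"
      using u u' x Wd(3) by (simp add: addV \<theta>' X.smult_closed X.smult_l_distr \<theta>a X.a_ac)
  qed
  moreover have "g (\<theta>' u) = h u" if u: "u \<in> W'" for u
  proof -
    obtain c w where u: "u = c \<odot>\<^bsub>V\<^esub> v \<oplus>\<^bsub>V\<^esub> w" "c \<in> carrier k" "w \<in> W" using u by (auto simp: W'_def)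
    then show ?thesis
      using x v by (simp add: \<theta>' linear_map_add[OF g] linear_map_add[OF h] linear_map_smult[OF g]
          linear_map_smult[OF h] X.smult_closed V.smult_closed g\<theta>)
  qed
  ultimately show ?thesis
    using sub' WW' vW' by (intro exI[of _ W'] exI[of _ \<theta>']) (auto simp: lift_on_def)
qed

text \<open>
  A finitely generated space is exhausted by adding one generator at a time to the zero subspace.
\<close>

lemma field_linear_lift:
  assumes k: "field k" and V: "left_module k V" and fg: "finitely_generated k V"
    and X: "left_module k X" and Y: "left_module k Y"
    and h: "h \<in> linear_map k V Y" and g: "g \<in> linear_map k X Y"
    and im: "\<And>v. v \<in> carrier V \<Longrightarrow> h v \<in> g ` carrier X"
  shows "\<exists>\<theta>\<in>linear_map k V X. \<forall>v\<in>carrier V. g (\<theta> v) = h v"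
proof -
  interpret V: left_module k V by fact
  interpret X: left_module k X by fact
  obtain S where S: "finite S" "S \<subseteq> carrier V" "carrier V = submodule_span k V S"
    using fg unfolding finitely_generated_def by blast
  have "\<exists>W \<theta>. lift_on k V X h g W \<theta> \<and> S \<subseteq> W"
    using S(1,2)
  proof (induction S rule: finite_induct)
    case empty
    have "submodule {\<zero>\<^bsub>V\<^esub>} k V" by (rule left_submoduleI[OF V]) (auto simp: smult_zero[OF V])
    then have "lift_on k V X h g {\<zero>\<^bsub>V\<^esub>} (\<lambda>_. \<zero>\<^bsub>X\<^esub>)"
      unfolding lift_on_def using linear_map_zero[OF X Y g] linear_map_zero[OF V Y h]
      by (auto intro!: linear_mapI simp: smult_zero[OF X])
    then show ?case by blast
  next
    case (insert v S)
    then obtain W \<theta> where W: "lift_on k V X h g W \<theta>" "S \<subseteq> W" by auto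
    from lift_on_insert[OF k V X Y h g im W(1), of v] insert.prems
    show ?case using W(2) by (meson insert_subset order_trans subset_insertI)
  qed
  then obtain W \<theta> where W: "lift_on k V X h g W \<theta>" "S \<subseteq> W" by blast
  then have "submodule W k V" by (simp add: lift_on_def)
  then have "W = carrier V"
    using S(3) W(2) submoduleD(1) unfolding submodule_span_def by blast
  then show ?thesis using W(1) unfolding lift_on_def by (intro bexI[of _ \<theta>]) (auto simp: linear_map_def hom_def)
qed

section \<open>Exactness of the tensored resolution\<close>

text \<open>
  What is used of a resolution that receives chain maps.  Unlike in
  \<^const>\<open>projective_resolution\<close>, the modules need not be projective and the maps need not be
  extensional, so that \<^const>\<open>tensor_resolution\<close> can satisfy it.
\<close>

definition exact_resolution where
  "exact_resolution R L D \<longleftrightarrow> left_module R L \<and>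
    (\<forall>n. left_module R (res_mod D n)) \<and>
    (\<forall>n. res_diff D n \<in> linear_map R (res_mod D (Suc n)) (res_mod D n)) \<and>
    res_aug D \<in> linear_map R (res_mod D 0) L \<and>
    carrier L \<subseteq> res_aug D ` carrier (res_mod D 0) \<and>
    (\<forall>x\<in>carrier (res_mod D (Suc 0)). res_aug D (res_diff D 0 x) = \<zero>\<^bsub>L\<^esub>) \<and>
    (\<forall>n. \<forall>x\<in>carrier (res_mod D (Suc (Suc n))). res_diff D n (res_diff D (Suc n) x) = \<zero>\<^bsub>res_mod D n\<^esub>) \<and>
    (\<forall>x\<in>carrier (res_mod D 0). res_aug D x = \<zero>\<^bsub>L\<^esub> \<longrightarrow> x \<in> res_diff D 0 ` carrier (res_mod D (Suc 0))) \<and>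
    (\<forall>n. \<forall>x\<in>carrier (res_mod D (Suc n)). res_diff D n x = \<zero>\<^bsub>res_mod D n\<^esub> \<longrightarrow>
      x \<in> res_diff D (Suc n) ` carrier (res_mod D (Suc (Suc n))))"

lemma projective_resolution_exact:
  assumes "left_module R L" "projective_resolution R L D"
  shows "exact_resolution R L D"
proof -
  have "x \<in> res_diff D n ` carrier (res_mod D (Suc n)) \<longleftrightarrow>
      x \<in> carrier (res_mod D n) \<and> (case n of 0 \<Rightarrow> res_aug D x = \<zero>\<^bsub>L\<^esub> | Suc m \<Rightarrow> res_diff D m x = \<zero>\<^bsub>res_mod D m\<^esub>)" for n x
    using assms(2) by (cases n) (auto simp: projective_resolution_def)
  note im = this[of _ 0, simplified] this[of _ "Suc n" for n, simplified]
  have "res_aug D (res_diff D 0 x) = \<zero>\<^bsub>L\<^esub>" if "x \<in> carrier (res_mod D (Suc 0))" for x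
    using im(1)[of "res_diff D 0 x"] that by blast
  moreover have "res_diff D n (res_diff D (Suc n) x) = \<zero>\<^bsub>res_mod D n\<^esub>"
    if "x \<in> carrier (res_mod D (Suc (Suc n)))" for n x
    using im(2)[of "res_diff D (Suc n) x" n] that by blast
  ultimately show ?thesis
    using assms im unfolding exact_resolution_def projective_resolution_def projective_module_def
    by (auto simp: module_hom_linear)
qed

context fd_algebra begin

lemma E_eqI:
  assumes "abelian_group Z" "f \<in> add_hom E Z" "g \<in> add_hom E Z"
    and "\<And>a b. a \<in> carrier A \<Longrightarrow> b \<in> carrier A \<Longrightarrow> f (env a b) = g (env a b)"
    and "u \<in> carrier E"
  shows "f u = g u"
  using env.tensor_add_hom_eqI[OF assms(1), of f g u] assms by (simp add: E_simps)

lemma kA_left_module: "left_module k A"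
  by (intro left_module.intro left_module_axioms.intro k.ring_axioms A.is_abelian_group)
     (auto simp: kA.smult_l_distr kA.smult_r_distr kA.smult_assoc1)

text \<open>
  A bimodule as a module over the ground field, with \<open>c\<close> acting as right multiplication by \<open>c \<cdot> 1\<close>.
\<close>

definition scalar_mod where
  "scalar_mod X = \<lparr>carrier = carrier X, monoid.mult = undefined, one = undefined, ring.zero = \<zero>\<^bsub>X\<^esub>,
    ring.add = ring.add X, module.smult = (\<lambda>c x. (c \<odot>\<^bsub>A\<^esub> \<one>\<^bsub>A\<^esub>) \<odot>\<^bsub>rmod X\<^esub> x)\<rparr>"

lemma scalar_mod_simps [simp]:
  "carrier (scalar_mod X) = carrier X" "ring.add (scalar_mod X) = ring.add X" "\<zero>\<^bsub>scalar_mod X\<^esub> = \<zero>\<^bsub>X\<^esub>"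
  "c \<odot>\<^bsub>scalar_mod X\<^esub> x = (c \<odot>\<^bsub>A\<^esub> \<one>\<^bsub>A\<^esub>) \<odot>\<^bsub>rmod X\<^esub> x"
  by (simp_all add: scalar_mod_def)

lemma scalar_one_mult: "c \<in> carrier k \<Longrightarrow> a \<in> carrier A \<Longrightarrow> (c \<odot>\<^bsub>A\<^esub> \<one>\<^bsub>A\<^esub>) \<otimes>\<^bsub>A\<^esub> a = c \<odot>\<^bsub>A\<^esub> a"
  by (simp add: scalar_mult_left)

lemma scalar_mod_left_module:
  assumes X: "left_module E X" shows "left_module k (scalar_mod X)"
proof (intro left_module.intro left_module_axioms.intro k.ring_axioms)
  show "abelian_group (scalar_mod X)"
    by (rule abelian_group_transfer[OF left_module_abelian_group[OF X]]) auto
  show "(a \<otimes>\<^bsub>k\<^esub> b) \<odot>\<^bsub>scalar_mod X\<^esub> x = a \<odot>\<^bsub>scalar_mod X\<^esub> (b \<odot>\<^bsub>scalar_mod X\<^esub> x)"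
    if "a \<in> carrier k" "b \<in> carrier k" "x \<in> carrier (scalar_mod X)" for a b x
  proof -
    have "(a \<otimes>\<^bsub>k\<^esub> b) \<odot>\<^bsub>A\<^esub> \<one>\<^bsub>A\<^esub> = (b \<odot>\<^bsub>A\<^esub> \<one>\<^bsub>A\<^esub>) \<otimes>\<^bsub>A\<^esub> (a \<odot>\<^bsub>A\<^esub> \<one>\<^bsub>A\<^esub>)"
      using that by (simp add: scalar_one_mult k.m_comm[of a b] flip: kA.smult_assoc1)
    then show ?thesis using that by (simp add: rmod_mult[OF X])
  qed
qed (use X in \<open>auto simp: rmod_closed rmod_add rmod_scalar_add kA.smult_l_distr rmod_one\<close>)

lemma linear_map_scalar_mod:
  "p \<in> linear_map A (rmod X) (rmod Y) \<Longrightarrow> p \<in> linear_map k (scalar_mod X) (scalar_mod Y)"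
  by (auto simp: linear_map_def hom_def)

text \<open>
  A bimodule that is projective over the enveloping algebra \<open>A \<otimes>\<^sub>k A\<close> is projective as a right module.
  Indeed \<open>A \<otimes>\<^sub>k A\<close> is induced from the vector space \<open>A\<close> as a right module: its right linear maps are
  \<open>a \<otimes> b \<mapsto> \<theta>(a) \<cdot> b\<close> with \<open>\<theta>\<close> linear over \<open>k\<close>, and linear maps over a field can be lifted.
\<close>

lemma rmod_lift:
  fixes P :: "(('a \<times> 'a \<Rightarrow>\<^sub>0 int) set, 'p, 'u) module_scheme"
  assumes P: "projective_module E P"
    and X: "left_module E X" and Y: "left_module E Y"
    and h: "h \<in> linear_map A (rmod P) (rmod Y)" and g: "g \<in> linear_map A (rmod X) (rmod Y)"
    and im: "\<And>p. p \<in> carrier P \<Longrightarrow> h p \<in> g ` carrier X"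
  shows "\<exists>l\<in>linear_map A (rmod P) (rmod X). \<forall>p\<in>carrier P. g (l p) = h p"
proof -
  have PM: "left_module E P" using P by (simp add: projective_module_def)
  interpret E: ring E using PM by (simp add: left_module_def)
  obtain I s r where s: "s \<in> module_hom E P (free_module E (I :: 'p set))"
    and r: "r \<in> module_hom E (free_module E I) P" and rs: "\<And>x. x \<in> carrier P \<Longrightarrow> r (s x) = x"
    using P unfolding projective_module_def by blast
  let ?F = "free_module E I"
  note rl = module_hom_linear[OF r] and sl = module_hom_linear[OF s]
  have abX: "abelian_group X" and abY: "abelian_group Y"
    using X Y by (auto intro: left_module_abelian_group)
  have h_env: "h (r (free_single E I i (env a b))) = b \<odot>\<^bsub>rmod Y\<^esub> h (r (free_single E I i (env a \<one>\<^bsub>A\<^esub>)))"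
    if "i \<in> I" "a \<in> carrier A" "b \<in> carrier A" for i a b
  proof -
    have "env a b = env \<one>\<^bsub>A\<^esub> b \<otimes>\<^bsub>E\<^esub> env a \<one>\<^bsub>A\<^esub>" using that by (simp add: env_mult)
    then have "free_single E I i (env a b) = env \<one>\<^bsub>A\<^esub> b \<odot>\<^bsub>?F\<^esub> free_single E I i (env a \<one>\<^bsub>A\<^esub>)"
      using that by (simp add: E.free_single_smult)
    then have "r (free_single E I i (env a b)) = b \<odot>\<^bsub>rmod P\<^esub> r (free_single E I i (env a \<one>\<^bsub>A\<^esub>))"
      using that by (simp add: linear_map_smult[OF rl] E.free_single_closed rmod_smult)
    then show ?thesis
      using that linear_map_smult[OF h] linear_map_closed[OF rl] by (simp add: E.free_single_closed)
  qed
  have "\<exists>\<theta>\<in>linear_map k A (scalar_mod X). \<forall>a\<in>carrier A. g (\<theta> a) = h (r (free_single E I i (env a \<one>\<^bsub>A\<^esub>)))"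
    if i: "i \<in> I" for i
  proof (rule field_linear_lift[OF k.field_axioms kA_left_module _ scalar_mod_left_module[OF X]
        scalar_mod_left_module[OF Y] _ linear_map_scalar_mod[OF g]])
    show "finitely_generated k A" using fd by (simp add: fin_dim_algebra_def)
    show "(\<lambda>a. h (r (free_single E I i (env a \<one>\<^bsub>A\<^esub>)))) \<in> linear_map k A (scalar_mod Y)"
    proof (rule linear_mapI)
      fix a assume a: "a \<in> carrier A"
      show "h (r (free_single E I i (env a \<one>\<^bsub>A\<^esub>))) \<in> carrier (scalar_mod Y)"
        using a i linear_map_closed[OF h] linear_map_closed[OF rl] by (simp add: E.free_single_closed)
      show "h (r (free_single E I i (env (c \<odot>\<^bsub>A\<^esub> a) \<one>\<^bsub>A\<^esub>))) = c \<odot>\<^bsub>scalar_mod Y\<^esub> h (r (free_single E I i (env a \<one>\<^bsub>A\<^esub>)))"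
        if "c \<in> carrier k" for c
        using that a i h_env[of i a "c \<odot>\<^bsub>A\<^esub> \<one>\<^bsub>A\<^esub>"] by (simp add: env_scalar)
      fix b assume b: "b \<in> carrier A"
      show "h (r (free_single E I i (env (a \<oplus>\<^bsub>A\<^esub> b) \<one>\<^bsub>A\<^esub>))) =
          h (r (free_single E I i (env a \<one>\<^bsub>A\<^esub>))) \<oplus>\<^bsub>scalar_mod Y\<^esub> h (r (free_single E I i (env b \<one>\<^bsub>A\<^esub>)))"
        using a b i linear_map_add[OF h] linear_map_closed[OF rl]
        by (simp add: env_add_left E.free_single_add E.free_single_closed linear_map_add[OF rl])
    qed
    show "h (r (free_single E I i (env a \<one>\<^bsub>A\<^esub>))) \<in> g ` carrier (scalar_mod X)" if "a \<in> carrier A" for a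
      using im[OF linear_map_closed[OF rl E.free_single_closed]] that i by simp
  qed
  then obtain \<theta> where \<theta>: "\<And>i. i \<in> I \<Longrightarrow> \<theta> i \<in> linear_map k A (scalar_mod X)"
    and g\<theta>: "\<And>i a. i \<in> I \<Longrightarrow> a \<in> carrier A \<Longrightarrow> g (\<theta> i a) = h (r (free_single E I i (env a \<one>\<^bsub>A\<^esub>)))" by metis
  note \<theta>c [simp] = linear_map_closed[OF \<theta>, simplified]
  let ?\<beta> = "\<lambda>i a b. b \<odot>\<^bsub>rmod X\<^esub> \<theta> i a"
  have \<beta>: "balanced_map k A (opposite A) X (?\<beta> i)" if i: "i \<in> I" for i
  proof (rule balanced_mapI)
    fix c a b assume "c \<in> carrier k" "a \<in> carrier A" "b \<in> carrier (opposite A)"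
    then show "b \<odot>\<^bsub>rmod X\<^esub> \<theta> i (c \<odot>\<^bsub>A\<^esub> a) = (c \<odot>\<^bsub>opposite A\<^esub> b) \<odot>\<^bsub>rmod X\<^esub> \<theta> i a"
      using i by (simp add: linear_map_smult[OF \<theta>] scalar_one_mult flip: rmod_mult[OF X])
  qed (use i in \<open>auto simp: linear_map_add[OF \<theta>] rmod_closed[OF X] rmod_add[OF X] rmod_scalar_add[OF X]\<close>)
  define l where "l i = tensor_lift X (?\<beta> i)" for i
  have l: "l i \<in> add_hom E X" if "i \<in> I" for i
    unfolding l_def using env.tensor_lift_hom[OF abX \<beta>[OF that]] by (simp add: E_simps hom_def)
  have l_env: "l i (env a b) = b \<odot>\<^bsub>rmod X\<^esub> \<theta> i a" if "i \<in> I" "a \<in> carrier A" "b \<in> carrier A" for i a b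
    unfolding l_def using env.tensor_lift_pure[OF abX \<beta>[OF that(1)]] that by simp
  obtain L where L: "L \<in> add_hom ?F X"
    and Ld: "\<And>i u. i \<in> I \<Longrightarrow> u \<in> carrier E \<Longrightarrow> L (free_single E I i u) = l i u"
    using E.free_module_universal[OF abX, of I l] l by blast
  have del: "(\<lambda>u. free_single E I i u) \<in> add_hom E ?F" if "i \<in> I" for i
    using that by (intro add_homI) (auto simp: E.free_single_closed E.free_single_add)
  have L_smult: "L (env \<one>\<^bsub>A\<^esub> b \<odot>\<^bsub>?F\<^esub> y) = b \<odot>\<^bsub>rmod X\<^esub> L y"
    if b: "b \<in> carrier A" and y: "y \<in> carrier ?F" for b y
  proof (rule E.free_module_add_hom_eqI[OF abX, of "\<lambda>y. L (env \<one>\<^bsub>A\<^esub> b \<odot>\<^bsub>?F\<^esub> y)" I "\<lambda>y. b \<odot>\<^bsub>rmod X\<^esub> L y" y, OF _ _ _ y])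
    from add_hom_comp[OF E.free_module_smult_add_hom[OF env_closed[OF A.one_closed b]] L] show "(\<lambda>y. L (env \<one>\<^bsub>A\<^esub> b \<odot>\<^bsub>?F\<^esub> y)) \<in> add_hom ?F X" .
    have rh: "(\<lambda>x. b \<odot>\<^bsub>rmod X\<^esub> x) \<in> add_hom X X"
      using b by (intro add_homI) (auto simp: rmod_closed[OF X] rmod_add[OF X])
    from add_hom_comp[OF L rh] show "(\<lambda>y. b \<odot>\<^bsub>rmod X\<^esub> L y) \<in> add_hom ?F X" .
    fix i u assume i: "i \<in> I" and u: "u \<in> carrier E"
    have "l i (env \<one>\<^bsub>A\<^esub> b \<otimes>\<^bsub>E\<^esub> u) = b \<odot>\<^bsub>rmod X\<^esub> l i u"
    proof (rule E_eqI[OF abX _ _ _ u])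
      have "(\<lambda>u. env \<one>\<^bsub>A\<^esub> b \<otimes>\<^bsub>E\<^esub> u) \<in> add_hom E E" using b by (intro add_homI) (auto simp: E.r_distr)
      from add_hom_comp[OF this l[OF i]] show "(\<lambda>u. l i (env \<one>\<^bsub>A\<^esub> b \<otimes>\<^bsub>E\<^esub> u)) \<in> add_hom E X" .
      from add_hom_comp[OF l[OF i] rh] show "(\<lambda>u. b \<odot>\<^bsub>rmod X\<^esub> l i u) \<in> add_hom E X" .
    qed (use b i in \<open>simp add: env_mult l_env rmod_mult[OF X]\<close>)
    then show "L (env \<one>\<^bsub>A\<^esub> b \<odot>\<^bsub>?F\<^esub> free_single E I i u) = b \<odot>\<^bsub>rmod X\<^esub> L (free_single E I i u)"
      using i u b by (simp add: Ld flip: E.free_single_smult)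
  qed
  have gh: "g \<in> add_hom X Y" and hh: "h \<in> add_hom P Y"
    using linear_map_add_hom[OF g] linear_map_add_hom[OF h] by (simp_all add: hom_def)
  have gL: "g (L y) = h (r y)" if y: "y \<in> carrier ?F" for y
  proof (rule E.free_module_add_hom_eqI[OF abY, of "\<lambda>y. g (L y)" I "\<lambda>y. h (r y)" y, OF _ _ _ y])
    show "(\<lambda>y. g (L y)) \<in> add_hom ?F Y" using add_hom_comp[OF L gh] .
    show hr: "(\<lambda>y. h (r y)) \<in> add_hom ?F Y"
      using add_hom_comp[OF linear_map_add_hom[OF rl] hh] .
    fix i u assume i: "i \<in> I" and u: "u \<in> carrier E"
    have "g (l i u) = h (r (free_single E I i u))"
    proof (rule E_eqI[OF abY _ _ _ u])
      show "(\<lambda>u. g (l i u)) \<in> add_hom E Y" using add_hom_comp[OF l[OF i] gh] .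
      show "(\<lambda>u. h (r (free_single E I i u))) \<in> add_hom E Y" using add_hom_comp[OF del[OF i] hr] .
      show "g (l i (env a b)) = h (r (free_single E I i (env a b)))" if "a \<in> carrier A" "b \<in> carrier A" for a b
        using that i linear_map_smult[OF g] by (simp add: l_env h_env[OF i that] g\<theta>)
    qed
    then show "g (L (free_single E I i u)) = h (r (free_single E I i u))" using i u by (simp add: Ld)
  qed
  have "(\<lambda>p. L (s p)) \<in> linear_map A (rmod P) (rmod X)"
    using add_hom_comp[OF linear_map_add_hom[OF sl] L] linear_map_smult[OF sl] linear_map_closed[OF sl]
    by (auto simp: linear_map_def hom_def rmod_smult L_smult[unfolded rmod_smult])
  then show ?thesis
    by (intro bexI[of _ "\<lambda>p. L (s p)"]) (auto simp: gL linear_map_closed[OF sl] rs)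
qed

text \<open>
  A contracting homotopy of \<open>P \<rightarrow> A\<close> made of right \<open>A\<close>-linear maps; its part \<open>A \<rightarrow> P\<^sub>0\<close> is \<open>a \<mapsto> p \<cdot> a\<close>.
\<close>

lemma contracting_homotopy:
  assumes P: "projective_resolution E (regular_bimodule A) P" and reg: "left_module E (regular_bimodule A)"
  obtains p s where "p \<in> carrier (res_mod P 0)" "res_aug P p = \<one>\<^bsub>A\<^esub>"
    "\<And>n. s n \<in> linear_map A (rmod (res_mod P n)) (rmod (res_mod P (Suc n)))"
    "\<And>x. x \<in> carrier (res_mod P 0) \<Longrightarrow>
      res_diff P 0 (s 0 x) \<oplus>\<^bsub>res_mod P 0\<^esub> res_aug P x \<odot>\<^bsub>rmod (res_mod P 0)\<^esub> p = x"
    "\<And>n x. x \<in> carrier (res_mod P (Suc n)) \<Longrightarrow>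
      res_diff P (Suc n) (s (Suc n) x) \<oplus>\<^bsub>res_mod P (Suc n)\<^esub> s n (res_diff P n x) = x"
proof -
  have ex: "exact_resolution E (regular_bimodule A) P" by (rule projective_resolution_exact[OF reg P])
  have proj: "projective_module E (res_mod P n)" for n using P by (simp add: projective_resolution_def)
  have M: "left_module E (res_mod P n)" for n using ex by (simp add: exact_resolution_def)
  have ab: "abelian_group (res_mod P n)" for n by (rule left_module_abelian_group[OF M])
  let ?d = "res_diff P" and ?\<epsilon> = "res_aug P"
  have d: "?d n \<in> linear_map E (res_mod P (Suc n)) (res_mod P n)" for n using ex by (simp add: exact_resolution_def)
  have \<epsilon>: "?\<epsilon> \<in> linear_map E (res_mod P 0) (regular_bimodule A)" using ex by (simp add: exact_resolution_def)
  note dr = linear_map_rmod[OF d] and \<epsilon>r = linear_map_rmod[OF \<epsilon>]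
  note dc [simp] = linear_map_closed[OF d] and \<epsilon>c [simp] = linear_map_closed[OF \<epsilon>, simplified]
  obtain p where p: "p \<in> carrier (res_mod P 0)" "?\<epsilon> p = \<one>\<^bsub>A\<^esub>"
    using ex by (force simp: exact_resolution_def)
  have minus_closed: "x \<oplus>\<^bsub>res_mod P n\<^esub> \<ominus>\<^bsub>res_mod P n\<^esub> y \<in> carrier (res_mod P n)"
    if "x \<in> carrier (res_mod P n)" "y \<in> carrier (res_mod P n)" for x y n
  proof -
    interpret abelian_group "res_mod P n" by (rule ab)
    show ?thesis using that by simp
  qed
  have minus_hom: "(\<lambda>x. x \<oplus>\<^bsub>res_mod P n\<^esub> \<ominus>\<^bsub>res_mod P n\<^esub> f x) \<in> linear_map A (rmod (res_mod P n)) (rmod (res_mod P n))"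
    if f: "f \<in> linear_map A (rmod (res_mod P n)) (rmod (res_mod P n))" for f n
  proof -
    interpret PP: abelian_group "res_mod P n" by (rule ab)
    have neg: "a \<odot>\<^bsub>rmod (res_mod P n)\<^esub> (\<ominus>\<^bsub>res_mod P n\<^esub> x) = \<ominus>\<^bsub>res_mod P n\<^esub> (a \<odot>\<^bsub>rmod (res_mod P n)\<^esub> x)"
      if "a \<in> carrier A" "x \<in> carrier (res_mod P n)" for a x
      using that smult_minus[OF M] by (simp add: rmod_smult)
    show ?thesis
      using linear_map_closed[OF f] linear_map_add[OF f] linear_map_smult[OF f]
      by (intro linear_mapI) (auto simp: PP.minus_add PP.a_ac rmod_add[OF M] neg rmod_closed[OF M])
  qed
  have solve: "y \<oplus>\<^bsub>res_mod P n\<^esub> z = x"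
    if "y = x \<oplus>\<^bsub>res_mod P n\<^esub> \<ominus>\<^bsub>res_mod P n\<^esub> z" "x \<in> carrier (res_mod P n)" "z \<in> carrier (res_mod P n)" for n x y z
  proof -
    interpret abelian_group "res_mod P n" by (rule ab)
    show ?thesis using that by (simp add: a_assoc l_neg)
  qed
  have cancel: "y = x" if "y \<oplus>\<^bsub>res_mod P n\<^esub> \<zero>\<^bsub>res_mod P n\<^esub> = x" "y \<in> carrier (res_mod P n)" for n x y
  proof -
    interpret abelian_group "res_mod P n" by (rule ab)
    show ?thesis using that by simp
  qed
  let ?\<Phi> = "\<lambda>n s. s \<in> linear_map A (rmod (res_mod P n)) (rmod (res_mod P (Suc n))) \<and>
    (\<forall>x\<in>carrier (res_mod P (Suc n)). ?d n (s (?d n x)) = ?d n x) \<and>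
    (n = 0 \<longrightarrow> (\<forall>x\<in>carrier (res_mod P 0). ?d 0 (s x) \<oplus>\<^bsub>res_mod P 0\<^esub> ?\<epsilon> x \<odot>\<^bsub>rmod (res_mod P 0)\<^esub> p = x))"
  have "\<exists>s. \<forall>n. ?\<Phi> n (s n) \<and> (\<forall>x\<in>carrier (res_mod P (Suc n)).
      ?d (Suc n) (s (Suc n) x) \<oplus>\<^bsub>res_mod P (Suc n)\<^esub> s n (?d n x) = x)"
  proof (rule dependent_nat_choice)
    let ?c = "\<lambda>x. ?\<epsilon> x \<odot>\<^bsub>rmod (res_mod P 0)\<^esub> p"
    have c: "?c \<in> linear_map A (rmod (res_mod P 0)) (rmod (res_mod P 0))"
      using p linear_map_add[OF \<epsilon>r] linear_map_smult[OF \<epsilon>r]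
      by (intro linear_mapI) (auto simp: rmod_closed[OF M] rmod_scalar_add[OF M] regular_rmod rmod_mult[OF M])
    have \<epsilon>c': "?\<epsilon> (?c x) = ?\<epsilon> x" if "x \<in> carrier (res_mod P 0)" for x
      using that p linear_map_smult[OF \<epsilon>r] by (simp add: regular_rmod)
    have im: "x \<oplus>\<^bsub>res_mod P 0\<^esub> \<ominus>\<^bsub>res_mod P 0\<^esub> ?c x \<in> ?d 0 ` carrier (rmod (res_mod P (Suc 0)))"
      if x: "x \<in> carrier (rmod (res_mod P 0))" for x
    proof -
      have cx: "?c x \<in> carrier (res_mod P 0)" using linear_map_closed[OF c] x by simp
      have "?\<epsilon> (x \<oplus>\<^bsub>res_mod P 0\<^esub> \<ominus>\<^bsub>res_mod P 0\<^esub> ?c x) = \<zero>\<^bsub>regular_bimodule A\<^esub>"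
        by (rule linear_map_diff_zero[OF M reg \<epsilon>]) (use x cx \<epsilon>c' in auto)
      then show ?thesis using ex minus_closed[of x 0 "?c x"] x cx by (simp add: exact_resolution_def)
    qed
    obtain s where s: "s \<in> linear_map A (rmod (res_mod P 0)) (rmod (res_mod P (Suc 0)))"
      and ds: "\<And>x. x \<in> carrier (res_mod P 0) \<Longrightarrow> ?d 0 (s x) = x \<oplus>\<^bsub>res_mod P 0\<^esub> \<ominus>\<^bsub>res_mod P 0\<^esub> ?c x"
      using rmod_lift[OF proj[of 0] M[of "Suc 0"] M[of 0] minus_hom[OF c] dr[of 0]] im by auto
    have id: "?d 0 (s x) \<oplus>\<^bsub>res_mod P 0\<^esub> ?c x = x" if "x \<in> carrier (res_mod P 0)" for x
      by (rule solve[OF ds[OF that] that]) (use linear_map_closed[OF c] that in simp)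
    have "?d 0 (s (?d 0 x)) = ?d 0 x" if x: "x \<in> carrier (res_mod P (Suc 0))" for x
    proof -
      have "?\<epsilon> (?d 0 x) = \<zero>\<^bsub>A\<^esub>" using ex x by (simp add: exact_resolution_def)
      then have "?c (?d 0 x) = \<zero>\<^bsub>res_mod P 0\<^esub>"
        using linear_map_zero[OF M reg \<epsilon>] add_hom_zero[OF rmod_abelian_group[OF M] rmod_abelian_group[OF M] linear_map_add_hom[OF c]]
        by simp
      then show ?thesis
        using id[of "?d 0 x"] x cancel[of 0 "?d 0 (s (?d 0 x))"] linear_map_closed[OF s] by simp
    qed
    then show "\<exists>s. ?\<Phi> 0 s" using s id by auto
  next
    fix s n assume sn: "?\<Phi> n s"
    let ?c = "\<lambda>x. s (?d n x)"
    have sl: "s \<in> linear_map A (rmod (res_mod P n)) (rmod (res_mod P (Suc n)))" using sn by simp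
    have c: "?c \<in> linear_map A (rmod (res_mod P (Suc n))) (rmod (res_mod P (Suc n)))"
      by (rule linear_map_comp[OF dr sl])
    have im: "x \<oplus>\<^bsub>res_mod P (Suc n)\<^esub> \<ominus>\<^bsub>res_mod P (Suc n)\<^esub> ?c x \<in> ?d (Suc n) ` carrier (rmod (res_mod P (Suc (Suc n))))"
      if x: "x \<in> carrier (rmod (res_mod P (Suc n)))" for x
    proof -
      have cx: "?c x \<in> carrier (res_mod P (Suc n))" using linear_map_closed[OF c] x by simp
      have "?d n (x \<oplus>\<^bsub>res_mod P (Suc n)\<^esub> \<ominus>\<^bsub>res_mod P (Suc n)\<^esub> ?c x) = \<zero>\<^bsub>res_mod P n\<^esub>"
        by (rule linear_map_diff_zero[OF M M d]) (use x cx sn in auto)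
      then show ?thesis using ex minus_closed[of x "Suc n" "?c x"] x cx by (simp add: exact_resolution_def)
    qed
    obtain t where t: "t \<in> linear_map A (rmod (res_mod P (Suc n))) (rmod (res_mod P (Suc (Suc n))))"
      and dt: "\<And>x. x \<in> carrier (res_mod P (Suc n)) \<Longrightarrow>
        ?d (Suc n) (t x) = x \<oplus>\<^bsub>res_mod P (Suc n)\<^esub> \<ominus>\<^bsub>res_mod P (Suc n)\<^esub> ?c x"
      using rmod_lift[OF proj[of "Suc n"] M[of "Suc (Suc n)"] M[of "Suc n"] minus_hom[OF c] dr[of "Suc n"]] im by auto
    have id: "?d (Suc n) (t x) \<oplus>\<^bsub>res_mod P (Suc n)\<^esub> ?c x = x" if "x \<in> carrier (res_mod P (Suc n))" for x
      by (rule solve[OF dt[OF that] that]) (use linear_map_closed[OF c] that in simp)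
    have "?d (Suc n) (t (?d (Suc n) x)) = ?d (Suc n) x" if x: "x \<in> carrier (res_mod P (Suc (Suc n)))" for x
    proof -
      have "?d n (?d (Suc n) x) = \<zero>\<^bsub>res_mod P n\<^esub>" using ex x by (simp add: exact_resolution_def)
      then have "?c (?d (Suc n) x) = \<zero>\<^bsub>res_mod P (Suc n)\<^esub>"
        using add_hom_zero[OF rmod_abelian_group[OF M] rmod_abelian_group[OF M] linear_map_add_hom[OF sl]]
        by simp
      then show ?thesis
        using id[of "?d (Suc n) x"] x cancel[of "Suc n" "?d (Suc n) (t (?d (Suc n) x))"] linear_map_closed[OF t] by simp
    qed
    then show "\<exists>t. ?\<Phi> (Suc n) t \<and> (\<forall>x\<in>carrier (res_mod P (Suc n)).
        ?d (Suc n) (t x) \<oplus>\<^bsub>res_mod P (Suc n)\<^esub> s (?d n x) = x)"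
      using t id by auto
  qed
  then obtain s where s: "\<forall>n. ?\<Phi> n (s n) \<and> (\<forall>x\<in>carrier (res_mod P (Suc n)).
      ?d (Suc n) (s (Suc n) x) \<oplus>\<^bsub>res_mod P (Suc n)\<^esub> s n (?d n x) = x)" ..
  show thesis
  proof (rule that[OF p])
    show "s n \<in> linear_map A (rmod (res_mod P n)) (rmod (res_mod P (Suc n)))" for n
      using s[rule_format, of n] by (elim conjE)
    show "?d 0 (s 0 x) \<oplus>\<^bsub>res_mod P 0\<^esub> ?\<epsilon> x \<odot>\<^bsub>rmod (res_mod P 0)\<^esub> p = x"
      if "x \<in> carrier (res_mod P 0)" for x
      using s[rule_format, of 0] that by simp
    show "?d (Suc n) (s (Suc n) x) \<oplus>\<^bsub>res_mod P (Suc n)\<^esub> s n (?d n x) = x"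
      if "x \<in> carrier (res_mod P (Suc n))" for n x
      using s that by blast
  qed
qed

lemma tensor_resolution_simps:
  "res_mod (tensor_resolution k A P L) n = T (res_mod P n) L"
  "res_diff (tensor_resolution k A P L) n = tensor_map (res_mod P n) L (res_diff P n) (\<lambda>m. m)"
  "res_aug (tensor_resolution k A P L) = eval_map L (res_aug P)"
  by (simp_all add: tensor_resolution_def tensor_map_def eval_map_def)

text \<open>
  The functor \<open>- \<otimes>\<^sub>A L\<close> is defined on right linear maps, so a right linear contracting homotopy of
  \<open>P \<rightarrow> A\<close> becomes a contracting homotopy, by additive maps, of \<open>P \<otimes>\<^sub>A L \<rightarrow> L\<close>.
\<close>

lemma tensor_resolution_exact:
  assumes P: "projective_resolution E (regular_bimodule A) P" and reg: "left_module E (regular_bimodule A)"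
    and L: "left_module A L"
  shows "exact_resolution A L (tensor_resolution k A P L)"
proof -
  obtain p s where p: "p \<in> carrier (res_mod P 0)" "res_aug P p = \<one>\<^bsub>A\<^esub>"
    and s: "\<And>n. s n \<in> linear_map A (rmod (res_mod P n)) (rmod (res_mod P (Suc n)))"
    and id0: "\<And>x. x \<in> carrier (res_mod P 0) \<Longrightarrow>
      res_diff P 0 (s 0 x) \<oplus>\<^bsub>res_mod P 0\<^esub> res_aug P x \<odot>\<^bsub>rmod (res_mod P 0)\<^esub> p = x"
    and id: "\<And>n x. x \<in> carrier (res_mod P (Suc n)) \<Longrightarrow>
      res_diff P (Suc n) (s (Suc n) x) \<oplus>\<^bsub>res_mod P (Suc n)\<^esub> s n (res_diff P n x) = x"
    by (rule contracting_homotopy[OF P reg]) blast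
  have ex: "exact_resolution E (regular_bimodule A) P" by (rule projective_resolution_exact[OF reg P])
  have M: "left_module E (res_mod P n)" for n using ex by (simp add: exact_resolution_def)
  let ?d = "\<lambda>n. tensor_map (res_mod P n) L (res_diff P n) (\<lambda>m. m)" and ?\<epsilon> = "eval_map L (res_aug P)"
  let ?s = "\<lambda>n. tensor_map (res_mod P (Suc n)) L (s n) (\<lambda>m. m)"
  let ?T = "\<lambda>n. T (res_mod P n) L"
  have d: "res_diff P n \<in> linear_map E (res_mod P (Suc n)) (res_mod P n)" for n using ex by (simp add: exact_resolution_def)
  have \<epsilon>: "res_aug P \<in> linear_map E (res_mod P 0) (regular_bimodule A)" using ex by (simp add: exact_resolution_def)
  note dc [simp] = linear_map_closed[OF d] and \<epsilon>c [simp] = linear_map_closed[OF \<epsilon>, simplified]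
    and sc [simp] = linear_map_closed[OF s, simplified]
  note TM = T_left_module[OF M L] and Tab = T_abelian_group[OF M L]
  note dl = tensor_map_linear[OF M M L L d linear_map_id]
  note dh = linear_map_add_hom[OF dl]
  note d_pt [simp] = tensor_map_pt[OF M M L L linear_map_rmod[OF d] linear_map_id]
  note sh = tensor_map_hom[OF M M L L s linear_map_id]
  note s_pt [simp] = tensor_map_pt[OF M M L L s linear_map_id]
  note \<epsilon>l = eval_map_linear[OF M L \<epsilon>] and \<epsilon>_pt [simp] = eval_map_pt[OF M L \<epsilon>]
  have dd: "?d n (?d (Suc n) u) = \<zero>\<^bsub>?T n\<^esub>" if u: "u \<in> carrier (?T (Suc (Suc n)))" for n u
  proof (rule T_eqI[OF M L Tab _ _ _ u])
    show "(\<lambda>u. ?d n (?d (Suc n) u)) \<in> add_hom (?T (Suc (Suc n))) (?T n)" by (rule add_hom_comp[OF dh dh])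
    show "(\<lambda>u. \<zero>\<^bsub>?T n\<^esub>) \<in> add_hom (?T (Suc (Suc n))) (?T n)"
      by (rule linear_map_add_hom[OF linear_map_zero_map[OF TM TM]])
    show "?d n (?d (Suc n) (pt (res_mod P (Suc (Suc n))) L x m)) = \<zero>\<^bsub>?T n\<^esub>"
      if "x \<in> carrier (res_mod P (Suc (Suc n)))" "m \<in> carrier L" for x m
      using that ex by (simp add: exact_resolution_def pt_zero_left[OF M L])
  qed
  have \<epsilon>d: "?\<epsilon> (?d 0 u) = \<zero>\<^bsub>L\<^esub>" if u: "u \<in> carrier (?T (Suc 0))" for u
  proof (rule T_eqI[OF M L left_module_abelian_group[OF L] _ _ _ u])
    show "(\<lambda>u. ?\<epsilon> (?d 0 u)) \<in> add_hom (?T (Suc 0)) L"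
      by (rule add_hom_comp[OF dh linear_map_add_hom[OF \<epsilon>l]])
    show "(\<lambda>u. \<zero>\<^bsub>L\<^esub>) \<in> add_hom (?T (Suc 0)) L"
      by (rule linear_map_add_hom[OF linear_map_zero_map[OF TM L]])
    show "?\<epsilon> (?d 0 (pt (res_mod P (Suc 0)) L x m)) = \<zero>\<^bsub>L\<^esub>"
      if "x \<in> carrier (res_mod P (Suc 0))" "m \<in> carrier L" for x m
      using that ex by (simp add: exact_resolution_def left_module_zero_scalar[OF L])
  qed
  have add_hom_plus: "(\<lambda>u. f u \<oplus>\<^bsub>?T n\<^esub> g u) \<in> add_hom (?T n) (?T n)"
    if "f \<in> add_hom (?T n) (?T n)" "g \<in> add_hom (?T n) (?T n)" for f g n
  proof -
    interpret TT: abelian_group "?T n" by (rule Tab)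
    show ?thesis
      using add_hom_closed[OF that(1)] add_hom_closed[OF that(2)] add_hom_add[OF that(1)] add_hom_add[OF that(2)]
      by (intro add_homI) (auto simp: TT.a_ac)
  qed
  have id_hom: "(\<lambda>u. u) \<in> add_hom (?T n) (?T n)" for n by (rule linear_map_add_hom[OF linear_map_id])
  have pth: "pt (res_mod P 0) L p \<in> add_hom L (?T 0)"
    using p by (intro add_homI) (auto simp: pt_closed[OF M L] pt_add_right[OF M L])
  have Id0: "?d 0 (?s 0 u) \<oplus>\<^bsub>?T 0\<^esub> pt (res_mod P 0) L p (?\<epsilon> u) = u" if u: "u \<in> carrier (?T 0)" for u
  proof (rule T_eqI[OF M L Tab _ id_hom _ u])
    show "(\<lambda>u. ?d 0 (?s 0 u) \<oplus>\<^bsub>?T 0\<^esub> pt (res_mod P 0) L p (?\<epsilon> u)) \<in> add_hom (?T 0) (?T 0)"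
      by (rule add_hom_plus[OF add_hom_comp[OF sh dh] add_hom_comp[OF linear_map_add_hom[OF \<epsilon>l] pth]])
    show "?d 0 (?s 0 (pt (res_mod P 0) L x m)) \<oplus>\<^bsub>?T 0\<^esub> pt (res_mod P 0) L p (?\<epsilon> (pt (res_mod P 0) L x m)) =
        pt (res_mod P 0) L x m" if "x \<in> carrier (res_mod P 0)" "m \<in> carrier L" for x m
      using that p id0[of x]
      by (simp add: rmod_closed[OF M] flip: pt_swap[OF M L] pt_add_left[OF M L])
  qed
  have Id: "?d (Suc n) (?s (Suc n) u) \<oplus>\<^bsub>?T (Suc n)\<^esub> ?s n (?d n u) = u" if u: "u \<in> carrier (?T (Suc n))" for n u
  proof (rule T_eqI[OF M L Tab _ id_hom _ u])
    show "(\<lambda>u. ?d (Suc n) (?s (Suc n) u) \<oplus>\<^bsub>?T (Suc n)\<^esub> ?s n (?d n u)) \<in> add_hom (?T (Suc n)) (?T (Suc n))"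
      by (rule add_hom_plus[OF add_hom_comp[OF sh dh] add_hom_comp[OF dh sh]])
    show "?d (Suc n) (?s (Suc n) (pt (res_mod P (Suc n)) L x m)) \<oplus>\<^bsub>?T (Suc n)\<^esub> ?s n (?d n (pt (res_mod P (Suc n)) L x m)) =
        pt (res_mod P (Suc n)) L x m" if "x \<in> carrier (res_mod P (Suc n))" "m \<in> carrier L" for x m
      using that id[of x n] by (simp flip: pt_add_left[OF M L])
  qed
  have cancel: "y = x" if "y \<oplus>\<^bsub>?T n\<^esub> \<zero>\<^bsub>?T n\<^esub> = x" "y \<in> carrier (?T n)" for n x y
  proof -
    interpret abelian_group "?T n" by (rule Tab)
    show ?thesis using that by simp
  qed
  have "m \<in> ?\<epsilon> ` carrier (?T 0)" if "m \<in> carrier L" for m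
    using that p left_module.smult_one[OF L]
    by (intro image_eqI[of _ _ "pt (res_mod P 0) L p m"]) (auto simp: pt_closed[OF M L])
  moreover have "u \<in> ?d 0 ` carrier (?T (Suc 0))" if u: "u \<in> carrier (?T 0)" "?\<epsilon> u = \<zero>\<^bsub>L\<^esub>" for u
  proof -
    have "?d 0 (?s 0 u) \<oplus>\<^bsub>?T 0\<^esub> \<zero>\<^bsub>?T 0\<^esub> = u"
      using Id0[OF u(1)] unfolding u(2) pt_zero_right[OF M L p(1)] .
    from cancel[OF this add_hom_closed[OF dh add_hom_closed[OF sh u(1)]]] add_hom_closed[OF sh u(1)]
    show ?thesis by (intro image_eqI[where x = "?s 0 u"]) (rule sym)
  qed
  moreover have "u \<in> ?d (Suc n) ` carrier (?T (Suc (Suc n)))"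
    if u: "u \<in> carrier (?T (Suc n))" "?d n u = \<zero>\<^bsub>?T n\<^esub>" for u n
  proof -
    have "?d (Suc n) (?s (Suc n) u) \<oplus>\<^bsub>?T (Suc n)\<^esub> \<zero>\<^bsub>?T (Suc n)\<^esub> = u"
      using Id[OF u(1)] unfolding u(2) add_hom_zero[OF Tab Tab sh] .
    from cancel[OF this add_hom_closed[OF dh add_hom_closed[OF sh u(1)]]] add_hom_closed[OF sh u(1)]
    show ?thesis by (intro image_eqI[where x = "?s (Suc n) u"]) (rule sym)
  qed
  ultimately show ?thesis
    unfolding exact_resolution_def tensor_resolution_simps
    by (intro conjI allI ballI impI subsetI) (rule L TM dl \<epsilon>l dd \<epsilon>d | assumption | simp only:)+
qed

end

section \<open>Cochains up to coboundaries\<close>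

definition projective_complex where
  "projective_complex R Q \<longleftrightarrow>
    (\<forall>n. projective_module R (res_mod Q n)) \<and>
    (\<forall>n. res_diff Q n \<in> linear_map R (res_mod Q (Suc n)) (res_mod Q n)) \<and>
    (\<forall>n. \<forall>x\<in>carrier (res_mod Q (Suc (Suc n))). res_diff Q n (res_diff Q (Suc n) x) = \<zero>\<^bsub>res_mod Q n\<^esub>)"

lemma projective_complexD:
  assumes "projective_complex R Q"
  shows "projective_module R (res_mod Q n)" "left_module R (res_mod Q n)"
    "res_diff Q n \<in> linear_map R (res_mod Q (Suc n)) (res_mod Q n)"
    "x \<in> carrier (res_mod Q (Suc (Suc n))) \<Longrightarrow> res_diff Q n (res_diff Q (Suc n) x) = \<zero>\<^bsub>res_mod Q n\<^esub>"
  using assms by (auto simp: projective_complex_def projective_module_def)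

lemma projective_resolution_complex:
  assumes "left_module R L" "projective_resolution R L Q"
  shows "projective_complex R Q"
  using projective_resolution_exact[OF assms] assms(2)
  by (simp add: exact_resolution_def projective_resolution_def projective_complex_def)

lemma exact_resolutionD:
  assumes "exact_resolution R L D"
  shows "left_module R L" "left_module R (res_mod D n)"
    "res_diff D n \<in> linear_map R (res_mod D (Suc n)) (res_mod D n)"
    "res_aug D \<in> linear_map R (res_mod D 0) L"
    "y \<in> carrier L \<Longrightarrow> y \<in> res_aug D ` carrier (res_mod D 0)"
    "x \<in> carrier (res_mod D (Suc 0)) \<Longrightarrow> res_aug D (res_diff D 0 x) = \<zero>\<^bsub>L\<^esub>"
    "x \<in> carrier (res_mod D (Suc (Suc n))) \<Longrightarrow> res_diff D n (res_diff D (Suc n) x) = \<zero>\<^bsub>res_mod D n\<^esub>"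
    "x \<in> carrier (res_mod D 0) \<Longrightarrow> res_aug D x = \<zero>\<^bsub>L\<^esub> \<Longrightarrow> x \<in> res_diff D 0 ` carrier (res_mod D (Suc 0))"
    "x \<in> carrier (res_mod D (Suc n)) \<Longrightarrow> res_diff D n x = \<zero>\<^bsub>res_mod D n\<^esub> \<Longrightarrow>
      x \<in> res_diff D (Suc n) ` carrier (res_mod D (Suc (Suc n)))"
  using assms unfolding exact_resolution_def by blast+

text \<open>
  Coboundaries as a pointwise condition, applicable also to functions that are not extensional.
\<close>

definition null_cochain where
  "null_cochain R Q N n b \<longleftrightarrow>
    (case n of
       0 \<Rightarrow> \<forall>x\<in>carrier (res_mod Q 0). b x = \<zero>\<^bsub>N\<^esub>
     | Suc m \<Rightarrow> \<exists>g\<in>linear_map R (res_mod Q m) N. \<forall>x\<in>carrier (res_mod Q n). b x = g (res_diff Q m x))"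

definition cohomologous where
  "cohomologous R Q N n f g \<longleftrightarrow>
    (\<exists>b. null_cochain R Q N n b \<and> (\<forall>x\<in>carrier (res_mod Q n). f x = b x \<oplus>\<^bsub>N\<^esub> g x))"

lemma null_cochain_zero:
  assumes "\<And>n. left_module R (res_mod Q n)" "left_module R N"
    and "\<And>x. x \<in> carrier (res_mod Q n) \<Longrightarrow> b x = \<zero>\<^bsub>N\<^esub>"
  shows "null_cochain R Q N n b"
  using assms linear_map_zero_map[OF assms(1,2)]
  by (auto simp: null_cochain_def split: nat.split intro!: bexI[of _ "\<lambda>_. \<zero>\<^bsub>N\<^esub>"])

lemma null_cochain_add:
  assumes "\<And>n. left_module R (res_mod Q n)" "left_module R N"
    and "null_cochain R Q N n b" "null_cochain R Q N n b'"
    and "\<And>x. x \<in> carrier (res_mod Q n) \<Longrightarrow> c x = b x \<oplus>\<^bsub>N\<^esub> b' x"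
  shows "null_cochain R Q N n c"
proof (cases n)
  case 0
  interpret N: abelian_group N using assms(2) by (simp add: left_module_abelian_group)
  show ?thesis using assms(3-5) 0 by (simp add: null_cochain_def)
next
  case (Suc m)
  then obtain g g' where "g \<in> linear_map R (res_mod Q m) N" "g' \<in> linear_map R (res_mod Q m) N"
    "\<And>x. x \<in> carrier (res_mod Q n) \<Longrightarrow> b x = g (res_diff Q m x)"
    "\<And>x. x \<in> carrier (res_mod Q n) \<Longrightarrow> b' x = g' (res_diff Q m x)"
    using assms(3,4) unfolding null_cochain_def by auto
  then show ?thesis
    using Suc assms(5) linear_map_sum[OF assms(1)[of m] assms(2), of g g']
    by (auto simp: null_cochain_def intro!: bexI[of _ "\<lambda>x. g x \<oplus>\<^bsub>N\<^esub> g' x"])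
qed

lemma null_cochain_minus:
  assumes "\<And>n. left_module R (res_mod Q n)" "left_module R N"
    and "null_cochain R Q N n b"
    and "\<And>x. x \<in> carrier (res_mod Q n) \<Longrightarrow> c x = \<ominus>\<^bsub>N\<^esub> b x"
  shows "null_cochain R Q N n c"
proof (cases n)
  case 0
  interpret N: abelian_group N using assms(2) by (simp add: left_module_abelian_group)
  show ?thesis using assms(3,4) 0 by (simp add: null_cochain_def)
next
  case (Suc m)
  then obtain g where "g \<in> linear_map R (res_mod Q m) N"
    "\<And>x. x \<in> carrier (res_mod Q n) \<Longrightarrow> b x = g (res_diff Q m x)"
    using assms(3) unfolding null_cochain_def by auto
  then show ?thesis
    using Suc assms(4) linear_map_uminus[OF assms(1)[of m] assms(2), of g]
    by (auto simp: null_cochain_def intro!: bexI[of _ "\<lambda>x. \<ominus>\<^bsub>N\<^esub> g x"])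
qed

lemma null_cochain_closed:
  assumes "projective_complex R Q" "left_module R N"
    and "null_cochain R Q N n b" "x \<in> carrier (res_mod Q n)"
  shows "b x \<in> carrier N"
proof -
  interpret N: abelian_group N using assms(2) by (simp add: left_module_abelian_group)
  show ?thesis
    using assms(3,4) linear_map_closed[OF projective_complexD(3)[OF assms(1)]]
    by (auto simp: null_cochain_def linear_map_closed split: nat.splits)
qed

lemma null_cochain_linear:
  assumes "projective_complex R Q" "left_module R N" "null_cochain R Q N n b"
  shows "b \<in> linear_map R (res_mod Q n) N"
proof -
  note D = projective_complexD[OF assms(1)]
  interpret N: abelian_group N using assms(2) by (simp add: left_module_abelian_group)
  interpret Qn: abelian_group "res_mod Q n" by (rule left_module_abelian_group[OF D(2)])
  show ?thesis
  proof (cases n)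
    case 0
    then show ?thesis using assms(3) left_module.smult_closed[OF D(2)[of n]] smult_zero[OF assms(2)]
        Qn.a_closed by (intro linear_mapI) (auto simp: null_cochain_def)
  next
    case (Suc m)
    then obtain g where g: "g \<in> linear_map R (res_mod Q m) N"
      "\<And>x. x \<in> carrier (res_mod Q n) \<Longrightarrow> b x = g (res_diff Q m x)"
      using assms(3) unfolding null_cochain_def by auto
    from linear_map_comp[OF D(3)[of m] g(1)] have "(\<lambda>x. g (res_diff Q m x)) \<in> linear_map R (res_mod Q n) N"
      using Suc by simp
    note l = linear_map_closed[OF this] linear_map_add[OF this] linear_map_smult[OF this]
    show ?thesis
      by (intro linear_mapI) (use l in \<open>auto simp: g(2) left_module.smult_closed[OF D(2)[of n]]\<close>)
  qed
qed

lemma null_cochain_cocycle: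
  assumes "projective_complex R Q" "left_module R N" "null_cochain R Q N n b"
    and x: "x \<in> carrier (res_mod Q (Suc n))"
  shows "b (res_diff Q n x) = \<zero>\<^bsub>N\<^esub>"
proof -
  note D = projective_complexD[OF assms(1)]
  show ?thesis
  proof (cases n)
    case 0
    then show ?thesis using assms(3) linear_map_closed[OF D(3) x] by (simp add: null_cochain_def)
  next
    case (Suc m)
    then show ?thesis
      using assms(3) linear_map_closed[OF D(3) x] D(4)[of x m] x linear_map_zero[OF D(2) assms(2)]
      by (auto simp: null_cochain_def)
  qed
qed

lemma null_cochain_comp:
  assumes "left_module R N" "left_module R N'" "h \<in> linear_map R N N'" "null_cochain R Q N n b"
  shows "null_cochain R Q N' n (\<lambda>x. h (b x))"
  using assms(4) linear_map_zero[OF assms(1-3)] linear_map_comp[OF _ assms(3)]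
  by (fastforce simp: null_cochain_def split: nat.splits)

lemma cohomologous_refl:
  assumes "projective_complex R Q" "left_module R N"
    and "\<And>x. x \<in> carrier (res_mod Q n) \<Longrightarrow> f x = g x"
    and "\<And>x. x \<in> carrier (res_mod Q n) \<Longrightarrow> g x \<in> carrier N"
  shows "cohomologous R Q N n f g"
proof -
  interpret N: abelian_group N using assms(2) by (simp add: left_module_abelian_group)
  have "null_cochain R Q N n (\<lambda>x. \<zero>\<^bsub>N\<^esub>)"
    by (rule null_cochain_zero[OF projective_complexD(2)[OF assms(1)] assms(2)]) simp
  then show ?thesis unfolding cohomologous_def using assms(3,4) by (intro exI[of _ "\<lambda>x. \<zero>\<^bsub>N\<^esub>"]) auto
qed

lemma cohomologous_sym:
  assumes "projective_complex R Q" "left_module R N"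
    and "cohomologous R Q N n f g" "\<And>x. x \<in> carrier (res_mod Q n) \<Longrightarrow> g x \<in> carrier N"
  shows "cohomologous R Q N n g f"
proof -
  interpret N: abelian_group N using assms(2) by (simp add: left_module_abelian_group)
  obtain b where b: "null_cochain R Q N n b" "\<And>x. x \<in> carrier (res_mod Q n) \<Longrightarrow> f x = b x \<oplus>\<^bsub>N\<^esub> g x"
    using assms(3) unfolding cohomologous_def by blast
  have "null_cochain R Q N n (\<lambda>x. \<ominus>\<^bsub>N\<^esub> b x)"
    by (rule null_cochain_minus[OF projective_complexD(2)[OF assms(1)] assms(2) b(1)]) simp
  then show ?thesis unfolding cohomologous_def
    using b(2) assms(4) null_cochain_closed[OF assms(1,2) b(1)]
    by (intro exI[of _ "\<lambda>x. \<ominus>\<^bsub>N\<^esub> b x"]) (auto simp: N.r_neg1)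
qed

lemma cohomologous_trans:
  assumes "projective_complex R Q" "left_module R N"
    and "cohomologous R Q N n f g" "cohomologous R Q N n g h"
    and "\<And>x. x \<in> carrier (res_mod Q n) \<Longrightarrow> h x \<in> carrier N"
  shows "cohomologous R Q N n f h"
proof -
  interpret N: abelian_group N using assms(2) by (simp add: left_module_abelian_group)
  obtain b where b: "null_cochain R Q N n b" "\<And>x. x \<in> carrier (res_mod Q n) \<Longrightarrow> f x = b x \<oplus>\<^bsub>N\<^esub> g x"
    using assms(3) unfolding cohomologous_def by blast
  obtain b' where b': "null_cochain R Q N n b'" "\<And>x. x \<in> carrier (res_mod Q n) \<Longrightarrow> g x = b' x \<oplus>\<^bsub>N\<^esub> h x"
    using assms(4) unfolding cohomologous_def by blast
  have "null_cochain R Q N n (\<lambda>x. b x \<oplus>\<^bsub>N\<^esub> b' x)"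
    by (rule null_cochain_add[OF projective_complexD(2)[OF assms(1)] assms(2) b(1) b'(1)]) simp
  then show ?thesis unfolding cohomologous_def
    using b(2) b'(2) assms(5) null_cochain_closed[OF assms(1,2) b(1)] null_cochain_closed[OF assms(1,2) b'(1)]
    by (intro exI[of _ "\<lambda>x. b x \<oplus>\<^bsub>N\<^esub> b' x"]) (auto simp: N.a_assoc)
qed

lemma coboundaries_iff:
  assumes Q: "projective_complex R Q" and N: "left_module R N"
  shows "b \<in> coboundaries R Q N n \<longleftrightarrow> b \<in> module_hom R (res_mod Q n) N \<and> null_cochain R Q N n b"
proof (cases n)
  case 0
  interpret N: abelian_group N using N by (simp add: left_module_abelian_group)
  have "(\<lambda>x\<in>carrier (res_mod Q 0). \<zero>\<^bsub>N\<^esub>) \<in> module_hom R (res_mod Q 0) N"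
    by (intro left_module_hom_restrict linear_map_zero_map projective_complexD(2)[OF Q] N)
  moreover have "b = (\<lambda>x\<in>carrier (res_mod Q 0). \<zero>\<^bsub>N\<^esub>)"
    if "b \<in> module_hom R (res_mod Q 0) N" "\<forall>x\<in>carrier (res_mod Q 0). b x = \<zero>\<^bsub>N\<^esub>"
    using that by (intro extensionalityI[of _ "carrier (res_mod Q 0)"]) (auto simp: module_hom_iff)
  ultimately show ?thesis
    using 0 by (auto simp: coboundaries_def hom_group_def null_cochain_def)
next
  case (Suc m)
  note D = projective_complexD[OF Q]
  have rest: "\<exists>g'\<in>module_hom R (res_mod Q m) N. \<forall>x\<in>carrier (res_mod Q n). g (res_diff Q m x) = g' (res_diff Q m x)"
    if "g \<in> linear_map R (res_mod Q m) N" for g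
    using left_module_hom_restrict[OF D(2) that] linear_map_closed[OF D(3)[of m]] Suc
    by (intro bexI[of _ "restrict g (carrier (res_mod Q m))"]) auto
  have cl: "compose (carrier (res_mod Q n)) g (res_diff Q m) \<in> module_hom R (res_mod Q n) N"
    if "g \<in> module_hom R (res_mod Q m) N" for g
    using left_module_hom_restrict[OF D(2)[of n], of "\<lambda>x. g (res_diff Q m x)" N]
      linear_map_comp[OF D(3)[of m] module_hom_linear[OF that]] Suc by (simp add: compose_def)
  show ?thesis
  proof
    assume "b \<in> coboundaries R Q N n"
    then obtain g where "g \<in> module_hom R (res_mod Q m) N" "b = compose (carrier (res_mod Q n)) g (res_diff Q m)"
      using Suc by (auto simp: coboundaries_def)
    then show "b \<in> module_hom R (res_mod Q n) N \<and> null_cochain R Q N n b"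
      using cl Suc by (auto simp: null_cochain_def compose_def module_hom_linear)
  next
    assume b: "b \<in> module_hom R (res_mod Q n) N \<and> null_cochain R Q N n b"
    then obtain g where g: "g \<in> linear_map R (res_mod Q m) N"
      "\<And>x. x \<in> carrier (res_mod Q n) \<Longrightarrow> b x = g (res_diff Q m x)"
      using Suc by (auto simp: null_cochain_def)
    obtain g' where g': "g' \<in> module_hom R (res_mod Q m) N"
      "\<And>x. x \<in> carrier (res_mod Q n) \<Longrightarrow> g (res_diff Q m x) = g' (res_diff Q m x)"
      using rest[OF g(1)] by blast
    have "b = compose (carrier (res_mod Q n)) g' (res_diff Q m)"
      by (rule extensionalityI[of _ "carrier (res_mod Q n)"])
         (use b g(2) g'(2) in \<open>auto simp: module_hom_iff compose_def\<close>)
    then show "b \<in> coboundaries R Q N n" using g'(1) Suc by (auto simp: coboundaries_def)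
  qed
qed

text \<open>
  Cosets described by their members; the products defined as unions of cosets are computed through
  this description.
\<close>

lemma ext_class_eq:
  assumes Q: "projective_complex R Q" and N: "left_module R N" and f: "f \<in> linear_map R (res_mod Q n) N"
  shows "ext_class R Q N n f = {h \<in> module_hom R (res_mod Q n) N. cohomologous R Q N n h f}"
proof (intro Set.equalityI subsetI)
  fix h assume "h \<in> ext_class R Q N n f"
  then obtain b where b: "b \<in> coboundaries R Q N n" and h: "h = (\<lambda>x\<in>carrier (res_mod Q n). b x \<oplus>\<^bsub>N\<^esub> f x)"
    by (auto simp: ext_class_def r_coset_def hom_group_def)
  have b': "b \<in> linear_map R (res_mod Q n) N" "null_cochain R Q N n b"
    using b by (simp_all add: coboundaries_iff[OF Q N] module_hom_linear)
  show "h \<in> {h \<in> module_hom R (res_mod Q n) N. cohomologous R Q N n h f}"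
    using b' left_module_hom_restrict[OF projective_complexD(2)[OF Q]
        linear_map_sum[OF projective_complexD(2)[OF Q] N b'(1) f]]
    by (auto simp: h cohomologous_def)
next
  fix h assume "h \<in> {h \<in> module_hom R (res_mod Q n) N. cohomologous R Q N n h f}"
  then obtain b where b: "null_cochain R Q N n b" "\<And>x. x \<in> carrier (res_mod Q n) \<Longrightarrow> h x = b x \<oplus>\<^bsub>N\<^esub> f x"
    and h: "h \<in> module_hom R (res_mod Q n) N"
    by (auto simp: cohomologous_def)
  let ?b = "restrict b (carrier (res_mod Q n))"
  have "?b \<in> coboundaries R Q N n"
    using left_module_hom_restrict[OF projective_complexD(2)[OF Q] null_cochain_linear[OF Q N b(1)]]
      null_cochain_add[OF projective_complexD(2)[OF Q] N b(1) null_cochain_zero[OF projective_complexD(2)[OF Q] N, of n "\<lambda>_. \<zero>\<^bsub>N\<^esub>"], of ?b]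
      null_cochain_closed[OF Q N b(1)] left_module_abelian_group[OF N, THEN abelian_group.axioms(1), THEN abelian_monoid.r_zero]
    by (simp add: coboundaries_iff[OF Q N])
  moreover have "h = (\<lambda>x\<in>carrier (res_mod Q n). ?b x \<oplus>\<^bsub>N\<^esub> f x)"
    by (rule extensionalityI[of _ "carrier (res_mod Q n)"]) (use h b(2) in \<open>auto simp: module_hom_iff\<close>)
  ultimately show "h \<in> ext_class R Q N n f"
    unfolding ext_class_def r_coset_def hom_group_def by (auto intro: bexI[of _ ?b])
qed

lemma ext_class_cong:
  assumes Q: "projective_complex R Q" and N: "left_module R N"
    and f: "f \<in> linear_map R (res_mod Q n) N" and g: "g \<in> linear_map R (res_mod Q n) N"
    and fg: "cohomologous R Q N n f g"
  shows "ext_class R Q N n f = ext_class R Q N n g"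
proof -
  have gf: "cohomologous R Q N n g f"
    by (rule cohomologous_sym[OF Q N fg]) (rule linear_map_closed[OF g])
  show ?thesis
    unfolding ext_class_eq[OF Q N f] ext_class_eq[OF Q N g]
    using cohomologous_trans[OF Q N _ fg] cohomologous_trans[OF Q N _ gf] linear_map_closed[OF f] linear_map_closed[OF g]
    by blast
qed

section \<open>Chain maps from projective complexes to exact ones\<close>

text \<open>
  The comparison theorem.  The recursion carries along that each component, composed with the
  differential, takes values in the image of the next differential; exactness provides this, and
  projectivity then provides the next component.
\<close>

lemma chain_lift_exists:
  assumes Q: "projective_complex R Q" and D: "exact_resolution R L D"
    and e: "e \<in> linear_map R (res_mod Q n) L"
    and e0: "\<And>x. x \<in> carrier (res_mod Q (Suc n)) \<Longrightarrow> e (res_diff Q n x) = \<zero>\<^bsub>L\<^esub>"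
  shows "\<exists>c. c \<in> chain_lifts R Q n D e"
proof -
  note q = projective_complexD[OF Q] and d = exact_resolutionD[OF D]
  let ?\<Phi> = "\<lambda>i c. c \<in> module_hom R (res_mod Q (n + i)) (res_mod D i) \<and>
    (\<forall>x\<in>carrier (res_mod Q (Suc (n + i))). c (res_diff Q (n + i) x) \<in> res_diff D i ` carrier (res_mod D (Suc i))) \<and>
    (i = 0 \<longrightarrow> (\<forall>x\<in>carrier (res_mod Q n). res_aug D (c x) = e x))"
  have "\<exists>c. \<forall>i. ?\<Phi> i (c i) \<and> (\<forall>x\<in>carrier (res_mod Q (Suc (n + i))).
      res_diff D i (c (Suc i) x) = c i (res_diff Q (n + i) x))"
  proof (rule dependent_nat_choice)
    obtain c where c: "c \<in> module_hom R (res_mod Q n) (res_mod D 0)"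
      "\<And>x. x \<in> carrier (res_mod Q n) \<Longrightarrow> res_aug D (c x) = e x"
      using projective_lift[OF q(1)[of n] d(2)[of 0] d(1) e d(4)] d(5) linear_map_closed[OF e] by blast
    have "c (res_diff Q n x) \<in> res_diff D 0 ` carrier (res_mod D (Suc 0))"
      if "x \<in> carrier (res_mod Q (Suc n))" for x
      using linear_map_closed[OF q(3) that] linear_map_closed[OF module_hom_linear[OF c(1)]]
      by (intro d(8)) (auto simp: c(2) e0 that)
    then show "\<exists>c. ?\<Phi> 0 c" using c by auto
  next
    fix c i assume c: "?\<Phi> i c"
    have cl: "c \<in> linear_map R (res_mod Q (n + i)) (res_mod D i)" using c by (simp add: module_hom_linear)
    obtain c' where c': "c' \<in> module_hom R (res_mod Q (Suc (n + i))) (res_mod D (Suc i))"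
      "\<And>x. x \<in> carrier (res_mod Q (Suc (n + i))) \<Longrightarrow> res_diff D i (c' x) = c (res_diff Q (n + i) x)"
      using projective_lift[OF q(1) d(2) d(2) linear_map_comp[OF q(3) cl] d(3)] c by blast
    have "c' (res_diff Q (Suc (n + i)) x) \<in> res_diff D (Suc i) ` carrier (res_mod D (Suc (Suc i)))"
      if "x \<in> carrier (res_mod Q (Suc (Suc (n + i))))" for x
      using linear_map_closed[OF q(3) that] linear_map_closed[OF module_hom_linear[OF c'(1)]]
      by (intro d(9)) (auto simp: c'(2) q(4)[OF that] linear_map_zero[OF q(2) d(2) cl])
    then show "\<exists>c'. ?\<Phi> (Suc i) c' \<and> (\<forall>x\<in>carrier (res_mod Q (Suc (n + i))).
      res_diff D i (c' x) = c (res_diff Q (n + i) x))" using c' by auto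
  qed
  then obtain c where "\<forall>i. ?\<Phi> i (c i) \<and> (\<forall>x\<in>carrier (res_mod Q (Suc (n + i))).
      res_diff D i (c (Suc i) x) = c i (res_diff Q (n + i) x))" ..
  then have "c \<in> chain_lifts R Q n D e" unfolding chain_lifts_def by auto
  then show ?thesis by blast
qed

lemma chain_liftsD:
  assumes "c \<in> chain_lifts R Q n D e"
  shows "c i \<in> linear_map R (res_mod Q (n + i)) (res_mod D i)"
    "x \<in> carrier (res_mod Q n) \<Longrightarrow> res_aug D (c 0 x) = e x"
    "x \<in> carrier (res_mod Q (Suc (n + i))) \<Longrightarrow> res_diff D i (c (Suc i) x) = c i (res_diff Q (n + i) x)"
  using assms by (auto simp: chain_lifts_def module_hom_linear)

lemma chain_lifts_restrictI:
  assumes "\<And>n. left_module R (res_mod Q n)"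
    and d: "\<And>n. res_diff Q n \<in> linear_map R (res_mod Q (Suc n)) (res_mod Q n)"
    and c: "\<And>i. c i \<in> linear_map R (res_mod Q (n + i)) (res_mod D i)"
    and "\<And>x. x \<in> carrier (res_mod Q n) \<Longrightarrow> res_aug D (c 0 x) = e x"
    and "\<And>i x. x \<in> carrier (res_mod Q (Suc (n + i))) \<Longrightarrow> res_diff D i (c (Suc i) x) = c i (res_diff Q (n + i) x)"
  shows "(\<lambda>i. restrict (c i) (carrier (res_mod Q (n + i)))) \<in> chain_lifts R Q n D e"
  using assms left_module_hom_restrict[OF assms(1) c] linear_map_closed[OF d]
  by (auto simp: chain_lifts_def)

lemma module_diff_cancel:
  assumes "left_module R M" "x \<in> carrier M" "y \<in> carrier M" "z \<in> carrier M" "u \<in> carrier M"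
  shows "u = (x \<oplus>\<^bsub>M\<^esub> \<ominus>\<^bsub>M\<^esub> y) \<oplus>\<^bsub>M\<^esub> \<ominus>\<^bsub>M\<^esub> z \<longleftrightarrow> x = (u \<oplus>\<^bsub>M\<^esub> z) \<oplus>\<^bsub>M\<^esub> y"
proof -
  interpret M: abelian_group M using assms by (simp add: left_module_abelian_group)
  show ?thesis using assms
    by (auto simp: M.a_ac M.r_neg M.l_neg M.r_neg1 M.r_neg2)
qed

text \<open>
  Two lifts of cohomologous maps are chain homotopic; a cocycle of the target therefore pulls back to
  cohomologous cocycles along both.
\<close>

lemma chain_lifts_cohomologous:
  assumes Q: "projective_complex R Q" and D: "exact_resolution R L D" and N: "left_module R N"
    and c: "c \<in> chain_lifts R Q n D e" and c': "c' \<in> chain_lifts R Q n D e'"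
    and ee': "cohomologous R Q L n e e'" and e': "e' \<in> linear_map R (res_mod Q n) L"
    and f: "f \<in> linear_map R (res_mod D i) N"
    and f0: "\<And>y. y \<in> carrier (res_mod D (Suc i)) \<Longrightarrow> f (res_diff D i y) = \<zero>\<^bsub>N\<^esub>"
  shows "cohomologous R Q N (n + i) (\<lambda>x. f (c i x)) (\<lambda>x. f (c' i x))"
proof -
  note q = projective_complexD[OF Q] and d = exact_resolutionD[OF D]
  note cc [simp] = linear_map_closed[OF chain_liftsD(1)[OF c]] and cc' [simp] = linear_map_closed[OF chain_liftsD(1)[OF c']]
  note qd [simp] = linear_map_closed[OF q(3)]
  interpret L: abelian_group L by (rule left_module_abelian_group[OF d(1)])
  obtain b where b: "null_cochain R Q L n b" "\<And>x. x \<in> carrier (res_mod Q n) \<Longrightarrow> e x = b x \<oplus>\<^bsub>L\<^esub> e' x"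
    using ee' unfolding cohomologous_def by blast
  have bc: "b x \<in> carrier L" if "x \<in> carrier (res_mod Q n)" for x by (rule null_cochain_closed[OF Q d(1) b(1) that])
  \<comment> \<open>The first step of the homotopy, already composed with the differential of \<open>Q\<close>: it is zero for \<open>n = 0\<close>.\<close>
  obtain w where w: "null_cochain R Q (res_mod D 0) n w"
    and aw: "\<And>x. x \<in> carrier (res_mod Q n) \<Longrightarrow> res_aug D (w x) = b x"
  proof (cases n)
    case 0
    have "null_cochain R Q (res_mod D 0) n (\<lambda>_. \<zero>\<^bsub>res_mod D 0\<^esub>)"
      by (rule null_cochain_zero[OF q(2) d(2)]) simp
    moreover have "res_aug D \<zero>\<^bsub>res_mod D 0\<^esub> = b x" if "x \<in> carrier (res_mod Q n)" for x
      using b(1) that 0 linear_map_zero[OF d(2) d(1) d(4)] by (simp add: null_cochain_def)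
    ultimately show ?thesis by (rule that)
  next
    case (Suc m)
    then obtain g where g: "g \<in> linear_map R (res_mod Q m) L"
      "\<And>x. x \<in> carrier (res_mod Q n) \<Longrightarrow> b x = g (res_diff Q m x)"
      using b(1) by (auto simp: null_cochain_def)
    obtain s where s: "s \<in> module_hom R (res_mod Q m) (res_mod D 0)"
      "\<And>x. x \<in> carrier (res_mod Q m) \<Longrightarrow> res_aug D (s x) = g x"
      using projective_lift[OF q(1)[of m] d(2)[of 0] d(1) g(1) d(4)] d(5) linear_map_closed[OF g(1)] by blast
    have "null_cochain R Q (res_mod D 0) n (\<lambda>x. s (res_diff Q m x))"
      using s(1) Suc by (auto simp: null_cochain_def module_hom_linear)
    moreover have "res_aug D (s (res_diff Q m x)) = b x" if "x \<in> carrier (res_mod Q n)" for x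
      using that Suc g(2) s(2) qd[of x m] by simp
    ultimately show ?thesis by (rule that)
  qed
  have wl: "w \<in> linear_map R (res_mod Q n) (res_mod D 0)" by (rule null_cochain_linear[OF Q d(2) w])
  note wc [simp] = linear_map_closed[OF wl]
  have diff: "(\<lambda>x. (c i x \<oplus>\<^bsub>res_mod D i\<^esub> \<ominus>\<^bsub>res_mod D i\<^esub> c' i x) \<oplus>\<^bsub>res_mod D i\<^esub> \<ominus>\<^bsub>res_mod D i\<^esub> h x)
      \<in> linear_map R (res_mod Q (n + i)) (res_mod D i)"
    if "h \<in> linear_map R (res_mod Q (n + i)) (res_mod D i)" for h i
    by (intro linear_map_sum linear_map_uminus q(2) d(2) chain_liftsD(1)[OF c] chain_liftsD(1)[OF c'] that)
  let ?\<Phi> = "\<lambda>i t. t \<in> module_hom R (res_mod Q (n + i)) (res_mod D (Suc i)) \<and>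
    (\<forall>x\<in>carrier (res_mod Q (Suc (n + i))). c i (res_diff Q (n + i) x) =
      (res_diff D i (t (res_diff Q (n + i) x))) \<oplus>\<^bsub>res_mod D i\<^esub> c' i (res_diff Q (n + i) x)) \<and>
    (i = 0 \<longrightarrow> (\<forall>x\<in>carrier (res_mod Q n). c 0 x = (res_diff D 0 (t x) \<oplus>\<^bsub>res_mod D 0\<^esub> w x) \<oplus>\<^bsub>res_mod D 0\<^esub> c' 0 x))"
  have "\<exists>t. \<forall>i. ?\<Phi> i (t i) \<and> (\<forall>x\<in>carrier (res_mod Q (Suc (n + i))). c (Suc i) x =
      (res_diff D (Suc i) (t (Suc i) x) \<oplus>\<^bsub>res_mod D (Suc i)\<^esub> t i (res_diff Q (n + i) x)) \<oplus>\<^bsub>res_mod D (Suc i)\<^esub> c' (Suc i) x)"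
  proof (rule dependent_nat_choice)
    interpret D0: abelian_group "res_mod D 0" by (rule left_module_abelian_group[OF d(2)])
    let ?h = "\<lambda>x. (c 0 x \<oplus>\<^bsub>res_mod D 0\<^esub> \<ominus>\<^bsub>res_mod D 0\<^esub> c' 0 x) \<oplus>\<^bsub>res_mod D 0\<^esub> \<ominus>\<^bsub>res_mod D 0\<^esub> w x"
    have h: "?h \<in> linear_map R (res_mod Q n) (res_mod D 0)" using diff[of w 0] wl by simp
    have "?h x \<in> res_diff D 0 ` carrier (res_mod D (Suc 0))" if x: "x \<in> carrier (res_mod Q n)" for x
    proof (rule d(8)[OF linear_map_closed[OF h x]])
      have cl: "c 0 x \<in> carrier (res_mod D 0)" "c' 0 x \<in> carrier (res_mod D 0)" using cc[of x 0] cc'[of x 0] x by auto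
      then have "res_aug D (?h x) = (e x \<oplus>\<^bsub>L\<^esub> \<ominus>\<^bsub>L\<^esub> e' x) \<oplus>\<^bsub>L\<^esub> \<ominus>\<^bsub>L\<^esub> b x"
        using x by (simp add: linear_map_add[OF d(4)] linear_map_minus[OF d(2) d(1) d(4)]
            chain_liftsD(2)[OF c] chain_liftsD(2)[OF c'] aw)
      also have "\<dots> = \<zero>\<^bsub>L\<^esub>"
        using x bc linear_map_closed[OF e'] by (simp add: b(2) L.a_ac L.r_neg L.r_neg1 L.r_neg2)
      finally show "res_aug D (?h x) = \<zero>\<^bsub>L\<^esub>" .
    qed
    then obtain t where t: "t \<in> module_hom R (res_mod Q n) (res_mod D (Suc 0))"
      "\<And>x. x \<in> carrier (res_mod Q n) \<Longrightarrow> res_diff D 0 (t x) = ?h x"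
      using projective_lift[OF q(1)[of n] d(2)[of "Suc 0"] d(2)[of 0] h d(3)[of 0]] by blast
    have t': "c 0 x = (res_diff D 0 (t x) \<oplus>\<^bsub>res_mod D 0\<^esub> w x) \<oplus>\<^bsub>res_mod D 0\<^esub> c' 0 x" if "x \<in> carrier (res_mod Q n)" for x
      using t(2)[OF that] module_diff_cancel[OF d(2)[of 0], of "c 0 x" "c' 0 x" "w x" "res_diff D 0 (t x)"]
        cc[of x 0] cc'[of x 0] wc[OF that] linear_map_closed[OF h] that by simp
    have "c 0 (res_diff Q n x) = res_diff D 0 (t (res_diff Q n x)) \<oplus>\<^bsub>res_mod D 0\<^esub> c' 0 (res_diff Q n x)"
      if x: "x \<in> carrier (res_mod Q (Suc n))" for x
      using t'[of "res_diff Q n x"] null_cochain_cocycle[OF Q d(2) w x] x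
        linear_map_closed[OF d(3)[of 0] linear_map_closed[OF module_hom_linear[OF t(1)] qd[OF x]]] by simp
    then show "\<exists>t. ?\<Phi> 0 t" using t(1) t' by auto
  next
    fix t i assume t: "?\<Phi> i t"
    interpret Di: abelian_group "res_mod D i" by (rule left_module_abelian_group[OF d(2)])
    interpret Dsi: abelian_group "res_mod D (Suc i)" by (rule left_module_abelian_group[OF d(2)])
    let ?D = "res_mod D (Suc i)"
    have tl: "t \<in> linear_map R (res_mod Q (n + i)) ?D" using t by (simp add: module_hom_linear)
    have tdl: "(\<lambda>x. t (res_diff Q (n + i) x)) \<in> linear_map R (res_mod Q (Suc (n + i))) ?D"
      by (rule linear_map_comp[OF q(3) tl])
    let ?h = "\<lambda>x. (c (Suc i) x \<oplus>\<^bsub>?D\<^esub> \<ominus>\<^bsub>?D\<^esub> c' (Suc i) x) \<oplus>\<^bsub>?D\<^esub> \<ominus>\<^bsub>?D\<^esub> t (res_diff Q (n + i) x)"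
    have h: "?h \<in> linear_map R (res_mod Q (Suc (n + i))) ?D" using diff[of "\<lambda>x. t (res_diff Q (n + i) x)" "Suc i"] tdl by simp
    have "?h x \<in> res_diff D (Suc i) ` carrier (res_mod D (Suc (Suc i)))" if x: "x \<in> carrier (res_mod Q (Suc (n + i)))" for x
    proof (rule d(9)[OF linear_map_closed[OF h x]])
      have cl: "c (Suc i) x \<in> carrier ?D" "c' (Suc i) x \<in> carrier ?D" "t (res_diff Q (n + i) x) \<in> carrier ?D"
        using cc[of x "Suc i"] cc'[of x "Suc i"] linear_map_closed[OF tdl x] x by auto
      then have "res_diff D i (?h x) = (c i (res_diff Q (n + i) x) \<oplus>\<^bsub>res_mod D i\<^esub> \<ominus>\<^bsub>res_mod D i\<^esub> c' i (res_diff Q (n + i) x))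
          \<oplus>\<^bsub>res_mod D i\<^esub> \<ominus>\<^bsub>res_mod D i\<^esub> res_diff D i (t (res_diff Q (n + i) x))"
        using x by (simp add: linear_map_add[OF d(3)] linear_map_minus[OF d(2) d(2) d(3)]
            chain_liftsD(3)[OF c] chain_liftsD(3)[OF c'])
      also have "\<dots> = \<zero>\<^bsub>res_mod D i\<^esub>"
        using t x linear_map_closed[OF d(3) cl(3)] cc[OF qd[OF x]] cc'[OF qd[OF x]]
        by (subst eq_commute, subst module_diff_cancel[OF d(2)]) auto
      finally show "res_diff D i (?h x) = \<zero>\<^bsub>res_mod D i\<^esub>" .
    qed
    then obtain t' where t': "t' \<in> module_hom R (res_mod Q (Suc (n + i))) (res_mod D (Suc (Suc i)))"
      "\<And>x. x \<in> carrier (res_mod Q (Suc (n + i))) \<Longrightarrow> res_diff D (Suc i) (t' x) = ?h x"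
      using projective_lift[OF q(1) d(2) d(2) h d(3)] by blast
    have eq: "c (Suc i) x = (res_diff D (Suc i) (t' x) \<oplus>\<^bsub>?D\<^esub> t (res_diff Q (n + i) x)) \<oplus>\<^bsub>?D\<^esub> c' (Suc i) x"
      if "x \<in> carrier (res_mod Q (Suc (n + i)))" for x
      using t'(2)[OF that] module_diff_cancel[OF d(2)[of "Suc i"], of "c (Suc i) x" "c' (Suc i) x" "t (res_diff Q (n + i) x)" "res_diff D (Suc i) (t' x)"]
        cc[of x "Suc i"] cc'[of x "Suc i"] linear_map_closed[OF tdl that] linear_map_closed[OF h] that by simp
    have "c (Suc i) (res_diff Q (n + Suc i) x) = res_diff D (Suc i) (t' (res_diff Q (n + Suc i) x)) \<oplus>\<^bsub>?D\<^esub> c' (Suc i) (res_diff Q (n + Suc i) x)"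
      if x: "x \<in> carrier (res_mod Q (Suc (n + Suc i)))" for x
      using eq[of "res_diff Q (n + Suc i) x"] x q(4)[of x "n + i"] linear_map_zero[OF q(2) d(2) tl]
        linear_map_closed[OF d(3)[of "Suc i"] linear_map_closed[OF module_hom_linear[OF t'(1)] qd[of "x" "Suc (n + i)"]]]
        qd[of x "n + Suc i"] by simp
    then show "\<exists>t'. ?\<Phi> (Suc i) t' \<and> (\<forall>x\<in>carrier (res_mod Q (Suc (n + i))). c (Suc i) x =
      (res_diff D (Suc i) (t' x) \<oplus>\<^bsub>?D\<^esub> t (res_diff Q (n + i) x)) \<oplus>\<^bsub>?D\<^esub> c' (Suc i) x)"
      using t'(1) eq by auto
  qed
  then obtain t where t: "\<forall>i. ?\<Phi> i (t i) \<and> (\<forall>x\<in>carrier (res_mod Q (Suc (n + i))). c (Suc i) x =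
      (res_diff D (Suc i) (t (Suc i) x) \<oplus>\<^bsub>res_mod D (Suc i)\<^esub> t i (res_diff Q (n + i) x)) \<oplus>\<^bsub>res_mod D (Suc i)\<^esub> c' (Suc i) x)" ..
  have tl: "t i \<in> linear_map R (res_mod Q (n + i)) (res_mod D (Suc i))" for i
    using t[rule_format, of i] by (elim conjE) (rule module_hom_linear)
  interpret N: abelian_group N by (rule left_module_abelian_group[OF N])
  note fc = linear_map_closed[OF f] and fa = linear_map_add[OF f]
  interpret Di: abelian_group "res_mod D i" by (rule left_module_abelian_group[OF d(2)])
  have collapse: "f ((res_diff D i y \<oplus>\<^bsub>res_mod D i\<^esub> z) \<oplus>\<^bsub>res_mod D i\<^esub> u) = f z \<oplus>\<^bsub>N\<^esub> f u"
    if "y \<in> carrier (res_mod D (Suc i))" "z \<in> carrier (res_mod D i)" "u \<in> carrier (res_mod D i)" for y z u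
    using that linear_map_closed[OF d(3) that(1)] by (simp add: fa f0 fc)
  show ?thesis
  proof (cases i)
    case 0
    have "null_cochain R Q N n (\<lambda>x. f (w x))"
      using null_cochain_comp[OF d(2) N _ w, of f] f 0 by simp
    moreover have "f (c i x) = f (w x) \<oplus>\<^bsub>N\<^esub> f (c' i x)" if x: "x \<in> carrier (res_mod Q (n + i))" for x
    proof -
      have "c i x = (res_diff D i (t i x) \<oplus>\<^bsub>res_mod D i\<^esub> w x) \<oplus>\<^bsub>res_mod D i\<^esub> c' i x"
        using t[rule_format, of 0] x 0 by simp
      then show ?thesis
        using collapse[OF linear_map_closed[OF tl x], of "w x" "c' i x"] cc'[OF x] wc[of x] x 0 by simp
    qed
    ultimately show ?thesis using 0 unfolding cohomologous_def by auto
  next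
    case (Suc l)
    have "null_cochain R Q N (n + i) (\<lambda>x. f (t l (res_diff Q (n + l) x)))"
      using linear_map_comp[OF tl[of l], of f N] f Suc by (auto simp: null_cochain_def)
    moreover have "f (c i x) = f (t l (res_diff Q (n + l) x)) \<oplus>\<^bsub>N\<^esub> f (c' i x)" if x: "x \<in> carrier (res_mod Q (n + i))" for x
    proof -
      have "c i x = (res_diff D i (t i x) \<oplus>\<^bsub>res_mod D i\<^esub> t l (res_diff Q (n + l) x)) \<oplus>\<^bsub>res_mod D i\<^esub> c' i x"
        using t[rule_format, of l] x Suc by simp
      then show ?thesis
        using collapse[OF linear_map_closed[OF tl x], of "t l (res_diff Q (n + l) x)" "c' i x"] cc'[OF x] x Suc
          linear_map_closed[OF tl[of l] qd[of x "n + l"]] by simp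
    qed
    ultimately show ?thesis unfolding cohomologous_def by blast
  qed
qed

text \<open>
  A coboundary \<open>g \<circ> d\<close> pulled back along a chain map \<open>l\<close> is the coboundary of \<open>g \<circ> l\<close>.
\<close>

lemma null_cochain_pullback:
  assumes Q: "projective_complex R Q" and Q': "projective_complex R Q'" and N: "left_module R N"
    and l: "l \<in> chain_lifts R Q n Q' e" and b: "null_cochain R Q' N i b"
  shows "null_cochain R Q N (n + i) (\<lambda>x. b (l i x))"
proof (cases i)
  case 0
  show ?thesis
    by (rule null_cochain_zero[OF projective_complexD(2)[OF Q] N])
       (use b 0 linear_map_closed[OF chain_liftsD(1)[OF l, of 0]] in \<open>auto simp: null_cochain_def\<close>)
next
  case (Suc m)
  then obtain g where g: "g \<in> linear_map R (res_mod Q' m) N"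
    "\<And>x. x \<in> carrier (res_mod Q' i) \<Longrightarrow> b x = g (res_diff Q' m x)"
    using b by (auto simp: null_cochain_def)
  have "b (l i x) = g (l m (res_diff Q (n + m) x))" if "x \<in> carrier (res_mod Q (n + i))" for x
    using that g(2)[OF linear_map_closed[OF chain_liftsD(1)[OF l] that]] chain_liftsD(3)[OF l, of x m] Suc by simp
  then show ?thesis
    using linear_map_comp[OF chain_liftsD(1)[OF l, of m] g(1)] Suc by (auto simp: null_cochain_def)
qed

section \<open>The groups Ext\<close>

definition cocycle_group where
  "cocycle_group R Q N n = (hom_group R (res_mod Q n) N)\<lparr>carrier := cocycles R Q N n\<rparr>"

lemma cocycle_group_simps:
  "carrier (cocycle_group R Q N n) = cocycles R Q N n"
  "f \<otimes>\<^bsub>cocycle_group R Q N n\<^esub> g = (\<lambda>x\<in>carrier (res_mod Q n). f x \<oplus>\<^bsub>N\<^esub> g x)"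
  "\<one>\<^bsub>cocycle_group R Q N n\<^esub> = (\<lambda>x\<in>carrier (res_mod Q n). \<zero>\<^bsub>N\<^esub>)"
  by (simp_all add: cocycle_group_def hom_group_def)

lemma cocycles_restrictI:
  assumes "projective_complex R Q" and "f \<in> linear_map R (res_mod Q n) N"
    and "\<And>x. x \<in> carrier (res_mod Q (Suc n)) \<Longrightarrow> f (res_diff Q n x) = \<zero>\<^bsub>N\<^esub>"
  shows "restrict f (carrier (res_mod Q n)) \<in> cocycles R Q N n"
  using assms left_module_hom_restrict[OF projective_complexD(2)[OF assms(1)] assms(2)]
    linear_map_closed[OF projective_complexD(3)[OF assms(1)]]
  by (auto simp: cocycles_def)

lemma cocyclesD:
  assumes "f \<in> cocycles R Q N n"
  shows "f \<in> linear_map R (res_mod Q n) N" "f \<in> extensional (carrier (res_mod Q n))"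
    "x \<in> carrier (res_mod Q (Suc n)) \<Longrightarrow> f (res_diff Q n x) = \<zero>\<^bsub>N\<^esub>"
  using assms by (auto simp: cocycles_def module_hom_iff)

lemma cocycle_group:
  assumes Q: "projective_complex R Q" and N: "left_module R N"
  shows cocycle_comm_group: "comm_group (cocycle_group R Q N n)"
    and coboundaries_subgroup: "subgroup (coboundaries R Q N n) (cocycle_group R Q N n)"
proof -
  note q = projective_complexD[OF Q]
  interpret N: abelian_group N by (rule left_module_abelian_group[OF N])
  note cl [simp] = linear_map_closed[OF cocyclesD(1)] and [simp] = linear_map_closed[OF q(3)]
  have zero: "(\<lambda>x\<in>carrier (res_mod Q n). \<zero>\<^bsub>N\<^esub>) \<in> cocycles R Q N n"
    by (rule cocycles_restrictI[OF Q linear_map_zero_map[OF q(2) N]]) simp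
  have plus: "(\<lambda>x\<in>carrier (res_mod Q n). f x \<oplus>\<^bsub>N\<^esub> g x) \<in> cocycles R Q N n"
    if "f \<in> cocycles R Q N n" "g \<in> cocycles R Q N n" for f g
    by (rule cocycles_restrictI[OF Q linear_map_sum[OF q(2) N cocyclesD(1)[OF that(1)] cocyclesD(1)[OF that(2)]]])
       (simp add: cocyclesD(3)[OF that(1)] cocyclesD(3)[OF that(2)])
  have neg: "(\<lambda>x\<in>carrier (res_mod Q n). \<ominus>\<^bsub>N\<^esub> f x) \<in> cocycles R Q N n"
    if "f \<in> cocycles R Q N n" for f
    by (rule cocycles_restrictI[OF Q linear_map_uminus[OF q(2) N cocyclesD(1)[OF that]]])
       (simp add: cocyclesD(3)[OF that])
  have ext: "(\<lambda>x\<in>carrier (res_mod Q n). f x) = f" if "f \<in> cocycles R Q N n" for f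
    using cocyclesD(2)[OF that] by (simp add: extensional_restrict)
  show G: "comm_group (cocycle_group R Q N n)"
  proof (rule comm_groupI)
    fix f assume f: "f \<in> carrier (cocycle_group R Q N n)"
    then have f': "f \<in> cocycles R Q N n" by (simp add: cocycle_group_simps)
    show "\<exists>g\<in>carrier (cocycle_group R Q N n). g \<otimes>\<^bsub>cocycle_group R Q N n\<^esub> f = \<one>\<^bsub>cocycle_group R Q N n\<^esub>"
      using neg[OF f'] f'
      by (intro bexI[of _ "\<lambda>x\<in>carrier (res_mod Q n). \<ominus>\<^bsub>N\<^esub> f x"])
         (auto simp: cocycle_group_simps N.l_neg intro!: restrict_ext)
    show "\<one>\<^bsub>cocycle_group R Q N n\<^esub> \<otimes>\<^bsub>cocycle_group R Q N n\<^esub> f = f"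
      using f' by (subst (2) ext[OF f', symmetric]) (auto simp: cocycle_group_simps intro!: restrict_ext)
  qed (auto simp: cocycle_group_simps zero plus N.a_ac intro!: restrict_ext)
  interpret G: comm_group "cocycle_group R Q N n" by (rule G)
  have B: "b \<in> coboundaries R Q N n \<longleftrightarrow> b \<in> cocycles R Q N n \<and> null_cochain R Q N n b" for b
    using null_cochain_cocycle[OF Q N] by (auto simp: coboundaries_iff[OF Q N] cocycles_def)
  have inv: "inv\<^bsub>cocycle_group R Q N n\<^esub> f = (\<lambda>x\<in>carrier (res_mod Q n). \<ominus>\<^bsub>N\<^esub> f x)"
    if "f \<in> cocycles R Q N n" for f
    using that neg[OF that]
    by (intro G.inv_equality) (auto simp: cocycle_group_simps N.l_neg intro!: restrict_ext)
  show "subgroup (coboundaries R Q N n) (cocycle_group R Q N n)"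
  proof (rule subgroup.intro)
    show "coboundaries R Q N n \<subseteq> carrier (cocycle_group R Q N n)" by (auto simp: B cocycle_group_simps)
    show "\<one>\<^bsub>cocycle_group R Q N n\<^esub> \<in> coboundaries R Q N n"
      using zero null_cochain_zero[OF q(2) N] by (simp add: B cocycle_group_simps)
    fix b assume b: "b \<in> coboundaries R Q N n"
    show "inv\<^bsub>cocycle_group R Q N n\<^esub> b \<in> coboundaries R Q N n"
      using b neg null_cochain_minus[OF q(2) N, of n b "\<lambda>x\<in>carrier (res_mod Q n). \<ominus>\<^bsub>N\<^esub> b x"]
      by (simp add: B inv)
    fix b' assume b': "b' \<in> coboundaries R Q N n"
    show "b \<otimes>\<^bsub>cocycle_group R Q N n\<^esub> b' \<in> coboundaries R Q N n"
      using b b' plus null_cochain_add[OF q(2) N, of n b b' "\<lambda>x\<in>carrier (res_mod Q n). b x \<oplus>\<^bsub>N\<^esub> b' x"]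
      by (simp add: B cocycle_group_simps)
  qed
qed

lemma ext_class_coset: "ext_class R Q N n f = coboundaries R Q N n #>\<^bsub>cocycle_group R Q N n\<^esub> f"
  by (simp add: ext_class_def r_coset_def cocycle_group_def)

lemma Ext_alt: "Ext R Q N n = cocycle_group R Q N n Mod coboundaries R Q N n"
  by (simp add: Ext_def cocycle_group_def)

lemma Ext_comm_group:
  assumes "projective_complex R Q" "left_module R N"
  shows "comm_group (Ext R Q N n)"
  unfolding Ext_alt
  by (rule comm_group.abelian_FactGroup[OF cocycle_comm_group[OF assms] coboundaries_subgroup[OF assms]])

lemma carrier_Ext: "carrier (Ext R Q N n) = ext_class R Q N n ` cocycles R Q N n"
  unfolding Ext_alt carrier_FactGroup by (simp add: ext_class_coset[abs_def] cocycle_group_simps)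

lemma ext_class_hom:
  assumes "projective_complex R Q" "left_module R N"
  shows "ext_class R Q N n \<in> hom (cocycle_group R Q N n) (Ext R Q N n)"
  unfolding Ext_alt ext_class_coset[abs_def]
  by (intro normal.r_coset_hom_Mod comm_group.subgroup_imp_normal cocycle_comm_group coboundaries_subgroup assms)

lemma ext_class_mult:
  assumes "projective_complex R Q" "left_module R N" "f \<in> cocycles R Q N n" "g \<in> cocycles R Q N n"
  shows "ext_class R Q N n f \<otimes>\<^bsub>Ext R Q N n\<^esub> ext_class R Q N n g =
    ext_class R Q N n (\<lambda>x\<in>carrier (res_mod Q n). f x \<oplus>\<^bsub>N\<^esub> g x)"
  using hom_mult[OF ext_class_hom[OF assms(1,2)], of f n g] assms(3,4) by (simp add: cocycle_group_simps)

lemma ext_class_inv: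
  assumes Q: "projective_complex R Q" and N: "left_module R N" and f: "f \<in> cocycles R Q N n"
  shows "inv\<^bsub>Ext R Q N n\<^esub> ext_class R Q N n f = ext_class R Q N n (\<lambda>x\<in>carrier (res_mod Q n). \<ominus>\<^bsub>N\<^esub> f x)"
proof -
  interpret N: abelian_group N by (rule left_module_abelian_group[OF N])
  interpret G: comm_group "Ext R Q N n" by (rule Ext_comm_group[OF Q N])
  interpret Z: comm_group "cocycle_group R Q N n" by (rule cocycle_comm_group[OF Q N])
  note cl = linear_map_closed[OF cocyclesD(1)[OF f]]
  have g: "(\<lambda>x\<in>carrier (res_mod Q n). \<ominus>\<^bsub>N\<^esub> f x) \<in> cocycles R Q N n"
    by (rule cocycles_restrictI[OF Q linear_map_uminus[OF projective_complexD(2)[OF Q] N cocyclesD(1)[OF f]]])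
       (simp add: cocyclesD(3)[OF f])
  have inv: "inv\<^bsub>cocycle_group R Q N n\<^esub> f = (\<lambda>x\<in>carrier (res_mod Q n). \<ominus>\<^bsub>N\<^esub> f x)"
    using f g cl by (intro Z.inv_equality) (auto simp: cocycle_group_simps N.l_neg intro!: restrict_ext)
  interpret h: group_hom "cocycle_group R Q N n" "Ext R Q N n" "ext_class R Q N n"
    by unfold_locales (rule ext_class_hom[OF Q N])
  show ?thesis using h.hom_inv[of f] f by (simp add: inv cocycle_group_simps)
qed

section \<open>The action of Hochschild classes on Ext by chain maps\<close>

text \<open>
  \<open>(-1)\<^sup>n x\<close>
\<close>

definition signed :: "('x, 'w) ring_scheme \<Rightarrow> nat \<Rightarrow> 'x \<Rightarrow> 'x" where
  "signed M n x = (if even n then x else \<ominus>\<^bsub>M\<^esub> x)"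

lemma signed_closed: "abelian_group M \<Longrightarrow> x \<in> carrier M \<Longrightarrow> signed M n x \<in> carrier M"
  by (simp add: signed_def abelian_group.a_inv_closed)

lemma signed_zero: "abelian_group M \<Longrightarrow> signed M n \<zero>\<^bsub>M\<^esub> = \<zero>\<^bsub>M\<^esub>"
  using add_hom_zero[of M M "\<lambda>x. \<ominus>\<^bsub>M\<^esub> x"]
  by (simp add: signed_def add_homI abelian_group.minus_add abelian_group.a_inv_closed)

lemma signed_signed:
  "abelian_group M \<Longrightarrow> x \<in> carrier M \<Longrightarrow> signed M m (signed M n x) = signed M (m + n) x"
  by (auto simp: signed_def abelian_group.minus_minus)

lemma signed_even: "even n \<Longrightarrow> signed M n x = x"
  by (simp add: signed_def)

lemma linear_map_signed:
  "left_module R M \<Longrightarrow> left_module R N \<Longrightarrow> f \<in> linear_map R M N \<Longrightarrow> x \<in> carrier M \<Longrightarrow>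
    f (signed M n x) = signed N n (f x)"
  by (simp add: signed_def linear_map_minus)

lemma signed_linear:
  "left_module R M \<Longrightarrow> left_module R N \<Longrightarrow> f \<in> linear_map R M N \<Longrightarrow>
    (\<lambda>x. signed N n (f x)) \<in> linear_map R M N"
  by (cases "even n") (simp_all add: signed_def linear_map_uminus)

lemma signed_cancel:
  assumes "abelian_group M" "x \<in> carrier M" "y \<in> carrier M" "x \<oplus>\<^bsub>M\<^esub> signed M (Suc n) y = \<zero>\<^bsub>M\<^esub>"
  shows "x = signed M n y"
proof -
  interpret abelian_group M by fact
  have "\<ominus>\<^bsub>M\<^esub> signed M (Suc n) y = x" using assms by (intro minus_equality) (auto simp: signed_closed[OF assms(1)])
  then show ?thesis using assms(3) by (auto simp: signed_def split: if_splits)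
qed

context fd_algebra begin

text \<open>
  Both sides of each axiom are additive in the elements of the enveloping algebra, so these may be
  taken to be pure tensors.
\<close>

lemma regular_bimodule_left_module:
  assumes "ring E"
  shows "left_module E (regular_bimodule A)"
proof -
  interpret E: ring E by fact
  let ?B = "regular_bimodule A"
  have bal: "balanced_map k A (opposite A) A (\<lambda>a b. a \<otimes>\<^bsub>A\<^esub> x \<otimes>\<^bsub>A\<^esub> b)" if "x \<in> carrier A" for x
    using that by (intro balanced_mapI) (auto simp: A.l_distr A.r_distr scalar_mult_left scalar_mult_right)
  have ab: "abelian_group A" by (rule A.is_abelian_group)
  have hom_left: "(\<lambda>U. U \<odot>\<^bsub>?B\<^esub> x) \<in> add_hom E A" if "x \<in> carrier A" for x
    using env.tensor_lift_hom[OF ab bal[OF that]] by (simp add: regular_bimodule_def E_simps hom_def)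
  note closed = add_hom_closed[OF hom_left]
  have add: "U \<odot>\<^bsub>?B\<^esub> (x \<oplus>\<^bsub>A\<^esub> y) = U \<odot>\<^bsub>?B\<^esub> x \<oplus>\<^bsub>A\<^esub> U \<odot>\<^bsub>?B\<^esub> y"
    if xy: "x \<in> carrier A" "y \<in> carrier A" and U: "U \<in> carrier E" for U x y
  proof (rule E_eqI[OF ab _ _ _ U])
    show "(\<lambda>U. U \<odot>\<^bsub>?B\<^esub> (x \<oplus>\<^bsub>A\<^esub> y)) \<in> add_hom E A" using xy by (intro hom_left) simp
    show "(\<lambda>U. U \<odot>\<^bsub>?B\<^esub> x \<oplus>\<^bsub>A\<^esub> U \<odot>\<^bsub>?B\<^esub> y) \<in> add_hom E A"
      using xy add_hom_add[OF hom_left] by (intro add_homI) (auto simp: closed A.a_ac)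
  qed (use xy in \<open>simp add: regular_bimodule_smult A.l_distr A.r_distr\<close>)
  have hom_right: "(\<lambda>x. U \<odot>\<^bsub>?B\<^esub> x) \<in> add_hom A A" if "U \<in> carrier E" for U
    using that by (intro add_homI) (auto simp: closed add)
  have assoc: "(U \<otimes>\<^bsub>E\<^esub> V) \<odot>\<^bsub>?B\<^esub> x = U \<odot>\<^bsub>?B\<^esub> (V \<odot>\<^bsub>?B\<^esub> x)"
    if U: "U \<in> carrier E" and V: "V \<in> carrier E" and x: "x \<in> carrier A" for U V x
  proof (rule E_eqI[OF ab _ _ _ U])
    have "(\<lambda>U. U \<otimes>\<^bsub>E\<^esub> V) \<in> add_hom E E" using V by (intro add_homI) (auto simp: E.l_distr)
    from add_hom_comp[OF this hom_left[OF x]] show "(\<lambda>U. (U \<otimes>\<^bsub>E\<^esub> V) \<odot>\<^bsub>?B\<^esub> x) \<in> add_hom E A" .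
    show "(\<lambda>U. U \<odot>\<^bsub>?B\<^esub> (V \<odot>\<^bsub>?B\<^esub> x)) \<in> add_hom E A" by (rule hom_left[OF closed[OF x V]])
    fix a b assume a: "a \<in> carrier A" and b: "b \<in> carrier A"
    show "(env a b \<otimes>\<^bsub>E\<^esub> V) \<odot>\<^bsub>?B\<^esub> x = env a b \<odot>\<^bsub>?B\<^esub> (V \<odot>\<^bsub>?B\<^esub> x)"
    proof (rule E_eqI[OF ab _ _ _ V])
      have "(\<lambda>V. env a b \<otimes>\<^bsub>E\<^esub> V) \<in> add_hom E E" using a b by (intro add_homI) (auto simp: E.r_distr)
      from add_hom_comp[OF this hom_left[OF x]] show "(\<lambda>V. (env a b \<otimes>\<^bsub>E\<^esub> V) \<odot>\<^bsub>?B\<^esub> x) \<in> add_hom E A" .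
      show "(\<lambda>V. env a b \<odot>\<^bsub>?B\<^esub> (V \<odot>\<^bsub>?B\<^esub> x)) \<in> add_hom E A"
        by (rule add_hom_comp[OF hom_left[OF x] hom_right]) (use a b in auto)
    qed (use a b x in \<open>simp add: env_mult regular_bimodule_smult A.m_assoc\<close>)
  qed
  show ?thesis
    by (intro left_module.intro left_module_axioms.intro E.ring_axioms abelian_group_transfer[OF ab])
       (use closed add assoc add_hom_add[OF hom_left] in
         \<open>auto simp: E_simps(4) regular_bimodule_smult\<close>)
qed

lemma tensor_map_commute:
  assumes X: "left_module E X" and X': "left_module E X'" and L: "left_module A L" and L': "left_module A L'"
    and p: "p \<in> linear_map E X X'" and e: "e \<in> linear_map A L L'" and u: "u \<in> carrier (T X L)"
  shows "tensor_map X' L' p (\<lambda>m. m) (tensor_map X L' (\<lambda>x. x) e u) =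
    tensor_map X' L' (\<lambda>x. x) e (tensor_map X' L p (\<lambda>m. m) u)"
  by (rule T_eqI[OF X L T_abelian_group[OF X' L'] _ _ _ u])
     (use add_hom_comp[OF tensor_map_hom[OF X X L L' linear_map_id e] tensor_map_hom[OF X X' L' L' linear_map_rmod[OF p] linear_map_id]]
       add_hom_comp[OF tensor_map_hom[OF X X' L L linear_map_rmod[OF p] linear_map_id] tensor_map_hom[OF X' X' L L' linear_map_id e]]
       linear_map_closed[OF p] linear_map_closed[OF e]
      in \<open>simp_all add: tensor_map_pt[OF X X L L' linear_map_id e] tensor_map_pt[OF X X' L L linear_map_rmod[OF p] linear_map_id]
        tensor_map_pt[OF X X' L' L' linear_map_rmod[OF p] linear_map_id] tensor_map_pt[OF X' X' L L' linear_map_id e]\<close>)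

lemma eval_map_natural:
  assumes X: "left_module E X" and L: "left_module A L" and L': "left_module A L'"
    and f: "f \<in> linear_map E X (regular_bimodule A)" and e: "e \<in> linear_map A L L'" and u: "u \<in> carrier (T X L)"
  shows "eval_map L' f (tensor_map X L' (\<lambda>x. x) e u) = e (eval_map L f u)"
  by (rule T_eqI[OF X L left_module_abelian_group[OF L'] _ _ _ u])
     (use add_hom_comp[OF tensor_map_hom[OF X X L L' linear_map_id e] linear_map_add_hom[OF eval_map_linear[OF X L' f]]]
       add_hom_comp[OF linear_map_add_hom[OF eval_map_linear[OF X L f]] linear_map_add_hom[OF e]]
       linear_map_closed[OF f] linear_map_closed[OF e]
      in \<open>simp_all add: tensor_map_pt[OF X X L L' linear_map_id e] eval_map_pt[OF X L f] eval_map_pt[OF X L' f]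
        linear_map_smult[OF e]\<close>)

lemma tensor_map_zero_comp:
  assumes X: "left_module E X" and L: "left_module A L" "left_module A L'" "left_module A L''"
    and e: "e \<in> linear_map A L L'" and e': "e' \<in> linear_map A L' L''"
    and z: "\<And>m. m \<in> carrier L \<Longrightarrow> e' (e m) = \<zero>\<^bsub>L''\<^esub>" and u: "u \<in> carrier (T X L)"
  shows "tensor_map X L'' (\<lambda>x. x) e' (tensor_map X L' (\<lambda>x. x) e u) = \<zero>\<^bsub>T X L''\<^esub>"
  by (rule T_eqI[OF X L(1) T_abelian_group[OF X L(3)] _ _ _ u])
     (use add_hom_comp[OF tensor_map_hom[OF X X L(1,2) linear_map_id e] tensor_map_hom[OF X X L(2,3) linear_map_id e']]
       linear_map_add_hom[OF linear_map_zero_map[OF T_left_module[OF X L(1)] T_left_module[OF X L(3)]]]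
       linear_map_closed[OF e]
      in \<open>simp_all add: tensor_map_pt[OF X X L(1,2) linear_map_id e] tensor_map_pt[OF X X L(2,3) linear_map_id e']
        z pt_zero_right[OF X L(3)]\<close>)

lemma eval_map_comp:
  assumes X: "left_module E X" and X': "left_module E X'" and L: "left_module A L"
    and p: "p \<in> linear_map E X X'" and g: "g \<in> linear_map E X' (regular_bimodule A)"
    and h: "h \<in> linear_map E X (regular_bimodule A)"
    and eq: "\<And>x. x \<in> carrier X \<Longrightarrow> h x = g (p x)" and u: "u \<in> carrier (T X L)"
  shows "eval_map L g (tensor_map X' L p (\<lambda>m. m) u) = eval_map L h u"
  by (rule T_eqI[OF X L left_module_abelian_group[OF L] _ _ _ u])
     (use add_hom_comp[OF tensor_map_hom[OF X X' L L linear_map_rmod[OF p] linear_map_id] linear_map_add_hom[OF eval_map_linear[OF X' L g]]]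
       linear_map_add_hom[OF eval_map_linear[OF X L h]] linear_map_closed[OF p]
      in \<open>simp_all add: tensor_map_pt[OF X X' L L linear_map_rmod[OF p] linear_map_id] eval_map_pt[OF X' L g]
        eval_map_pt[OF X L h] eq\<close>)

lemma eval_map_zero:
  assumes X: "left_module E X" and L: "left_module A L" and h: "h \<in> linear_map E X (regular_bimodule A)"
    and eq: "\<And>x. x \<in> carrier X \<Longrightarrow> h x = \<zero>\<^bsub>A\<^esub>" and u: "u \<in> carrier (T X L)"
  shows "eval_map L h u = \<zero>\<^bsub>L\<^esub>"
  by (rule T_eqI[OF X L left_module_abelian_group[OF L] _ _ _ u])
     (use linear_map_add_hom[OF linear_map_zero_map[OF T_left_module[OF X L] L]]
       linear_map_add_hom[OF eval_map_linear[OF X L h]]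
      in \<open>simp_all add: eval_map_pt[OF X L h] eq left_module_zero_scalar[OF L]\<close>)

lemma eval_map_add:
  assumes X: "left_module E X" and L: "left_module A L"
    and f: "f \<in> linear_map E X (regular_bimodule A)" and g: "g \<in> linear_map E X (regular_bimodule A)"
    and h: "h \<in> linear_map E X (regular_bimodule A)"
    and eq: "\<And>x. x \<in> carrier X \<Longrightarrow> f x = g x \<oplus>\<^bsub>A\<^esub> h x" and u: "u \<in> carrier (T X L)"
  shows "eval_map L f u = eval_map L g u \<oplus>\<^bsub>L\<^esub> eval_map L h u"
  by (rule T_eqI[OF X L left_module_abelian_group[OF L] _ _ _ u])
     (use linear_map_add_hom[OF linear_map_sum[OF T_left_module[OF X L] L eval_map_linear[OF X L g] eval_map_linear[OF X L h]]]
       linear_map_add_hom[OF eval_map_linear[OF X L f]] linear_map_closed[OF g] linear_map_closed[OF h]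
      in \<open>simp_all add: eval_map_pt[OF X L f] eval_map_pt[OF X L g] eval_map_pt[OF X L h] eq left_module.smult_l_distr[OF L]\<close>)

end

locale hochschild_resolution = fd_algebra k A
  for k :: "('k, 'z) ring_scheme" and A :: "('k, 'a, 'w) module_scheme" +
  fixes P :: "(('a \<times> 'a \<Rightarrow>\<^sub>0 int) set, 'p, 'a) resolution"
  assumes P: "projective_resolution E (regular_bimodule A) P"
begin

abbreviation reg where "reg \<equiv> regular_bimodule A"
abbreviation TP where "TP L \<equiv> tensor_resolution k A P L"

lemma reg_left_module: "left_module E reg"
proof (rule regular_bimodule_left_module)
  have "left_module E (res_mod P 0)" using P by (simp add: projective_resolution_def projective_module_def)
  then show "ring E" by (rule left_module_ring)
qed

lemma P_exact: "exact_resolution E reg P"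
  by (rule projective_resolution_exact[OF reg_left_module P])

lemma P_complex: "projective_complex E P"
  by (rule projective_resolution_complex[OF reg_left_module P])

lemmas PM = projective_complexD(2)[OF P_complex]
lemmas Pd = projective_complexD(3)[OF P_complex]
lemmas P\<epsilon> = exact_resolutionD(4)[OF P_exact]

lemma TP_exact: "left_module A L \<Longrightarrow> exact_resolution A L (TP L)"
  by (rule tensor_resolution_exact[OF P reg_left_module])

lemma cocycle_linear: "f \<in> cocycles E P reg i \<Longrightarrow> f \<in> linear_map E (res_mod P i) reg"
  by (simp add: cocycles_def module_hom_linear)

lemma eval_cocycle:
  assumes L: "left_module A L" and f: "f \<in> cocycles E P reg i" and u: "u \<in> carrier (T (res_mod P (Suc i)) L)"
  shows "eval_map L f (tensor_map (res_mod P i) L (res_diff P i) (\<lambda>m. m) u) = \<zero>\<^bsub>L\<^esub>"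
proof -
  have z: "(\<lambda>x. \<zero>\<^bsub>A\<^esub>) \<in> linear_map E (res_mod P (Suc i)) reg"
    using linear_map_zero_map[OF PM reg_left_module] by simp
  have "f (res_diff P i x) = \<zero>\<^bsub>A\<^esub>" if "x \<in> carrier (res_mod P (Suc i))" for x
    using f that by (simp add: cocycles_def)
  then show ?thesis
    using eval_map_comp[OF PM PM L Pd cocycle_linear[OF f] z _ u] eval_map_zero[OF PM L z _ u] by simp
qed

text \<open>
  A chain map from \<open>Q\<close> to the total complex of \<open>P \<otimes>\<^sub>A Q\<close>, with components \<open>\<Delta>\<^bsub>a,b\<^esub> : Q\<^bsub>b+a\<^esub> \<rightarrow> P\<^sub>a \<otimes>\<^sub>A Q\<^sub>b\<close>, that
  splits the augmentation \<open>P\<^sub>0 \<otimes>\<^sub>A Q\<^sub>b \<rightarrow> Q\<^sub>b\<close>.  It is constructed by recursion on \<open>a\<close> for all \<open>b\<close> at once,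
  lifting along the differentials of the exact complexes \<open>P \<otimes>\<^sub>A Q\<^sub>b \<rightarrow> Q\<^sub>b\<close>.  The sign \<open>(-1)\<^bsup>a+1\<^esup>\<close> makes the right hand
  side of the recursion a cycle: its two contributions from \<open>(1 \<otimes> d) \<circ> \<Delta> \<circ> d\<close> cancel.
\<close>

lemma double_complex:
  assumes Q: "projective_complex A Q"
  obtains \<Delta> where
    "\<And>a b. \<Delta> a b \<in> linear_map A (res_mod Q (b + a)) (T (res_mod P a) (res_mod Q b))"
    "\<And>b x. x \<in> carrier (res_mod Q b) \<Longrightarrow> eval_map (res_mod Q b) (res_aug P) (\<Delta> 0 b x) = x"
    "\<And>a b x. x \<in> carrier (res_mod Q (Suc (b + a))) \<Longrightarrow>
      tensor_map (res_mod P a) (res_mod Q b) (res_diff P a) (\<lambda>m. m) (\<Delta> (Suc a) b x) =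
      \<Delta> a b (res_diff Q (b + a) x) \<oplus>\<^bsub>T (res_mod P a) (res_mod Q b)\<^esub>
      signed (T (res_mod P a) (res_mod Q b)) (Suc a)
        (tensor_map (res_mod P a) (res_mod Q b) (\<lambda>x. x) (res_diff Q b) (\<Delta> a (Suc b) x))"
proof -
  note q = projective_complexD[OF Q]
  let ?T = "\<lambda>a b. T (res_mod P a) (res_mod Q b)"
  note TM = T_left_module[OF PM q(2)] and Tab = T_abelian_group[OF PM q(2)]
  let ?dP = "\<lambda>a b. tensor_map (res_mod P a) (res_mod Q b) (res_diff P a) (\<lambda>m. m)"
  let ?dQ = "\<lambda>a b. tensor_map (res_mod P a) (res_mod Q b) (\<lambda>x. x) (res_diff Q b)"
  have dP: "?dP a b \<in> linear_map A (?T (Suc a) b) (?T a b)" for a b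
    by (rule tensor_map_linear[OF PM PM q(2) q(2) Pd linear_map_id])
  have dQ: "?dQ a b \<in> linear_map A (?T a (Suc b)) (?T a b)" for a b
    by (rule tensor_map_linear[OF PM PM q(2) q(2) linear_map_id q(3)])
  have ex: "exact_resolution A (res_mod Q b) (TP (res_mod Q b))" for b by (rule TP_exact[OF q(2)])
  note ex0 = exact_resolutionD(8)[OF ex, unfolded tensor_resolution_simps]
    and ex1 = exact_resolutionD(9)[OF ex, unfolded tensor_resolution_simps]
    and exs = exact_resolutionD(5)[OF ex, unfolded tensor_resolution_simps]
  note \<epsilon>l = eval_map_linear[OF PM q(2) P\<epsilon>]
  let ?R = "\<lambda>a (D :: nat \<Rightarrow> _ \<Rightarrow> _) b x. D b (res_diff Q (b + a) x) \<oplus>\<^bsub>?T a b\<^esub> signed (?T a b) (Suc a) (?dQ a b (D (Suc b) x))"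
  have Rl: "?R a D b \<in> linear_map A (res_mod Q (Suc (b + a))) (?T a b)"
    if D: "\<And>b. D b \<in> linear_map A (res_mod Q (b + a)) (?T a b)" for a D b
    using D[of "Suc b"] by (intro linear_map_sum signed_linear q(2) TM linear_map_comp[OF q(3) D] linear_map_comp[OF _ dQ]) simp
  let ?\<Phi> = "\<lambda>a D. (\<forall>b. D b \<in> linear_map A (res_mod Q (b + a)) (?T a b)) \<and>
    (\<forall>b. \<forall>x\<in>carrier (res_mod Q (Suc (b + a))). ?R a D b x \<in> ?dP a b ` carrier (?T (Suc a) b)) \<and>
    (a = 0 \<longrightarrow> (\<forall>b. \<forall>x\<in>carrier (res_mod Q b). eval_map (res_mod Q b) (res_aug P) (D b x) = x))"
  have "\<exists>\<Delta>. \<forall>a. ?\<Phi> a (\<Delta> a) \<and>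
    (\<forall>b. \<forall>x\<in>carrier (res_mod Q (Suc (b + a))). ?dP a b (\<Delta> (Suc a) b x) = ?R a (\<Delta> a) b x)"
  proof (rule dependent_nat_choice)
    have "\<exists>l\<in>module_hom A (res_mod Q b) (?T 0 b). \<forall>x\<in>carrier (res_mod Q b). eval_map (res_mod Q b) (res_aug P) (l x) = x" for b
      using projective_lift[OF q(1) TM q(2) linear_map_id \<epsilon>l] exs by blast
    then obtain D where D: "\<And>b. D b \<in> linear_map A (res_mod Q b) (?T 0 b)"
      and \<epsilon>D: "\<And>b x. x \<in> carrier (res_mod Q b) \<Longrightarrow> eval_map (res_mod Q b) (res_aug P) (D b x) = x"
      by (metis module_hom_linear)
    have "?R 0 D b x \<in> ?dP 0 b ` carrier (?T (Suc 0) b)" if x: "x \<in> carrier (res_mod Q (Suc b))" for b x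
    proof (rule ex0)
      interpret Qb: abelian_group "res_mod Q b" by (rule left_module_abelian_group[OF q(2)])
      show Rc: "?R 0 D b x \<in> carrier (?T 0 b)" using linear_map_closed[OF Rl[of D 0 b]] D x by simp
      have c: "D b (res_diff Q b x) \<in> carrier (?T 0 b)" "?dQ 0 b (D (Suc b) x) \<in> carrier (?T 0 b)"
        "D (Suc b) x \<in> carrier (?T 0 (Suc b))"
        using linear_map_closed[OF D linear_map_closed[OF q(3) x]] linear_map_closed[OF dQ linear_map_closed[OF D x]]
          linear_map_closed[OF D x] by auto
      have "eval_map (res_mod Q b) (res_aug P) (?dQ 0 b (D (Suc b) x)) = res_diff Q b x"
        using eval_map_natural[OF PM q(2) q(2) P\<epsilon> q(3) c(3)] \<epsilon>D[OF x] by simp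
      then show "eval_map (res_mod Q b) (res_aug P) (?R 0 D b x) = \<zero>\<^bsub>res_mod Q b\<^esub>"
        using c linear_map_closed[OF q(3) x] \<epsilon>D
        by (simp add: linear_map_add[OF \<epsilon>l] signed_closed[OF Tab] linear_map_signed[OF TM q(2) \<epsilon>l])
           (simp add: signed_def Qb.r_neg)
    qed
    then show "\<exists>D. ?\<Phi> 0 D" using D \<epsilon>D by (intro exI[of _ D]) simp
  next
    fix D a assume Da: "?\<Phi> a D"
    then have D: "\<And>b. D b \<in> linear_map A (res_mod Q (b + a)) (?T a b)" by blast
    have "\<exists>l\<in>module_hom A (res_mod Q (Suc (b + a))) (?T (Suc a) b).
        \<forall>x\<in>carrier (res_mod Q (Suc (b + a))). ?dP a b (l x) = ?R a D b x" for b
      using projective_lift[OF q(1) TM TM Rl[OF D] dP] Da by blast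
    then obtain D' where D': "\<And>b. D' b \<in> linear_map A (res_mod Q (Suc (b + a))) (?T (Suc a) b)"
      and dD': "\<And>b x. x \<in> carrier (res_mod Q (Suc (b + a))) \<Longrightarrow> ?dP a b (D' b x) = ?R a D b x"
      by (metis module_hom_linear)
    have D'': "D' b \<in> linear_map A (res_mod Q (b + Suc a)) (?T (Suc a) b)" for b using D' by simp
    have "?R (Suc a) D' b x \<in> ?dP (Suc a) b ` carrier (?T (Suc (Suc a)) b)"
      if x: "x \<in> carrier (res_mod Q (Suc (b + Suc a)))" for b x
    proof (rule ex1)
      interpret Tb: abelian_group "?T a b" by (rule Tab)
      show "?R (Suc a) D' b x \<in> carrier (?T (Suc a) b)" using linear_map_closed[OF Rl[of D' "Suc a" b]] D' x by simp
      let ?y = "res_diff Q (Suc (b + a)) x"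
      have y: "?y \<in> carrier (res_mod Q (Suc (b + a)))" using linear_map_closed[OF q(3) x] by simp
      have x': "x \<in> carrier (res_mod Q (Suc (Suc b + a)))" using x by simp
      have dy: "res_diff Q (b + a) ?y = \<zero>\<^bsub>res_mod Q (b + a)\<^esub>" using q(4)[of x "b + a"] x by simp
      have c: "D' b ?y \<in> carrier (?T (Suc a) b)" "D' (Suc b) x \<in> carrier (?T (Suc a) (Suc b))"
        "D (Suc b) ?y \<in> carrier (?T a (Suc b))" "D (Suc (Suc b)) x \<in> carrier (?T a (Suc (Suc b)))"
        using linear_map_closed[OF D' y] linear_map_closed[OF D' x'] linear_map_closed[OF D, of ?y "Suc b"] y
          linear_map_closed[OF D, of x "Suc (Suc b)"] x by simp_all
      note cQ = linear_map_closed[OF dQ]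
      have e1: "?dP a b (D' b ?y) = signed (?T a b) (Suc a) (?dQ a b (D (Suc b) ?y))"
        using dD'[OF y] dy linear_map_zero[OF q(2) TM D] cQ[OF c(3)] by (simp add: signed_closed[OF Tab])
      have "?dP a b (?dQ (Suc a) b (D' (Suc b) x)) = ?dQ a b (?dP a (Suc b) (D' (Suc b) x))"
        by (rule tensor_map_commute[OF PM PM q(2) q(2) Pd q(3) c(2)])
      also have "\<dots> = ?dQ a b (D (Suc b) ?y \<oplus>\<^bsub>?T a (Suc b)\<^esub> signed (?T a (Suc b)) (Suc a) (?dQ a (Suc b) (D (Suc (Suc b)) x)))"
        using dD'[OF x'] by simp
      also have "\<dots> = ?dQ a b (D (Suc b) ?y) \<oplus>\<^bsub>?T a b\<^esub> signed (?T a b) (Suc a) (?dQ a b (?dQ a (Suc b) (D (Suc (Suc b)) x)))"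
        using c cQ[OF c(4)] by (simp add: linear_map_add[OF dQ] signed_closed[OF Tab] linear_map_signed[OF TM TM dQ])
      also have "?dQ a b (?dQ a (Suc b) (D (Suc (Suc b)) x)) = \<zero>\<^bsub>?T a b\<^esub>"
        by (rule tensor_map_zero_comp[OF PM q(2) q(2) q(2) q(3) q(3) q(4) c(4)])
      finally have e2: "?dP a b (?dQ (Suc a) b (D' (Suc b) x)) = ?dQ a b (D (Suc b) ?y)"
        using cQ[OF c(3)] by (simp add: signed_zero[OF Tab])
      have "?dP a b (?R (Suc a) D' b x) = signed (?T a b) (Suc a) (?dQ a b (D (Suc b) ?y)) \<oplus>\<^bsub>?T a b\<^esub>
          signed (?T a b) (Suc (Suc a)) (?dQ a b (D (Suc b) ?y))"
        using c cQ[OF c(2)] by (simp add: linear_map_add[OF dP] signed_closed[OF Tab] linear_map_signed[OF TM TM dP] e1 e2)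
      also have "\<dots> = \<zero>\<^bsub>?T a b\<^esub>" using cQ[OF c(3)] by (simp add: signed_def Tb.r_neg Tb.l_neg)
      finally show "?dP a b (?R (Suc a) D' b x) = \<zero>\<^bsub>?T a b\<^esub>" .
    qed
    then show "\<exists>D'. ?\<Phi> (Suc a) D' \<and>
      (\<forall>b. \<forall>x\<in>carrier (res_mod Q (Suc (b + a))). ?dP a b (D' b x) = ?R a D b x)"
      using D'' dD' by (intro exI[of _ D']) simp
  qed
  then obtain \<Delta> where D: "\<forall>a. ?\<Phi> a (\<Delta> a) \<and>
    (\<forall>b. \<forall>x\<in>carrier (res_mod Q (Suc (b + a))). ?dP a b (\<Delta> (Suc a) b x) = ?R a (\<Delta> a) b x)" ..
  show thesis
  proof (rule that)
    show "\<Delta> a b \<in> linear_map A (res_mod Q (b + a)) (?T a b)" for a b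
      using D[rule_format, of a] by (elim conjE) blast
    show "eval_map (res_mod Q b) (res_aug P) (\<Delta> 0 b x) = x" if "x \<in> carrier (res_mod Q b)" for b x
      using D[rule_format, of 0] that by (elim conjE) blast
    show "?dP a b (\<Delta> (Suc a) b x) = ?R a (\<Delta> a) b x" if "x \<in> carrier (res_mod Q (Suc (b + a)))" for a b x
      using D[rule_format, of a] that by (elim conjE) blast
  qed
qed

lemma null_cochain_eval:
  assumes Q: "projective_complex A Q" and N: "left_module A N"
    and c: "c \<in> chain_lifts A Q n (TP N) e" and b: "null_cochain E P reg i b"
  shows "null_cochain A Q N (n + i) (\<lambda>x. eval_map N b (c i x))"
proof -
  note cl = chain_liftsD(1)[OF c, unfolded tensor_resolution_simps]
  have bl: "b \<in> linear_map E (res_mod P i) reg" by (rule null_cochain_linear[OF P_complex reg_left_module b])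
  show ?thesis
  proof (cases i)
    case 0
    have "eval_map N b (c i x) = \<zero>\<^bsub>N\<^esub>" if "x \<in> carrier (res_mod Q (n + i))" for x
      by (rule eval_map_zero[OF PM N bl _ linear_map_closed[OF cl that]])
         (use b 0 in \<open>simp add: null_cochain_def\<close>)
    then show ?thesis by (intro null_cochain_zero[OF projective_complexD(2)[OF Q] N])
  next
    case (Suc m)
    then obtain g where g: "g \<in> linear_map E (res_mod P m) reg"
      "\<And>x. x \<in> carrier (res_mod P i) \<Longrightarrow> b x = g (res_diff P m x)"
      using b by (auto simp: null_cochain_def)
    have "eval_map N b (c i x) = eval_map N g (c m (res_diff Q (n + m) x))"
      if x: "x \<in> carrier (res_mod Q (n + i))" for x
    proof -
      have "c i x \<in> carrier (T (res_mod P (Suc m)) N)" using linear_map_closed[OF cl x] Suc by simp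
      from eval_map_comp[OF PM PM N Pd g(1) _ _ this, of b]
      have "eval_map N b (c i x) = eval_map N g (tensor_map (res_mod P m) N (res_diff P m) (\<lambda>m. m) (c i x))"
        using bl g(2) Suc by simp
      then show ?thesis
        using chain_liftsD(3)[OF c, of x m] x Suc by (simp add: tensor_resolution_simps)
    qed
    then show ?thesis
      using linear_map_comp[OF cl[of m] eval_map_linear[OF PM N g(1)]] Suc by (auto simp: null_cochain_def)
  qed
qed

lemma eval_lift_cocycle:
  assumes Q: "projective_complex A Q" and N: "left_module A N"
    and c: "c \<in> chain_lifts A Q n (TP N) e" and f: "f \<in> cocycles E P reg i"
  shows "(\<lambda>x. eval_map N f (c i x)) \<in> linear_map A (res_mod Q (n + i)) N"
    and "x \<in> carrier (res_mod Q (Suc (n + i))) \<Longrightarrow> eval_map N f (c i (res_diff Q (n + i) x)) = \<zero>\<^bsub>N\<^esub>"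
proof -
  note cl = chain_liftsD(1)[OF c, unfolded tensor_resolution_simps]
  show "(\<lambda>x. eval_map N f (c i x)) \<in> linear_map A (res_mod Q (n + i)) N"
    by (rule linear_map_comp[OF cl eval_map_linear[OF PM N cocycle_linear[OF f]]])
  show "eval_map N f (c i (res_diff Q (n + i) x)) = \<zero>\<^bsub>N\<^esub>" if x: "x \<in> carrier (res_mod Q (Suc (n + i)))"
    using eval_cocycle[OF N f, of "c (Suc i) x"] linear_map_closed[OF cl[of "Suc i"], of x] x
      chain_liftsD(3)[OF c x] by (simp add: tensor_resolution_simps)
qed

text \<open>
  The products are defined as unions over all representatives, comparison maps and lifts.  Each
  choice gives a composite \<open>Q \<rightarrow> QN \<rightarrow> P \<otimes>\<^sub>A N\<close> lifting a representative of the class of \<open>e\<close>.  Such lifts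
  are homotopic, so every choice gives the class computed from the given lift \<open>c\<close>; and choices exist
  because \<open>QN\<close> and \<open>P \<otimes>\<^sub>A N\<close> are exact.
\<close>

lemma HH_action:
  assumes Q: "projective_complex A Q" and N: "left_module A N" and QN: "projective_resolution A N QN"
    and f: "f \<in> cocycles E P reg i" and e: "e \<in> cocycles A Q N n"
    and c: "c \<in> chain_lifts A Q n (TP N) e"
  shows "yoneda A Q QN N i n (HH_to_Ext k A P N QN i (ext_class E P reg i f)) (ext_class A Q N n e) =
    ext_class A Q N (n + i) (\<lambda>x\<in>carrier (res_mod Q (n + i)). eval_map N f (c i x))"
    (is "?lhs = ext_class _ _ _ _ ?target")
proof -
  note q = projective_complexD[OF Q]
  have QNc: "projective_complex A QN" by (rule projective_resolution_complex[OF N QN])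
  have QNe: "exact_resolution A N QN" by (rule projective_resolution_exact[OF N QN])
  note TNe = TP_exact[OF N]
  let ?r = "\<lambda>h. restrict h (carrier (res_mod Q (n + i)))"
  let ?X = "\<lambda>\<phi> l. ext_class A Q N (n + i) (compose (carrier (res_mod Q (n + i))) \<phi> (l i))"
  let ?H = "HH_to_Ext k A P N QN i (ext_class E P reg i f)"
  have fl: "f \<in> linear_map E (res_mod P i) reg" and el: "e \<in> linear_map A (res_mod Q n) N"
    using cocyclesD(1)[OF f] cocyclesD(1)[OF e] .
  have lin: "?r h \<in> linear_map A (res_mod Q (n + i)) N" if "h \<in> linear_map A (res_mod Q (n + i)) N" for h
    using left_module_hom_restrict[OF q(2) that] by (rule module_hom_linear)
  \<comment> \<open>Independence of all choices.\<close>
  have target: "?X \<phi> l = ext_class A Q N (n + i) ?target"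
    if \<phi>: "\<phi> \<in> ?H" and e': "e' \<in> ext_class A Q N n e" and l: "l \<in> chain_lifts A Q n QN e'" for \<phi> e' l
  proof -
    obtain f' c' where f': "f' \<in> ext_class E P reg i f"
      and c': "c' \<in> chain_lifts A QN 0 (TP N) (res_aug QN)"
      and \<phi>': "\<phi> \<in> ext_class A QN N i (compose (carrier (res_mod QN i)) (eval_map N f') (c' i))"
      using \<phi> by (auto simp: HH_to_Ext_def eval_map_def)
    have f'l: "f' \<in> linear_map E (res_mod P i) reg" and f'f: "cohomologous E P reg i f' f"
      using f' by (auto simp: ext_class_eq[OF P_complex reg_left_module fl] module_hom_linear)
    have e'e: "cohomologous A Q N n e' e"
      using e' by (auto simp: ext_class_eq[OF Q N el])
    note ll = chain_liftsD(1)[OF l] and c'l = chain_liftsD(1)[OF c', simplified]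
    note evl' = eval_map_linear[OF PM N f'l] and evl = eval_map_linear[OF PM N fl]
    have cc: "(\<lambda>a. restrict (\<lambda>x. c' a (l a x)) (carrier (res_mod Q (n + a)))) \<in> chain_lifts A Q n (TP N) e'"
    proof (rule chain_lifts_restrictI[OF q(2) q(3)])
      show "(\<lambda>x. c' a (l a x)) \<in> linear_map A (res_mod Q (n + a)) (res_mod (TP N) a)" for a
        by (rule linear_map_comp[OF ll c'l])
      show "res_aug (TP N) (c' 0 (l 0 x)) = e' x" if "x \<in> carrier (res_mod Q n)" for x
        using that chain_liftsD(2)[OF c'] chain_liftsD(2)[OF l] linear_map_closed[OF ll[of 0]] by simp
      show "res_diff (TP N) a (c' (Suc a) (l (Suc a) x)) = c' a (l a (res_diff Q (n + a) x))"
        if "x \<in> carrier (res_mod Q (Suc (n + a)))" for a x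
        using that chain_liftsD(3)[OF c', of "l (Suc a) x" a] chain_liftsD(3)[OF l] linear_map_closed[OF ll[of "Suc a"]] by simp
    qed
    have c'c: "c' i (l i x) \<in> carrier (T (res_mod P i) N)" if "x \<in> carrier (res_mod Q (n + i))" for x
      using linear_map_closed[OF c'l linear_map_closed[OF ll that]] by (simp add: tensor_resolution_simps)
    have "compose (carrier (res_mod QN i)) (eval_map N f') (c' i) \<in> linear_map A (res_mod QN i) N"
      unfolding compose_def
      using linear_map_comp[OF c'l[of i, unfolded tensor_resolution_simps] evl']
      by (rule module_hom_linear[OF left_module_hom_restrict[OF projective_complexD(2)[OF QNc]]])
    from \<phi>'[unfolded ext_class_eq[OF QNc N this]]
    obtain b where \<phi>l: "\<phi> \<in> linear_map A (res_mod QN i) N" and b: "null_cochain A QN N i b"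
      "\<And>x. x \<in> carrier (res_mod QN i) \<Longrightarrow> \<phi> x = b x \<oplus>\<^bsub>N\<^esub> eval_map N f' (c' i x)"
      by (auto simp: cohomologous_def module_hom_linear compose_def)
    have coh1: "cohomologous A Q N (n + i) (compose (carrier (res_mod Q (n + i))) \<phi> (l i)) (\<lambda>x. eval_map N f' (c' i (l i x)))"
      using null_cochain_pullback[OF Q QNc N l b(1)] b(2) linear_map_closed[OF ll[of i]]
      unfolding cohomologous_def compose_def by (intro exI[of _ "\<lambda>x. b (l i x)"]) auto
    obtain h where h: "null_cochain E P reg i h" "\<And>x. x \<in> carrier (res_mod P i) \<Longrightarrow> f' x = h x \<oplus>\<^bsub>A\<^esub> f x"
      using f'f unfolding cohomologous_def by auto
    have hl: "h \<in> linear_map E (res_mod P i) reg" by (rule null_cochain_linear[OF P_complex reg_left_module h(1)])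
    have coh2: "cohomologous A Q N (n + i) (\<lambda>x. eval_map N f' (c' i (l i x))) (\<lambda>x. eval_map N f (c' i (l i x)))"
      unfolding cohomologous_def
    proof (intro exI conjI ballI)
      show "null_cochain A Q N (n + i) (\<lambda>x. eval_map N h (restrict (\<lambda>x. c' i (l i x)) (carrier (res_mod Q (n + i))) x))"
        using null_cochain_eval[OF Q N cc h(1)] .
      show "eval_map N f' (c' i (l i x)) = eval_map N h (restrict (\<lambda>x. c' i (l i x)) (carrier (res_mod Q (n + i))) x) \<oplus>\<^bsub>N\<^esub>
          eval_map N f (c' i (l i x))" if "x \<in> carrier (res_mod Q (n + i))" for x
        using eval_map_add[OF PM N f'l hl fl h(2) c'c[OF that]] that by simp
    qed
    have coh3: "cohomologous A Q N (n + i) (\<lambda>x. eval_map N f (restrict (\<lambda>x. c' i (l i x)) (carrier (res_mod Q (n + i))) x))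
        (\<lambda>x. eval_map N f (c i x))"
    proof (rule chain_lifts_cohomologous[OF Q TNe N cc c e'e el])
      show "eval_map N f \<in> linear_map A (res_mod (TP N) i) N" using evl by (simp add: tensor_resolution_simps)
      show "eval_map N f (res_diff (TP N) i y) = \<zero>\<^bsub>N\<^esub>" if "y \<in> carrier (res_mod (TP N) (Suc i))" for y
        using eval_cocycle[OF N f] that by (simp add: tensor_resolution_simps)
    qed
    have coh4: "cohomologous A Q N (n + i) (\<lambda>x. eval_map N f (c' i (l i x))) ?target"
      using coh3 unfolding cohomologous_def by auto
    have tl: "?target \<in> linear_map A (res_mod Q (n + i)) N" by (rule lin[OF eval_lift_cocycle(1)[OF Q N c f]])
    note tc = linear_map_closed[OF tl]
    have "cohomologous A Q N (n + i) (compose (carrier (res_mod Q (n + i))) \<phi> (l i)) ?target"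
      by (rule cohomologous_trans[OF Q N coh1 cohomologous_trans[OF Q N coh2 coh4 tc] tc])
    then show ?thesis
      by (rule ext_class_cong[OF Q N _ tl, rotated])
         (use lin[OF linear_map_comp[OF ll \<phi>l]] in \<open>simp add: compose_def\<close>)
  qed
  \<comment> \<open>Existence of choices.\<close>
  have self: "f \<in> ext_class E P reg i f" "e \<in> ext_class A Q N n e"
    using f e cohomologous_refl[OF P_complex reg_left_module, of i f f] cohomologous_refl[OF Q N, of n e e]
      linear_map_closed[OF fl] linear_map_closed[OF el]
    by (auto simp: ext_class_eq[OF P_complex reg_left_module fl] ext_class_eq[OF Q N el] cocycles_def)
  obtain c' where c': "c' \<in> chain_lifts A QN 0 (TP N) (res_aug QN)"
    using chain_lift_exists[OF QNc TNe exact_resolutionD(4)[OF QNe] exact_resolutionD(6)[OF QNe]] by blast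
  let ?\<phi> = "compose (carrier (res_mod QN i)) (eval_map N f) (c' i)"
  have \<phi>h: "?\<phi> \<in> module_hom A (res_mod QN i) N"
    unfolding compose_def
    using linear_map_comp[OF chain_liftsD(1)[OF c', of i, unfolded tensor_resolution_simps, simplified] eval_map_linear[OF PM N fl]]
    by (intro left_module_hom_restrict projective_complexD(2)[OF QNc])
  have "?\<phi> \<in> ext_class A QN N i ?\<phi>"
    using \<phi>h cohomologous_refl[OF QNc N, of i ?\<phi> ?\<phi>] linear_map_closed[OF module_hom_linear[OF \<phi>h]]
    by (simp add: ext_class_eq[OF QNc N module_hom_linear[OF \<phi>h]])
  then have \<phi>H: "?\<phi> \<in> ?H"
    using self(1) c' by (auto simp: HH_to_Ext_def simp flip: eval_map_def)
  obtain l where l: "l \<in> chain_lifts A Q n QN e"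
    using chain_lift_exists[OF Q QNe el cocyclesD(3)[OF e]] by blast
  have "?lhs = (\<Union>\<phi>\<in>?H. \<Union>e'\<in>ext_class A Q N n e. \<Union>l\<in>chain_lifts A Q n QN e'. ?X \<phi> l)"
    by (simp add: yoneda_def)
  also have "\<dots> = ext_class A Q N (n + i) ?target"
  proof (intro Set.equalityI subsetI)
    fix z assume "z \<in> (\<Union>\<phi>\<in>?H. \<Union>e'\<in>ext_class A Q N n e. \<Union>l\<in>chain_lifts A Q n QN e'. ?X \<phi> l)"
    then show "z \<in> ext_class A Q N (n + i) ?target"
      by (elim UN_E) (simp only: target)
  next
    fix z assume z: "z \<in> ext_class A Q N (n + i) ?target"
    show "z \<in> (\<Union>\<phi>\<in>?H. \<Union>e'\<in>ext_class A Q N n e. \<Union>l\<in>chain_lifts A Q n QN e'. ?X \<phi> l)"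
      by (rule UN_I[OF \<phi>H], rule UN_I[OF self(2)], rule UN_I[OF l]) (simp only: target[OF \<phi>H self(2) l] z)
  qed
  finally show ?thesis .
qed

text \<open>
  A cocycle \<open>f\<close> of degree \<open>i\<close> acts through maps \<open>g\<^sub>b : Q\<^bsub>b+i\<^esub> \<rightarrow> Q\<^sub>b\<close>, namely \<open>(f \<otimes> 1) \<circ> \<Delta>\<^bsub>i,b\<^esub>\<close>; they commute
  with the differentials up to the sign \<open>(-1)\<^sup>i\<close>.
\<close>

lemma cocycle_chain_map:
  assumes Q: "projective_complex A Q" and N: "left_module A N" and f: "f \<in> cocycles E P reg i"
  obtains g where "\<And>b. g b \<in> linear_map A (res_mod Q (b + i)) (res_mod Q b)"
    "\<And>b x. x \<in> carrier (res_mod Q (Suc (b + i))) \<Longrightarrow>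
      g b (res_diff Q (b + i) x) = signed (res_mod Q b) i (res_diff Q b (g (Suc b) x))"
    "\<And>n e. e \<in> cocycles A Q N n \<Longrightarrow> \<exists>c\<in>chain_lifts A Q n (TP N) e.
      \<forall>x\<in>carrier (res_mod Q (n + i)). eval_map N f (c i x) = e (g n x)"
proof -
  note q = projective_complexD[OF Q]
  note TM = T_left_module[OF PM q(2)] and Tab = T_abelian_group[OF PM q(2)]
  obtain \<Delta> where \<Delta>: "\<And>a b. \<Delta> a b \<in> linear_map A (res_mod Q (b + a)) (T (res_mod P a) (res_mod Q b))"
    and \<epsilon>\<Delta>: "\<And>b x. x \<in> carrier (res_mod Q b) \<Longrightarrow> eval_map (res_mod Q b) (res_aug P) (\<Delta> 0 b x) = x"
    and d\<Delta>: "\<And>a b x. x \<in> carrier (res_mod Q (Suc (b + a))) \<Longrightarrow>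
      tensor_map (res_mod P a) (res_mod Q b) (res_diff P a) (\<lambda>m. m) (\<Delta> (Suc a) b x) =
      \<Delta> a b (res_diff Q (b + a) x) \<oplus>\<^bsub>T (res_mod P a) (res_mod Q b)\<^esub>
      signed (T (res_mod P a) (res_mod Q b)) (Suc a)
        (tensor_map (res_mod P a) (res_mod Q b) (\<lambda>x. x) (res_diff Q b) (\<Delta> a (Suc b) x))"
    using double_complex[OF Q] by blast
  have \<Delta>Suc: "\<Delta> (Suc a) b x \<in> carrier (T (res_mod P (Suc a)) (res_mod Q b))"
    "\<Delta> a (Suc b) x \<in> carrier (T (res_mod P a) (res_mod Q (Suc b)))"
    "\<Delta> a b (res_diff Q (b + a) x) \<in> carrier (T (res_mod P a) (res_mod Q b))"
    if "x \<in> carrier (res_mod Q (Suc (b + a)))" for a b x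
    using linear_map_closed[OF \<Delta>[of "Suc a" b]] linear_map_closed[OF \<Delta>[of a "Suc b"]]
      linear_map_closed[OF \<Delta>[of a b] linear_map_closed[OF q(3)]] that by simp_all
  have dQ: "tensor_map (res_mod P a) (res_mod Q b) (\<lambda>x. x) (res_diff Q b) \<in>
      linear_map A (T (res_mod P a) (res_mod Q (Suc b))) (T (res_mod P a) (res_mod Q b))" for a b
    by (rule tensor_map_linear[OF PM PM q(2) q(2) linear_map_id q(3)])
  note fl = cocycle_linear[OF f]
  note evl = eval_map_linear[OF PM q(2) fl]
  define g where "g b x = eval_map (res_mod Q b) f (\<Delta> i b x)" for b x
  show thesis
  proof (rule that)
    show "g b \<in> linear_map A (res_mod Q (b + i)) (res_mod Q b)" for b
      unfolding g_def[abs_def] by (rule linear_map_comp[OF \<Delta> evl])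
  next
    fix b x assume x: "x \<in> carrier (res_mod Q (Suc (b + i)))"
    note c = \<Delta>Suc[OF x]
    note ab = left_module_abelian_group[OF q(2)]
    have "\<zero>\<^bsub>res_mod Q b\<^esub> = eval_map (res_mod Q b) f
        (tensor_map (res_mod P i) (res_mod Q b) (res_diff P i) (\<lambda>m. m) (\<Delta> (Suc i) b x))"
      using eval_cocycle[OF q(2) f c(1)] by simp
    also have "\<dots> = eval_map (res_mod Q b) f (\<Delta> i b (res_diff Q (b + i) x)) \<oplus>\<^bsub>res_mod Q b\<^esub>
       signed (res_mod Q b) (Suc i) (eval_map (res_mod Q b) f
         (tensor_map (res_mod P i) (res_mod Q b) (\<lambda>x. x) (res_diff Q b) (\<Delta> i (Suc b) x)))"
      using c linear_map_closed[OF dQ c(2)]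
      by (simp add: d\<Delta>[OF x] linear_map_add[OF evl] signed_closed[OF Tab] linear_map_signed[OF TM q(2) evl])
    also have "eval_map (res_mod Q b) f
         (tensor_map (res_mod P i) (res_mod Q b) (\<lambda>x. x) (res_diff Q b) (\<Delta> i (Suc b) x)) = res_diff Q b (g (Suc b) x)"
      using eval_map_natural[OF PM q(2) q(2) fl q(3) c(2)] by (simp add: g_def)
    finally have "g b (res_diff Q (b + i) x) \<oplus>\<^bsub>res_mod Q b\<^esub>
        signed (res_mod Q b) (Suc i) (res_diff Q b (g (Suc b) x)) = \<zero>\<^bsub>res_mod Q b\<^esub>"
      by (simp add: g_def)
    then show "g b (res_diff Q (b + i) x) = signed (res_mod Q b) i (res_diff Q b (g (Suc b) x))"
      using linear_map_closed[OF evl c(3)] linear_map_closed[OF q(3) linear_map_closed[OF evl c(2)]]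
      by (intro signed_cancel[OF ab]) (simp_all add: g_def)
  next
    fix n e assume e: "e \<in> cocycles A Q N n"
    note el = cocyclesD(1)[OF e]
    let ?t = "\<lambda>a. tensor_map (res_mod P a) N (\<lambda>x. x) e"
    have tl: "?t a \<in> linear_map A (T (res_mod P a) (res_mod Q n)) (T (res_mod P a) N)" for a
      by (rule tensor_map_linear[OF PM PM q(2) N linear_map_id el])
    let ?c = "\<lambda>a. restrict (\<lambda>x. ?t a (\<Delta> a n x)) (carrier (res_mod Q (n + a)))"
    have lift: "?c \<in> chain_lifts A Q n (TP N) e"
    proof (rule chain_lifts_restrictI[OF q(2) q(3)], unfold tensor_resolution_simps)
      show "(\<lambda>x. ?t a (\<Delta> a n x)) \<in> linear_map A (res_mod Q (n + a)) (T (res_mod P a) N)" for a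
        by (rule linear_map_comp[OF \<Delta> tl])
      show "eval_map N (res_aug P) (?t 0 (\<Delta> 0 n x)) = e x" if "x \<in> carrier (res_mod Q n)" for x
        using eval_map_natural[OF PM q(2) N P\<epsilon> el, of "\<Delta> 0 n x"] linear_map_closed[OF \<Delta>[of 0 n]] that
        by (simp add: \<epsilon>\<Delta>)
      fix a x assume x: "x \<in> carrier (res_mod Q (Suc (n + a)))"
      note c = \<Delta>Suc[OF x]
      have "tensor_map (res_mod P a) N (res_diff P a) (\<lambda>m. m) (?t (Suc a) (\<Delta> (Suc a) n x)) =
          ?t a (tensor_map (res_mod P a) (res_mod Q n) (res_diff P a) (\<lambda>m. m) (\<Delta> (Suc a) n x))"
        by (rule tensor_map_commute[OF PM PM q(2) N Pd el c(1)])
      also have "\<dots> = ?t a (\<Delta> a n (res_diff Q (n + a) x)) \<oplus>\<^bsub>T (res_mod P a) N\<^esub>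
          signed (T (res_mod P a) N) (Suc a)
            (?t a (tensor_map (res_mod P a) (res_mod Q n) (\<lambda>x. x) (res_diff Q n) (\<Delta> a (Suc n) x)))"
        using c linear_map_closed[OF dQ c(2)]
        by (simp add: d\<Delta>[OF x] linear_map_add[OF tl] signed_closed[OF Tab] linear_map_signed[OF TM T_left_module[OF PM N] tl])
      also have "?t a (tensor_map (res_mod P a) (res_mod Q n) (\<lambda>x. x) (res_diff Q n) (\<Delta> a (Suc n) x)) = \<zero>\<^bsub>T (res_mod P a) N\<^esub>"
        by (rule tensor_map_zero_comp[OF PM q(2) q(2) N q(3) el cocyclesD(3)[OF e] c(2)])
      finally show "tensor_map (res_mod P a) N (res_diff P a) (\<lambda>m. m) (?t (Suc a) (\<Delta> (Suc a) n x)) =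
          ?t a (\<Delta> a n (res_diff Q (n + a) x))"
        using linear_map_closed[OF tl c(3)] abelian_monoid.r_zero[OF abelian_group.axioms(1)[OF T_abelian_group[OF PM N]]]
        by (simp add: signed_zero[OF T_abelian_group[OF PM N]])
    qed
    have val: "eval_map N f (?c i x) = e (g n x)" if "x \<in> carrier (res_mod Q (n + i))" for x
      using that eval_map_natural[OF PM q(2) N fl el linear_map_closed[OF \<Delta> that]] by (simp add: g_def)
    show "\<exists>c\<in>chain_lifts A Q n (TP N) e.
        \<forall>x\<in>carrier (res_mod Q (n + i)). eval_map N f (c i x) = e (g n x)"
      by (rule bexI[OF _ lift]) (rule ballI, rule val)
  qed
qed

definition act where
  "act Q QN N i \<zeta> n \<eta> = yoneda A Q QN N i n (HH_to_Ext k A P N QN i \<zeta>) \<eta>"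

lemma act_by_chain_map:
  assumes Q: "projective_complex A Q" and N: "left_module A N" and QN: "projective_resolution A N QN"
    and \<zeta>: "\<zeta> \<in> carrier (HH k A P i)"
  obtains g where "\<And>b. g b \<in> linear_map A (res_mod Q (b + i)) (res_mod Q b)"
    "\<And>b x. x \<in> carrier (res_mod Q (Suc (b + i))) \<Longrightarrow>
      g b (res_diff Q (b + i) x) = signed (res_mod Q b) i (res_diff Q b (g (Suc b) x))"
    "\<And>n e. e \<in> cocycles A Q N n \<Longrightarrow> act Q QN N i \<zeta> n (ext_class A Q N n e) =
      ext_class A Q N (n + i) (\<lambda>x\<in>carrier (res_mod Q (n + i)). e (g n x))"
    "\<And>n e. e \<in> cocycles A Q N n \<Longrightarrow>
      (\<lambda>x\<in>carrier (res_mod Q (n + i)). e (g n x)) \<in> cocycles A Q N (n + i)"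
proof -
  obtain f where f: "f \<in> cocycles E P reg i" "\<zeta> = ext_class E P reg i f"
    using \<zeta> by (auto simp: HH_def carrier_Ext)
  obtain g where g: "\<And>b. g b \<in> linear_map A (res_mod Q (b + i)) (res_mod Q b)"
    "\<And>b x. x \<in> carrier (res_mod Q (Suc (b + i))) \<Longrightarrow>
      g b (res_diff Q (b + i) x) = signed (res_mod Q b) i (res_diff Q b (g (Suc b) x))"
    "\<And>n e. e \<in> cocycles A Q N n \<Longrightarrow> \<exists>c\<in>chain_lifts A Q n (TP N) e.
      \<forall>x\<in>carrier (res_mod Q (n + i)). eval_map N f (c i x) = e (g n x)"
    by (rule cocycle_chain_map[OF Q N f(1)]) blast
  let ?g = "\<lambda>n e. \<lambda>x\<in>carrier (res_mod Q (n + i)). e (g n x)"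
  have "act Q QN N i \<zeta> n (ext_class A Q N n e) = ext_class A Q N (n + i) (?g n e) \<and>
      ?g n e \<in> cocycles A Q N (n + i)" if e: "e \<in> cocycles A Q N n" for e n
  proof -
    obtain c where c: "c \<in> chain_lifts A Q n (TP N) e"
      "\<And>x. x \<in> carrier (res_mod Q (n + i)) \<Longrightarrow> eval_map N f (c i x) = e (g n x)"
      using g(3)[OF e] by blast
    have eq: "?g n e = (\<lambda>x\<in>carrier (res_mod Q (n + i)). eval_map N f (c i x))"
      by (rule restrict_ext) (simp add: c(2))
    show ?thesis
      unfolding act_def f(2) eq
      by (intro conjI HH_action[OF Q N QN f(1) e c(1)] cocycles_restrictI[OF Q eval_lift_cocycle[OF Q N c(1) f(1)]])
  qed
  then show thesis using that[OF g(1,2)] by blast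
qed

lemma act_hom:
  assumes Q: "projective_complex A Q" and N: "left_module A N" and QN: "projective_resolution A N QN"
    and \<zeta>: "\<zeta> \<in> carrier (HH k A P i)"
  shows "act Q QN N i \<zeta> n \<in> hom (Ext A Q N n) (Ext A Q N (n + i))"
proof -
  obtain g where g: "\<And>b. g b \<in> linear_map A (res_mod Q (b + i)) (res_mod Q b)"
    and act: "\<And>n e. e \<in> cocycles A Q N n \<Longrightarrow> act Q QN N i \<zeta> n (ext_class A Q N n e) =
      ext_class A Q N (n + i) (\<lambda>x\<in>carrier (res_mod Q (n + i)). e (g n x))"
    and coc: "\<And>n e. e \<in> cocycles A Q N n \<Longrightarrow>
      (\<lambda>x\<in>carrier (res_mod Q (n + i)). e (g n x)) \<in> cocycles A Q N (n + i)"
    by (rule act_by_chain_map[OF Q N QN \<zeta>]) blast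
  let ?g = "\<lambda>e. \<lambda>x\<in>carrier (res_mod Q (n + i)). e (g n x)"
  show ?thesis
  proof (rule homI)
    fix y assume "y \<in> carrier (Ext A Q N n)"
    then obtain e where e: "e \<in> cocycles A Q N n" "y = ext_class A Q N n e" by (auto simp: carrier_Ext)
    then show "act Q QN N i \<zeta> n y \<in> carrier (Ext A Q N (n + i))" using coc by (auto simp: act carrier_Ext)
    fix y' assume "y' \<in> carrier (Ext A Q N n)"
    then obtain e' where e': "e' \<in> cocycles A Q N n" "y' = ext_class A Q N n e'" by (auto simp: carrier_Ext)
    have s: "(\<lambda>x\<in>carrier (res_mod Q n). e x \<oplus>\<^bsub>N\<^esub> e' x) \<in> cocycles A Q N n"
      using comm_group.axioms(1)[OF cocycle_comm_group[OF Q N], THEN comm_monoid.axioms(1), THEN monoid.m_closed, of e n e'] e e'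
      by (simp add: cocycle_group_simps)
    have "act Q QN N i \<zeta> n (y \<otimes>\<^bsub>Ext A Q N n\<^esub> y') =
        ext_class A Q N (n + i) (?g (\<lambda>x\<in>carrier (res_mod Q n). e x \<oplus>\<^bsub>N\<^esub> e' x))"
      using e e' by (simp add: ext_class_mult[OF Q N] act[OF s])
    also have "?g (\<lambda>x\<in>carrier (res_mod Q n). e x \<oplus>\<^bsub>N\<^esub> e' x) = (\<lambda>x\<in>carrier (res_mod Q (n + i)). ?g e x \<oplus>\<^bsub>N\<^esub> ?g e' x)"
      by (rule restrict_ext) (use linear_map_closed[OF g] in auto)
    also have "ext_class A Q N (n + i) \<dots> = act Q QN N i \<zeta> n y \<otimes>\<^bsub>Ext A Q N (n + i)\<^esub> act Q QN N i \<zeta> n y'"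
      using e e' coc by (simp add: act ext_class_mult[OF Q N])
    finally show "act Q QN N i \<zeta> n (y \<otimes>\<^bsub>Ext A Q N n\<^esub> y') =
        act Q QN N i \<zeta> n y \<otimes>\<^bsub>Ext A Q N (n + i)\<^esub> act Q QN N i \<zeta> n y'" .
  qed
qed

text \<open>
  If \<open>\<zeta>\<close> acts through \<open>g\<close> and \<open>c\<close> lifts \<open>e\<close>, then the maps \<open>(-1)\<^bsup>ia\<^esup> c\<^sub>a \<circ> g\<^bsub>n+a\<^esub>\<close> form a lift of \<open>e \<circ> g\<^sub>n\<close>, the
  signs making up for \<open>g\<close> being a chain map only up to \<open>(-1)\<^sup>i\<close>.  Evaluating it at a cocycle of degree \<open>j\<close>
  that represents \<open>\<xi>\<close> gives both orders of the two actions, with the sign \<open>(-1)\<^bsup>ij\<^esup>\<close>.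
\<close>

lemma act_commute:
  assumes Q: "projective_complex A Q" and N: "left_module A N" and QN: "projective_resolution A N QN"
    and \<zeta>: "\<zeta> \<in> carrier (HH k A P i)" and \<xi>: "\<xi> \<in> carrier (HH k A P j)"
    and y: "y \<in> carrier (Ext A Q N n)"
  shows "act Q QN N j \<xi> (n + i) (act Q QN N i \<zeta> n y) = act Q QN N i \<zeta> (n + j) (act Q QN N j \<xi> n y) \<or>
    act Q QN N j \<xi> (n + i) (act Q QN N i \<zeta> n y) =
      inv\<^bsub>Ext A Q N (n + i + j)\<^esub> act Q QN N i \<zeta> (n + j) (act Q QN N j \<xi> n y)"
proof -
  note q = projective_complexD[OF Q]
  obtain g where g: "\<And>b. g b \<in> linear_map A (res_mod Q (b + i)) (res_mod Q b)"
    and dg: "\<And>b x. x \<in> carrier (res_mod Q (Suc (b + i))) \<Longrightarrow>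
      g b (res_diff Q (b + i) x) = signed (res_mod Q b) i (res_diff Q b (g (Suc b) x))"
    and act_g: "\<And>n e. e \<in> cocycles A Q N n \<Longrightarrow> act Q QN N i \<zeta> n (ext_class A Q N n e) =
      ext_class A Q N (n + i) (\<lambda>x\<in>carrier (res_mod Q (n + i)). e (g n x))"
      "\<And>n e. e \<in> cocycles A Q N n \<Longrightarrow>
      (\<lambda>x\<in>carrier (res_mod Q (n + i)). e (g n x)) \<in> cocycles A Q N (n + i)"
    by (rule act_by_chain_map[OF Q N QN \<zeta>]) blast
  obtain f' where f': "f' \<in> cocycles E P reg j" "\<xi> = ext_class E P reg j f'"
    using \<xi> by (auto simp: HH_def carrier_Ext)
  obtain e where e: "e \<in> cocycles A Q N n" "y = ext_class A Q N n e" using y by (auto simp: carrier_Ext)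
  obtain c where c: "c \<in> chain_lifts A Q n (TP N) e"
    using chain_lift_exists[OF Q TP_exact[OF N] cocyclesD(1)[OF e(1)] cocyclesD(3)[OF e(1)]] by blast
  note cl = chain_liftsD(1)[OF c] and cd = chain_liftsD(3)[OF c]
  note TNM = exact_resolutionD(2)[OF TP_exact[OF N]] and TNd = exact_resolutionD(3)[OF TP_exact[OF N]]
  \<comment> \<open>The cocycle that represents the action of \<open>\<xi>\<close> on \<open>y\<close>.\<close>
  let ?h = "\<lambda>x\<in>carrier (res_mod Q (n + j)). eval_map N f' (c j x)"
  have h: "?h \<in> cocycles A Q N (n + j)"
    by (rule cocycles_restrictI[OF Q eval_lift_cocycle[OF Q N c f'(1)]])
  have act_y: "act Q QN N j \<xi> n y = ext_class A Q N (n + j) ?h"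
    unfolding act_def f'(2) e(2) by (rule HH_action[OF Q N QN f'(1) e(1) c])
  have idx: "n + i + a = n + a + i" for a by simp
  let ?c = "\<lambda>a x. signed (res_mod (TP N) a) (i * a) (c a (g (n + a) x))"
  have gcl: "g (n + a) x \<in> carrier (res_mod Q (n + a))" if "x \<in> carrier (res_mod Q (n + i + a))" for a x
    using linear_map_closed[OF g[of "n + a"]] that by (simp add: idx)
  have glin: "g (n + a) \<in> linear_map A (res_mod Q (n + i + a)) (res_mod Q (n + a))" for a
    using g[of "n + a"] by (simp add: idx)
  have c': "(\<lambda>a. restrict (?c a) (carrier (res_mod Q (n + i + a)))) \<in>
      chain_lifts A Q (n + i) (TP N) (\<lambda>x\<in>carrier (res_mod Q (n + i)). e (g n x))"
  proof (rule chain_lifts_restrictI[OF q(2) q(3)])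
    show "?c a \<in> linear_map A (res_mod Q (n + i + a)) (res_mod (TP N) a)" for a
      by (rule signed_linear[OF q(2) TNM linear_map_comp[OF glin cl]])
    show "res_aug (TP N) (?c 0 x) = (\<lambda>x\<in>carrier (res_mod Q (n + i)). e (g n x)) x" if "x \<in> carrier (res_mod Q (n + i))" for x
      using that gcl[of x 0] chain_liftsD(2)[OF c, of "g n x"] by (simp add: signed_even)
    fix a x assume x: "x \<in> carrier (res_mod Q (Suc (n + i + a)))"
    have gx: "g (Suc (n + a)) x \<in> carrier (res_mod Q (Suc (n + a)))" using gcl[of x "Suc a"] x by simp
    have dgx: "res_diff Q (n + a) (g (Suc (n + a)) x) \<in> carrier (res_mod Q (n + a))" by (rule linear_map_closed[OF q(3) gx])
    have cgx: "c (Suc a) (g (Suc (n + a)) x) \<in> carrier (res_mod (TP N) (Suc a))" using linear_map_closed[OF cl[of "Suc a"]] gx by simp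
    have "res_diff (TP N) a (?c (Suc a) x) = signed (res_mod (TP N) a) (i * Suc a) (res_diff (TP N) a (c (Suc a) (g (Suc (n + a)) x)))"
      using cgx by (simp add: linear_map_signed[OF TNM TNM TNd])
    also have "res_diff (TP N) a (c (Suc a) (g (Suc (n + a)) x)) = c a (res_diff Q (n + a) (g (Suc (n + a)) x))"
      by (rule cd[OF gx])
    also have "signed (res_mod (TP N) a) (i * Suc a) (c a (res_diff Q (n + a) (g (Suc (n + a)) x))) =
        signed (res_mod (TP N) a) (i * a) (c a (signed (res_mod Q (n + a)) i (res_diff Q (n + a) (g (Suc (n + a)) x))))"
      using linear_map_closed[OF cl dgx]
      by (simp add: linear_map_signed[OF q(2) TNM cl dgx] signed_signed[OF left_module_abelian_group[OF TNM]] add.commute[of "i * a" i])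
    also have "signed (res_mod Q (n + a)) i (res_diff Q (n + a) (g (Suc (n + a)) x)) = g (n + a) (res_diff Q (n + i + a) x)"
      using dg[of x "n + a"] x by (simp add: idx)
    finally show "res_diff (TP N) a (?c (Suc a) x) = ?c a (res_diff Q (n + i + a) x)" .
  qed
  let ?k = "\<lambda>x\<in>carrier (res_mod Q (n + i + j)). ?h (g (n + j) x)"
  have k: "?k \<in> cocycles A Q N (n + i + j)" and act_k: "act Q QN N i \<zeta> (n + j) (act Q QN N j \<xi> n y) = ext_class A Q N (n + i + j) ?k"
    using act_g[OF h] by (simp_all add: act_y idx)
  have "act Q QN N j \<xi> (n + i) (act Q QN N i \<zeta> n y) =
    ext_class A Q N (n + i + j) (\<lambda>x\<in>carrier (res_mod Q (n + i + j)). eval_map N f' (restrict (?c j) (carrier (res_mod Q (n + i + j))) x))"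
    unfolding e(2) act_g(1)[OF e(1)]
    unfolding act_def f'(2) by (rule HH_action[OF Q N QN f'(1) act_g(2)[OF e(1)] c'])
  also have "(\<lambda>x\<in>carrier (res_mod Q (n + i + j)). eval_map N f' (restrict (?c j) (carrier (res_mod Q (n + i + j))) x)) =
    (\<lambda>x\<in>carrier (res_mod Q (n + i + j)). signed N (i * j) (?k x))"
  proof (rule restrict_ext)
    fix x assume x: "x \<in> carrier (res_mod Q (n + i + j))"
    show "eval_map N f' (restrict (?c j) (carrier (res_mod Q (n + i + j))) x) = signed N (i * j) (?k x)"
      using x gcl[OF x] linear_map_closed[OF cl gcl[OF x]]
        linear_map_signed[OF T_left_module[OF PM N] N eval_map_linear[OF PM N cocycle_linear[OF f'(1)]]]
      by (simp add: tensor_resolution_simps)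
  qed
  finally have main: "act Q QN N j \<xi> (n + i) (act Q QN N i \<zeta> n y) =
    ext_class A Q N (n + i + j) (\<lambda>x\<in>carrier (res_mod Q (n + i + j)). signed N (i * j) (?k x))" .
  show ?thesis
  proof (cases "even (i * j)")
    case True
    have "(\<lambda>x\<in>carrier (res_mod Q (n + i + j)). ?k x) = ?k" by (rule restrict_ext) simp
    then show ?thesis using main act_k by (simp add: signed_even[OF True] del: restrict_apply)
  next
    case False
    then have "(\<lambda>x\<in>carrier (res_mod Q (n + i + j)). signed N (i * j) (?k x)) =
        (\<lambda>x\<in>carrier (res_mod Q (n + i + j)). \<ominus>\<^bsub>N\<^esub> ?k x)" by (simp add: signed_def)
    then show ?thesis using main act_k ext_class_inv[OF Q N k] by simp
  qed
qed

end

section \<open>Noetherian graded groups with commuting operators\<close>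

lemma (in comm_group) finprod_in_subgroup:
  assumes H: "subgroup H G" and f: "\<And>i. i \<in> J \<Longrightarrow> f i \<in> H"
  shows "finprod G f J \<in> H"
proof -
  interpret H: subgroup H G by fact
  show ?thesis
    using f
  proof (induction J rule: infinite_finite_induct)
    case (insert j J)
    then show ?case by (subst finprod_insert) auto
  qed auto
qed

lemma submodule_span_least: "submodule H R M \<Longrightarrow> S \<subseteq> H \<Longrightarrow> submodule_span R M S \<subseteq> H"
  by (auto simp: submodule_span_def)

text \<open>
  The shape of \<^const>\<open>Ext_from\<close> for arbitrary graded groups and operators: \<open>act i \<zeta> n\<close> is the action of
  \<open>\<zeta>\<close>, of degree \<open>i\<close>, on elements of degree \<open>n\<close>.
\<close>

definition graded_module ::
    "nat set \<Rightarrow> (nat \<Rightarrow> ('g, 'b) monoid_scheme) \<Rightarrow> (nat \<Rightarrow> 's \<Rightarrow> nat \<Rightarrow> 'g \<Rightarrow> 'g) \<Rightarrow> (nat \<Rightarrow> 's, nat \<Rightarrow> 'g) module" where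
  "graded_module I G act =
    (let S = sum_group I G in
     \<lparr>carrier = carrier S, monoid.mult = undefined, one = undefined,
      ring.zero = \<one>\<^bsub>S\<^esub>, ring.add = monoid.mult S,
      module.smult = (\<lambda>\<zeta> \<eta>. \<lambda>n\<in>I. finprod (G n) (\<lambda>i. act i (\<zeta> i) (n - i) (\<eta> (n - i))) {i. i \<le> n \<and> n - i \<in> I})\<rparr>)"

text \<open>
  The groups are written multiplicatively, so commuting up to sign reads as commuting up to
  inversion.  The finiteness condition on families of operators guarantees that they preserve the
  finiteness of supports.
\<close>

locale noetherian_graded =
  fixes I :: "nat set" and G :: "nat \<Rightarrow> ('g, 'b) monoid_scheme" and Z :: "nat \<Rightarrow> 's set"
    and act :: "nat \<Rightarrow> 's \<Rightarrow> nat \<Rightarrow> 'g \<Rightarrow> 'g" and R :: "(nat \<Rightarrow> 's, 'z) ring_scheme"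
  assumes up: "n \<in> I \<Longrightarrow> n \<le> m \<Longrightarrow> m \<in> I" and nonempty: "I \<noteq> {}"
    and comm_group_G: "comm_group (G n)"
    and hom: "\<zeta> \<in> Z i \<Longrightarrow> act i \<zeta> n \<in> hom (G n) (G (n + i))"
    and commute: "\<zeta> \<in> Z i \<Longrightarrow> \<xi> \<in> Z j \<Longrightarrow> y \<in> carrier (G n) \<Longrightarrow>
      act j \<xi> (n + i) (act i \<zeta> n y) = act i \<zeta> (n + j) (act j \<xi> n y) \<or>
      act j \<xi> (n + i) (act i \<zeta> n y) = inv\<^bsub>G (n + i + j)\<^esub> act i \<zeta> (n + j) (act j \<xi> n y)"
    and R_carrier: "\<rho> \<in> carrier R \<Longrightarrow> \<rho> i \<in> Z i"
    and R_finite: "\<rho> \<in> carrier R \<Longrightarrow> finite {i. \<exists>n. \<exists>y\<in>carrier (G n). act i (\<rho> i) n y \<noteq> \<one>\<^bsub>G (n + i)\<^esub>}"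
    and noeth: "noetherian_module R (graded_module I G act)"
begin

abbreviation E where "E \<equiv> graded_module I G act"

lemma group_G: "group (G n)" using comm_group_G by (simp add: comm_group_def)

lemma act_closed: "\<zeta> \<in> Z i \<Longrightarrow> y \<in> carrier (G n) \<Longrightarrow> act i \<zeta> n y \<in> carrier (G (n + i))"
  by (rule hom_in_carrier[OF hom])

lemma act_mult: "\<zeta> \<in> Z i \<Longrightarrow> x \<in> carrier (G n) \<Longrightarrow> y \<in> carrier (G n) \<Longrightarrow>
    act i \<zeta> n (x \<otimes>\<^bsub>G n\<^esub> y) = act i \<zeta> n x \<otimes>\<^bsub>G (n + i)\<^esub> act i \<zeta> n y"
  using hom by (auto simp: hom_def)

lemma act_group_hom: "\<zeta> \<in> Z i \<Longrightarrow> group_hom (G n) (G (n + i)) (act i \<zeta> n)"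
  using hom by (simp add: group_hom_def group_hom_axioms_def group_G)

lemma act_one: "\<zeta> \<in> Z i \<Longrightarrow> act i \<zeta> n \<one>\<^bsub>G n\<^esub> = \<one>\<^bsub>G (n + i)\<^esub>"
  by (rule group_hom.hom_one[OF act_group_hom])

lemma act_inv: "\<zeta> \<in> Z i \<Longrightarrow> y \<in> carrier (G n) \<Longrightarrow>
    act i \<zeta> n (inv\<^bsub>G n\<^esub> y) = inv\<^bsub>G (n + i)\<^esub> act i \<zeta> n y"
  by (rule group_hom.hom_inv[OF act_group_hom])

lemma E_simps:
  "carrier E = {x \<in> \<Pi>\<^sub>E n\<in>I. carrier (G n). finite {n \<in> I. x n \<noteq> \<one>\<^bsub>G n\<^esub>}}"
  "\<zero>\<^bsub>E\<^esub> = (\<lambda>n\<in>I. \<one>\<^bsub>G n\<^esub>)" "x \<oplus>\<^bsub>E\<^esub> y = (\<lambda>n\<in>I. x n \<otimes>\<^bsub>G n\<^esub> y n)"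
  "\<zeta> \<odot>\<^bsub>E\<^esub> x = (\<lambda>n\<in>I. finprod (G n) (\<lambda>i. act i (\<zeta> i) (n - i) (x (n - i))) {i. i \<le> n \<and> n - i \<in> I})"
  by (simp_all add: graded_module_def Let_def carrier_sum_group group_G)

text \<open>
  Graded submodules are given by their homogeneous components.
\<close>

definition graded_sub where
  "graded_sub F \<longleftrightarrow> (\<forall>n. subgroup (F n) (G n)) \<and>
    (\<forall>n i. \<forall>\<zeta>\<in>Z i. \<forall>y\<in>F n. act i \<zeta> n y \<in> F (n + i))"

lemma graded_subD:
  assumes "graded_sub F"
  shows "subgroup (F n) (G n)" "\<zeta> \<in> Z i \<Longrightarrow> y \<in> F n \<Longrightarrow> act i \<zeta> n y \<in> F (n + i)"
    "F n \<subseteq> carrier (G n)" "\<one>\<^bsub>G n\<^esub> \<in> F n"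
  using assms subgroup.subset[of "F n" "G n"] subgroup.one_closed[of "F n" "G n"]
  by (auto simp: graded_sub_def)

lemma graded_sub_mem: "graded_sub F \<Longrightarrow> y \<in> F n \<Longrightarrow> y \<in> carrier (G n)"
  using graded_subD(3) by blast

lemma G_unit: "y \<in> carrier (G n) \<Longrightarrow> y \<otimes>\<^bsub>G n\<^esub> \<one>\<^bsub>G n\<^esub> = y"
  "y \<in> carrier (G n) \<Longrightarrow> \<one>\<^bsub>G n\<^esub> \<otimes>\<^bsub>G n\<^esub> y = y" "\<one>\<^bsub>G n\<^esub> \<in> carrier (G n)"
  using group.is_monoid[OF group_G] by (simp_all add: monoid.r_one monoid.l_one monoid.one_closed)

definition total where
  "total F = {x \<in> carrier E. \<forall>n\<in>I. x n \<in> F n}"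

lemma total_submodule:
  assumes F: "graded_sub F"
  shows "submodule (total F) R E"
proof (intro submodule.intro submodule_axioms.intro)
  have carE: "carrier E = carrier (sum_group I G)" by (simp add: graded_module_def Let_def)
  interpret S: group "sum_group I G" by (simp add: group_G)
  have "subgroup (total F) (sum_group I G)"
  proof (rule S.subgroupI)
    show "total F \<subseteq> carrier (sum_group I G)" by (auto simp: total_def carE)
    have "\<one>\<^bsub>sum_group I G\<^esub> \<in> total F"
      using S.one_closed graded_subD(4)[OF F] by (simp add: total_def carE del: one_sum_group) simp
    then show "total F \<noteq> {}" by blast
    fix x assume x: "x \<in> total F"
    then have xS: "x \<in> carrier (sum_group I G)" by (simp add: total_def carE)
    show "inv\<^bsub>sum_group I G\<^esub> x \<in> total F"
      using x S.inv_closed[OF xS] subgroup.m_inv_closed[OF graded_subD(1)[OF F]]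
      by (auto simp: total_def carE inv_sum_group[OF group_G xS])
    fix y assume y: "y \<in> total F"
    then have yS: "y \<in> carrier (sum_group I G)" by (simp add: total_def carE)
    show "x \<otimes>\<^bsub>sum_group I G\<^esub> y \<in> total F"
      using x y S.m_closed[OF xS yS] subgroup.m_closed[OF graded_subD(1)[OF F]]
      by (auto simp: total_def carE)
  qed
  then show "subgroup (total F) (add_monoid E)"
    by (simp add: subgroup_def m_inv_def graded_module_def Let_def)
  fix \<zeta> x assume \<zeta>: "\<zeta> \<in> carrier R" and x: "x \<in> total F"
  have xc: "x n \<in> carrier (G n)" if "n \<in> I" for n using x that by (auto simp: total_def E_simps)
  have mem: "act i (\<zeta> i) (n - i) (x (n - i)) \<in> F n" if "i \<le> n" "n - i \<in> I" for i n
    using graded_subD(2)[OF F R_carrier[OF \<zeta>], of "x (n - i)" "n - i" i] x that by (simp add: total_def)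
  have prod: "finprod (G n) (\<lambda>i. act i (\<zeta> i) (n - i) (x (n - i))) {i. i \<le> n \<and> n - i \<in> I} \<in> F n" for n
    by (rule comm_group.finprod_in_subgroup[OF comm_group_G graded_subD(1)[OF F]]) (auto intro: mem)
  let ?A = "{i. \<exists>n. \<exists>y\<in>carrier (G n). act i (\<zeta> i) n y \<noteq> \<one>\<^bsub>G (n + i)\<^esub>}" and ?B = "{n \<in> I. x n \<noteq> \<one>\<^bsub>G n\<^esub>}"
  have fin: "finite ((\<lambda>(i, n). n + i) ` (?A \<times> ?B))"
    using R_finite[OF \<zeta>] x by (auto simp: total_def E_simps)
  have "n \<in> (\<lambda>(i, n). n + i) ` (?A \<times> ?B)"
    if n: "(\<zeta> \<odot>\<^bsub>E\<^esub> x) n \<noteq> \<one>\<^bsub>G n\<^esub>" "n \<in> I" for n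
  proof -
    interpret Gn: comm_group "G n" by (rule comm_group_G)
    obtain i where i: "i \<le> n" "n - i \<in> I" "act i (\<zeta> i) (n - i) (x (n - i)) \<noteq> \<one>\<^bsub>G n\<^esub>"
      using n Gn.finprod_one_eqI[of "{i. i \<le> n \<and> n - i \<in> I}" "\<lambda>i. act i (\<zeta> i) (n - i) (x (n - i))"]
      by (auto simp: E_simps)
    then have "i \<in> ?A" using xc[OF i(2)] by force
    moreover have "n - i \<in> ?B" using i act_one[OF R_carrier[OF \<zeta>], of i "n - i"] by auto
    ultimately show ?thesis using i(1) by (intro image_eqI[of _ _ "(i, n - i)"]) auto
  qed
  then have "finite {n \<in> I. (\<zeta> \<odot>\<^bsub>E\<^esub> x) n \<noteq> \<one>\<^bsub>G n\<^esub>}" by (intro finite_subset[OF _ fin]) auto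
  moreover have "(\<zeta> \<odot>\<^bsub>E\<^esub> x) n \<in> F n" if "n \<in> I" for n using prod that by (simp add: E_simps)
  moreover have "(\<zeta> \<odot>\<^bsub>E\<^esub> x) \<in> extensional I" by (simp add: E_simps)
  ultimately show "\<zeta> \<odot>\<^bsub>E\<^esub> x \<in> total F"
    unfolding total_def E_simps(1) using graded_subD(3)[OF F] by (auto simp: PiE_iff)
qed

text \<open>
  Homogeneous elements embed in the direct sum, so an inclusion of submodules can be tested on
  components.
\<close>

lemma finite_generation:
  assumes F: "graded_sub F"
  obtains S where "finite S" "S \<subseteq> total F"
    "\<And>F' n. graded_sub F' \<Longrightarrow> S \<subseteq> total F' \<Longrightarrow> n \<in> I \<Longrightarrow> F n \<subseteq> F' n"
proof -
  obtain S where S: "finite S" "S \<subseteq> total F" "total F = submodule_span R E S"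
    using noeth total_submodule[OF F] unfolding noetherian_module_def by blast
  show thesis
  proof (rule that[OF S(1,2)])
    fix F' n assume F': "graded_sub F'" "S \<subseteq> total F'" and n: "n \<in> I"
    have sub: "total F \<subseteq> total F'"
      unfolding S(3) by (rule submodule_span_least[OF total_submodule[OF F'(1)] F'(2)])
    show "F n \<subseteq> F' n"
    proof
      fix y assume y: "y \<in> F n"
      let ?x = "\<lambda>m\<in>I. if m = n then y else \<one>\<^bsub>G m\<^esub>"
      have "finite {m \<in> I. ?x m \<noteq> \<one>\<^bsub>G m\<^esub>}" by (rule finite_subset[of _ "{n}"]) auto
      then have "?x \<in> total F"
        using y subsetD[OF graded_subD(3)[OF F] y] graded_subD(4)[OF F] group.is_monoid[OF group_G, THEN monoid.one_closed]
        by (auto simp: total_def E_simps)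
      then have "?x \<in> total F'" using sub by auto
      then have "?x n \<in> F' n" using n unfolding total_def by blast
      then show "y \<in> F' n" using n by simp
    qed
  qed
qed

lemma graded_sub_all: "graded_sub (\<lambda>n. carrier (G n))"
  using act_closed group.subgroup_self[OF group_G] by (auto simp: graded_sub_def)

lemma graded_sub_trivial: "graded_sub (\<lambda>n. {\<one>\<^bsub>G n\<^esub>})"
  using act_one group.triv_subgroup[OF group_G] by (auto simp: graded_sub_def)

text \<open>
  The quotient by \<open>F\<close> vanishes in high degrees.
\<close>

definition cobounded where
  "cobounded F \<longleftrightarrow> (\<exists>b. \<forall>n\<in>I. b \<le> n \<longrightarrow> F n = carrier (G n))"

lemma finite_subset_in_chain:
  assumes F: "\<And>k :: nat. graded_sub (F k)" and inc: "\<And>k n. F k n \<subseteq> F (Suc k) n"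
    and S: "finite S" "S \<subseteq> carrier E"
    and cover: "\<And>s n. s \<in> S \<Longrightarrow> n \<in> I \<Longrightarrow> \<exists>k. s n \<in> F k n"
  shows "\<exists>k. S \<subseteq> total (F k)"
proof -
  have mono: "F k n \<subseteq> F l n" if "k \<le> l" for k l n
    by (rule lift_Suc_mono_le[of "\<lambda>k. F k n", OF inc that])
  have one: "\<exists>k. s \<in> total (F k)" if s: "s \<in> S" for s
  proof -
    let ?J = "{n \<in> I. s n \<noteq> \<one>\<^bsub>G n\<^esub>}"
    have sE: "s \<in> carrier E" using s S(2) by auto
    have fin: "finite ?J" using sE by (simp add: E_simps)
    have "\<forall>n\<in>?J. \<exists>k. s n \<in> F k n" using cover[OF s] by simp
    then obtain k where k: "\<And>n. n \<in> ?J \<Longrightarrow> s n \<in> F (k n) n" by metis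
    have "s n \<in> F (Max (insert 0 (k ` ?J))) n" if n: "n \<in> I" for n
    proof (cases "n \<in> ?J")
      case True
      then have "k n \<le> Max (insert 0 (k ` ?J))" using fin by (intro Max_ge) auto
      then show ?thesis using k[OF True] mono by blast
    next
      case False
      then show ?thesis using n graded_subD(4)[OF F] by auto
    qed
    then show ?thesis using sE by (auto simp: total_def)
  qed
  then obtain k where k: "\<And>s. s \<in> S \<Longrightarrow> s \<in> total (F (k s))" by metis
  let ?K = "Max (insert 0 (k ` S))"
  have "s \<in> total (F ?K)" if "s \<in> S" for s
  proof -
    have "k s \<le> ?K" using that S(1) by (intro Max_ge) auto
    then show ?thesis using k[OF that] mono[of "k s" ?K] by (auto simp: total_def)
  qed
  then show ?thesis by blast
qed

text \<open>
  The union of the chain is generated by finitely many elements, and these lie in one of its members.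
\<close>

lemma ascending_chain_stabilizes:
  assumes F: "\<And>k :: nat. graded_sub (F k)" and inc: "\<And>k n. F k n \<subseteq> F (Suc k) n"
  shows "\<exists>k. \<forall>n\<in>I. F (Suc k) n = F k n"
proof -
  have mono: "F k n \<subseteq> F l n" if "k \<le> l" for k l n
    by (rule lift_Suc_mono_le[of "\<lambda>k. F k n", OF inc that])
  define U where "U n = (\<Union>k. F k n)" for n
  have "subgroup (U n) (G n)" for n
  proof (rule group.subgroupI[OF group_G])
    show "U n \<subseteq> carrier (G n)" using graded_subD(3)[OF F] by (auto simp: U_def)
    show "U n \<noteq> {}" using graded_subD(4)[OF F] by (auto simp: U_def)
    fix a assume "a \<in> U n"
    then obtain k where k: "a \<in> F k n" by (auto simp: U_def)
    show "inv\<^bsub>G n\<^esub> a \<in> U n" using subgroup.m_inv_closed[OF graded_subD(1)[OF F] k] by (auto simp: U_def)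
    fix b assume "b \<in> U n"
    then obtain l where l: "b \<in> F l n" by (auto simp: U_def)
    have "a \<in> F (max k l) n" "b \<in> F (max k l) n" using k l mono[of k "max k l"] mono[of l "max k l"] by auto
    then have "a \<otimes>\<^bsub>G n\<^esub> b \<in> F (max k l) n" by (rule subgroup.m_closed[OF graded_subD(1)[OF F]])
    then show "a \<otimes>\<^bsub>G n\<^esub> b \<in> U n" by (auto simp: U_def)
  qed
  then have U: "graded_sub U" using graded_subD(2)[OF F] by (fastforce simp: graded_sub_def U_def)
  obtain S where S: "finite S" "S \<subseteq> total U"
    "\<And>F' n. graded_sub F' \<Longrightarrow> S \<subseteq> total F' \<Longrightarrow> n \<in> I \<Longrightarrow> U n \<subseteq> F' n"
    using finite_generation[OF U] by blast
  have "S \<subseteq> carrier E" "\<And>s n. s \<in> S \<Longrightarrow> n \<in> I \<Longrightarrow> \<exists>k. s n \<in> F k n"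
    using S(2) by (auto simp: total_def U_def)
  then obtain K where K: "S \<subseteq> total (F K)"
    using finite_subset_in_chain[of F S, OF F inc S(1)] by blast
  have "U n \<subseteq> F K n" if "n \<in> I" for n by (rule S(3)[OF F K that])
  then have "F (Suc K) n = F K n" if "n \<in> I" for n using inc[of K n] that by (auto simp: U_def)
  then show ?thesis by blast
qed

lemma maximal_not_cobounded:
  assumes "\<not> cobounded (\<lambda>n. {\<one>\<^bsub>G n\<^esub>})"
  obtains F where "graded_sub F" "\<not> cobounded F"
    "\<And>F' n. graded_sub F' \<Longrightarrow> (\<And>n. F n \<subseteq> F' n) \<Longrightarrow> \<not> cobounded F' \<Longrightarrow> n \<in> I \<Longrightarrow> F' n = F n"
proof (rule ccontr)
  assume no: "\<not> thesis"
  note maximal = that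
  have "\<exists>F'. (graded_sub F' \<and> \<not> cobounded F') \<and> (\<forall>n. F n \<subseteq> F' n) \<and> (\<exists>n\<in>I. F' n \<noteq> F n)"
    if "graded_sub F" "\<not> cobounded F" for F
    using maximal[of F] no that by blast
  then have "\<exists>F. \<forall>k::nat. (graded_sub (F k) \<and> \<not> cobounded (F k)) \<and>
      ((\<forall>n. F k n \<subseteq> F (Suc k) n) \<and> (\<exists>n\<in>I. F (Suc k) n \<noteq> F k n))"
    using graded_sub_trivial assms
    by (intro dependent_nat_choice[of "\<lambda>_ F. graded_sub F \<and> \<not> cobounded F"
          "\<lambda>_ F F'. (\<forall>n. F n \<subseteq> F' n) \<and> (\<exists>n\<in>I. F' n \<noteq> F n)"]) blast+
  then obtain F where F: "\<And>k::nat. graded_sub (F k)" "\<And>k n. F k n \<subseteq> F (Suc k) n"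
    "\<And>k. \<exists>n\<in>I. F (Suc k) n \<noteq> F k n" by blast
  show False using ascending_chain_stabilizes[of F, OF F(1,2)] F(3) by blast
qed

fun act_power where
  "act_power i \<zeta> 0 n y = y"
| "act_power i \<zeta> (Suc m) n y = act i \<zeta> (n + m * i) (act_power i \<zeta> m n y)"

lemma act_power_hom: "\<zeta> \<in> Z i \<Longrightarrow> act_power i \<zeta> m n \<in> hom (G n) (G (n + m * i))"
proof (induction m)
  case 0
  show ?case by (simp add: hom_def)
next
  case (Suc m)
  have "act i \<zeta> (n + m * i) \<circ> act_power i \<zeta> m n \<in> hom (G n) (G (n + m * i + i))"
    using hom_compose[OF Suc.IH hom] Suc.prems by blast
  then show ?case by (simp add: comp_def add.assoc add.commute[of i])
qed

lemma act_power_closed: "\<zeta> \<in> Z i \<Longrightarrow> y \<in> carrier (G n) \<Longrightarrow> act_power i \<zeta> m n y \<in> carrier (G (n + m * i))"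
  by (rule hom_in_carrier[OF act_power_hom])

lemma act_power_commute:
  assumes \<zeta>: "\<zeta> \<in> Z i" and \<xi>: "\<xi> \<in> Z j" and y: "y \<in> carrier (G n)"
  shows "act_power i \<zeta> m (n + j) (act j \<xi> n y) = act j \<xi> (n + m * i) (act_power i \<zeta> m n y) \<or>
    act_power i \<zeta> m (n + j) (act j \<xi> n y) = inv\<^bsub>G (n + m * i + j)\<^esub> act j \<xi> (n + m * i) (act_power i \<zeta> m n y)"
proof (induction m)
  case 0
  show ?case by simp
next
  case (Suc m)
  let ?w = "act_power i \<zeta> m n y" and ?n = "n + m * i"
  have w: "?w \<in> carrier (G ?n)" by (rule act_power_closed[OF \<zeta> y])
  have idx: "n + j + m * i = ?n + j" "n + Suc m * i = ?n + i" "?n + j + i = ?n + i + j" by simp_all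
  have c: "act j \<xi> (?n + i) (act i \<zeta> ?n ?w) \<in> carrier (G (?n + i + j))"
    "act i \<zeta> (?n + j) (act j \<xi> ?n ?w) \<in> carrier (G (?n + j + i))"
    by (intro act_closed \<zeta> \<xi> w)+
  have "act_power i \<zeta> (Suc m) (n + j) (act j \<xi> n y) = act i \<zeta> (?n + j) (act j \<xi> ?n ?w) \<or>
      act_power i \<zeta> (Suc m) (n + j) (act j \<xi> n y) = inv\<^bsub>G (?n + j + i)\<^esub> act i \<zeta> (?n + j) (act j \<xi> ?n ?w)"
    using Suc.IH act_inv[OF \<zeta> act_closed[OF \<xi> w]] by (auto simp: idx(1))
  moreover have "act i \<zeta> (?n + j) (act j \<xi> ?n ?w) = act j \<xi> (?n + i) (act i \<zeta> ?n ?w) \<or>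
      act i \<zeta> (?n + j) (act j \<xi> ?n ?w) = inv\<^bsub>G (?n + i + j)\<^esub> act j \<xi> (?n + i) (act i \<zeta> ?n ?w)"
    using commute[OF \<xi> \<zeta> w] by (simp add: idx(3))
  ultimately have "act_power i \<zeta> (Suc m) (n + j) (act j \<xi> n y) = act j \<xi> (?n + i) (act i \<zeta> ?n ?w) \<or>
      act_power i \<zeta> (Suc m) (n + j) (act j \<xi> n y) = inv\<^bsub>G (?n + i + j)\<^esub> act j \<xi> (?n + i) (act i \<zeta> ?n ?w)"
    using group.inv_inv[OF group_G c(1)] by (auto simp: idx(3))
  then show ?case unfolding idx(2) by simp
qed

text \<open>
  Stability under the operators is where commutation up to inversion enters.
\<close>

lemma power_kernel_sub:
  assumes \<zeta>: "\<zeta> \<in> Z i"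
  shows "graded_sub (\<lambda>n. {y \<in> carrier (G n). act_power i \<zeta> m n y = \<one>\<^bsub>G (n + m * i)\<^esub>})"
  unfolding graded_sub_def
proof (intro conjI allI ballI)
  fix n
  interpret h: group_hom "G n" "G (n + m * i)" "act_power i \<zeta> m n"
    using act_power_hom[OF \<zeta>] by (simp add: group_hom_def group_hom_axioms_def group_G)
  show "subgroup {y \<in> carrier (G n). act_power i \<zeta> m n y = \<one>\<^bsub>G (n + m * i)\<^esub>} (G n)"
    using h.subgroup_kernel by (simp add: kernel_def)
  fix j \<xi> y assume \<xi>: "\<xi> \<in> Z j" and y: "y \<in> {y \<in> carrier (G n). act_power i \<zeta> m n y = \<one>\<^bsub>G (n + m * i)\<^esub>}"
  have "act_power i \<zeta> m (n + j) (act j \<xi> n y) = \<one>\<^bsub>G (n + m * i + j)\<^esub>"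
    using act_power_commute[OF \<zeta> \<xi>, of y n m] y act_one[OF \<xi>] monoid.inv_one[OF group.is_monoid[OF group_G]] by auto
  then show "act j \<xi> n y \<in> {y \<in> carrier (G (n + j)). act_power i \<zeta> m (n + j) y = \<one>\<^bsub>G (n + j + m * i)\<^esub>}"
    using act_closed[OF \<xi>] y by (simp add: add.assoc add.commute[of j])
qed

lemma locally_nilpotent_imp_nilpotent:
  assumes \<zeta>: "\<zeta> \<in> Z i"
    and nil: "\<And>n y. n \<in> I \<Longrightarrow> y \<in> carrier (G n) \<Longrightarrow> \<exists>m. act_power i \<zeta> m n y = \<one>\<^bsub>G (n + m * i)\<^esub>"
  shows "\<exists>m. \<forall>n\<in>I. \<forall>y\<in>carrier (G n). act_power i \<zeta> m n y = \<one>\<^bsub>G (n + m * i)\<^esub>"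
proof -
  let ?K = "\<lambda>m n. {y \<in> carrier (G n). act_power i \<zeta> m n y = \<one>\<^bsub>G (n + m * i)\<^esub>}"
  have inc: "?K m n \<subseteq> ?K (Suc m) n" for m n
    using act_one[OF \<zeta>] by (auto simp: add.assoc add.commute[of i])
  obtain S where S: "finite S" "S \<subseteq> total (\<lambda>n. carrier (G n))"
    "\<And>F' n. graded_sub F' \<Longrightarrow> S \<subseteq> total F' \<Longrightarrow> n \<in> I \<Longrightarrow> carrier (G n) \<subseteq> F' n"
    using finite_generation[OF graded_sub_all] by blast
  have cov: "\<exists>k. s n \<in> ?K k n" if "s \<in> S" "n \<in> I" for s n
  proof -
    have sn: "s n \<in> carrier (G n)" using that S(2) by (auto simp: total_def)
    then show ?thesis using nil[OF that(2) sn] by simp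
  qed
  have "\<exists>m. S \<subseteq> total (?K m)"
  proof (rule finite_subset_in_chain[of ?K])
    show "graded_sub (?K m)" for m by (rule power_kernel_sub[OF \<zeta>])
    show "S \<subseteq> carrier E" using S(2) by (auto simp: total_def)
  qed (fact inc S(1) cov)+
  then obtain m where m: "S \<subseteq> total (?K m)" ..
  have "act_power i \<zeta> m n y = \<one>\<^bsub>G (n + m * i)\<^esub>" if "n \<in> I" "y \<in> carrier (G n)" for n y
    using S(3)[OF power_kernel_sub[OF \<zeta>] m that(1)] that(2) by blast
  then show ?thesis by blast
qed

text \<open>
  The images of a single operator, extended by the trivial group to the degrees that it does not reach.
\<close>

definition op_image where
  "op_image i \<zeta> n = insert \<one>\<^bsub>G n\<^esub> (\<Union>m\<in>{m \<in> I. m + i = n}. act i \<zeta> m ` carrier (G m))"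

lemma op_image_sub:
  assumes \<zeta>: "\<zeta> \<in> Z i"
  shows "graded_sub (op_image i \<zeta>)"
  unfolding graded_sub_def
proof (intro conjI allI ballI)
  fix n
  show "subgroup (op_image i \<zeta> n) (G n)"
  proof (cases "\<exists>m\<in>I. m + i = n")
    case True
    then obtain m where m: "m \<in> I" "n = m + i" by auto
    interpret h: group_hom "G m" "G n" "act i \<zeta> m" using act_group_hom[OF \<zeta>] m by simp
    have "{k \<in> I. k + i = n} = {m}" using m by auto
    moreover have "\<one>\<^bsub>G n\<^esub> \<in> act i \<zeta> m ` carrier (G m)"
      using h.hom_one h.G.one_closed by (intro image_eqI[of _ _ "\<one>\<^bsub>G m\<^esub>"]) simp_all
    ultimately have "op_image i \<zeta> n = act i \<zeta> m ` carrier (G m)"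
      by (simp add: op_image_def insert_absorb)
    then show ?thesis using h.img_is_subgroup by simp
  next
    case False
    then have "op_image i \<zeta> n = {\<one>\<^bsub>G n\<^esub>}" by (auto simp: op_image_def)
    then show ?thesis using group.triv_subgroup[OF group_G] by simp
  qed
  fix j \<xi> y assume \<xi>: "\<xi> \<in> Z j" and y: "y \<in> op_image i \<zeta> n"
  show "act j \<xi> n y \<in> op_image i \<zeta> (n + j)"
  proof (cases "y = \<one>\<^bsub>G n\<^esub>")
    case True
    then show ?thesis by (simp add: act_one[OF \<xi>] op_image_def)
  next
    case False
    then obtain m x where m: "m \<in> I" "n = m + i" "x \<in> carrier (G m)" "y = act i \<zeta> m x"
      using y by (auto simp: op_image_def)
    let ?x = "act j \<xi> m x"
    have x: "?x \<in> carrier (G (m + j))" "inv\<^bsub>G (m + j)\<^esub> ?x \<in> carrier (G (m + j))"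
      using act_closed[OF \<xi> m(3)] group.inv_closed[OF group_G] by auto
    have mj: "m + j \<in> I" "m + j + i = n + j" using up[OF m(1)] m(2) by auto
    have "act j \<xi> n y = act i \<zeta> (m + j) ?x \<or> act j \<xi> n y = act i \<zeta> (m + j) (inv\<^bsub>G (m + j)\<^esub> ?x)"
      using commute[OF \<zeta> \<xi> m(3)] m(2,4) act_inv[OF \<zeta> x(1)] mj(2) by simp
    then show ?thesis using x mj by (auto simp: op_image_def)
  qed
qed

lemma product_sub:
  assumes F: "graded_sub F" and F': "graded_sub F'"
  shows "graded_sub (\<lambda>n. F n <#>\<^bsub>G n\<^esub> F' n)"
  unfolding graded_sub_def
proof (intro conjI allI ballI)
  fix n show "subgroup (F n <#>\<^bsub>G n\<^esub> F' n) (G n)"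
    by (rule comm_group.mult_subgroups[OF comm_group_G graded_subD(1)[OF F] graded_subD(1)[OF F']])
  fix i \<zeta> y assume \<zeta>: "\<zeta> \<in> Z i" and "y \<in> F n <#>\<^bsub>G n\<^esub> F' n"
  then obtain a b where ab: "a \<in> F n" "b \<in> F' n" "y = a \<otimes>\<^bsub>G n\<^esub> b" by (auto simp: set_mult_def)
  then have "act i \<zeta> n y = act i \<zeta> n a \<otimes>\<^bsub>G (n + i)\<^esub> act i \<zeta> n b"
    using graded_subD(3)[OF F] graded_subD(3)[OF F'] by (auto intro!: act_mult[OF \<zeta>])
  then show "act i \<zeta> n y \<in> F (n + i) <#>\<^bsub>G (n + i)\<^esub> F' (n + i)"
    using graded_subD(2)[OF F \<zeta> ab(1)] graded_subD(2)[OF F' \<zeta> ab(2)] by (auto simp: set_mult_def)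
qed

text \<open>
  Noetherian induction: a maximal \<open>F\<close> with unbounded quotient contains the images of all operators of
  positive degree, since these are nilpotent, but then the quotient is bounded by the degrees of
  finitely many generators.
\<close>

theorem exists_non_nilpotent:
  assumes nc: "\<not> cobounded (\<lambda>n. {\<one>\<^bsub>G n\<^esub>})"
  shows "\<exists>i>0. \<exists>\<zeta>\<in>Z i. \<exists>n\<in>I. \<exists>y\<in>carrier (G n). \<forall>m. act_power i \<zeta> m n y \<noteq> \<one>\<^bsub>G (n + m * i)\<^esub>"
proof (rule ccontr)
  assume "\<not> ?thesis"
  then have nil: "\<exists>m. act_power i \<zeta> m n y = \<one>\<^bsub>G (n + m * i)\<^esub>"
    if "i > 0" "\<zeta> \<in> Z i" "n \<in> I" "y \<in> carrier (G n)" for i \<zeta> n y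
    using that by blast
  obtain F where F: "graded_sub F" and ncF: "\<not> cobounded F"
    and max: "\<And>F' n. graded_sub F' \<Longrightarrow> (\<And>n. F n \<subseteq> F' n) \<Longrightarrow> \<not> cobounded F' \<Longrightarrow> n \<in> I \<Longrightarrow> F' n = F n"
    using maximal_not_cobounded[OF nc] by blast
  note sg = graded_subD(1)[OF F]
  have image_F: "op_image i \<zeta> n \<subseteq> F n" if i: "i > 0" and \<zeta>: "\<zeta> \<in> Z i" and n: "n \<in> I" for i \<zeta> n
  proof (rule ccontr)
    assume not_sub: "\<not> op_image i \<zeta> n \<subseteq> F n"
    let ?F' = "\<lambda>n. F n <#>\<^bsub>G n\<^esub> op_image i \<zeta> n"
    note Im = op_image_sub[OF \<zeta>]
    have F': "graded_sub ?F'" by (rule product_sub[OF F Im])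
    have FF': "F n \<subseteq> ?F' n" for n
    proof
      fix y assume y: "y \<in> F n"
      then have "y = y \<otimes>\<^bsub>G n\<^esub> \<one>\<^bsub>G n\<^esub>"
        by (simp add: G_unit graded_sub_mem[OF F])
      then show "y \<in> ?F' n" using y graded_subD(4)[OF Im] unfolding set_mult_def by blast
    qed
    have "op_image i \<zeta> n \<subseteq> ?F' n"
    proof
      fix y assume y: "y \<in> op_image i \<zeta> n"
      then have "y = \<one>\<^bsub>G n\<^esub> \<otimes>\<^bsub>G n\<^esub> y"
        by (simp add: G_unit graded_sub_mem[OF Im])
      then show "y \<in> ?F' n" using y graded_subD(4)[OF F] unfolding set_mult_def by blast
    qed
    then have "cobounded ?F'" using max[OF F' FF' _ n] not_sub by blast
    then obtain b0 where b0: "\<And>n. n \<in> I \<Longrightarrow> b0 \<le> n \<Longrightarrow> ?F' n = carrier (G n)" by (auto simp: cobounded_def)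
    obtain m0 where m0: "m0 \<in> I" using nonempty by blast
    define b where "b = max b0 m0"
    have b: "n \<in> I" "b0 \<le> n" if "b \<le> n" for n using up[OF m0, of n] that by (auto simp: b_def)
    \<comment> \<open>Iterating \<open>E = F + \<zeta>E\<close>, valid from degree \<open>b\<close> on; each step costs \<open>i\<close> degrees.\<close>
    have iterate: "\<exists>a\<in>F n. \<exists>m x. b \<le> m \<and> n = m + N * i \<and> x \<in> carrier (G m) \<and> y = a \<otimes>\<^bsub>G n\<^esub> act_power i \<zeta> N m x"
      if "b + N * i \<le> n" "y \<in> carrier (G n)" for N n y
      using that
    proof (induction N arbitrary: n y)
      case 0
      then show ?case
        using graded_subD(4)[OF F]
        by (intro bexI[of _ "\<one>\<^bsub>G n\<^esub>"] exI[of _ n] exI[of _ y]) (auto simp: G_unit)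
    next
      case (Suc N)
      have n: "b \<le> n" "b + N * i \<le> n - i" "i \<le> n" using Suc.prems(1) by auto
      have ni: "b \<le> n - i" "n = (n - i) + i" using n by auto
      obtain a c where ac: "a \<in> F n" "c \<in> op_image i \<zeta> n" "y = a \<otimes>\<^bsub>G n\<^esub> c"
        using b0[OF b[OF n(1)]] Suc.prems(2) unfolding set_mult_def by blast
      obtain x where x: "x \<in> carrier (G (n - i))" "c = act i \<zeta> (n - i) x"
      proof (cases "c = \<one>\<^bsub>G n\<^esub>")
        case True
        then show ?thesis
          using that[OF G_unit(3)] act_one[OF \<zeta>, of "n - i"] ni(2) by simp
      next
        case False
        then show ?thesis using ac(2) that by (auto simp: op_image_def)
      qed
      obtain a' m x' where IH: "a' \<in> F (n - i)" "b \<le> m" "n - i = m + N * i" "x' \<in> carrier (G m)"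
        "x = a' \<otimes>\<^bsub>G (n - i)\<^esub> act_power i \<zeta> N m x'"
        using Suc.IH[OF n(2) x(1)] by blast
      have a'c: "a' \<in> carrier (G (n - i))" using IH(1) graded_subD(3)[OF F] by auto
      have pc: "act_power i \<zeta> N m x' \<in> carrier (G (n - i))" using act_power_closed[OF \<zeta> IH(4)] IH(3) by simp
      have "c = act i \<zeta> (n - i) a' \<otimes>\<^bsub>G n\<^esub> act i \<zeta> (n - i) (act_power i \<zeta> N m x')"
        using act_mult[OF \<zeta> a'c pc] x(2) IH(5) ni(2) by simp
      also have "act i \<zeta> (n - i) (act_power i \<zeta> N m x') = act_power i \<zeta> (Suc N) m x'" using IH(3) by simp
      finally have c: "c = act i \<zeta> (n - i) a' \<otimes>\<^bsub>G n\<^esub> act_power i \<zeta> (Suc N) m x'" .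
      have Fa: "act i \<zeta> (n - i) a' \<in> F n" using graded_subD(2)[OF F \<zeta> IH(1)] ni(2) by simp
      have nm: "n = m + Suc N * i" using IH(3) ni(2) by simp
      have pc': "act_power i \<zeta> (Suc N) m x' \<in> carrier (G n)" using act_power_closed[OF \<zeta> IH(4), of "Suc N"] nm by simp
      have "y = (a \<otimes>\<^bsub>G n\<^esub> act i \<zeta> (n - i) a') \<otimes>\<^bsub>G n\<^esub> act_power i \<zeta> (Suc N) m x'"
        unfolding ac(3) c
        by (rule monoid.m_assoc[OF group.is_monoid[OF group_G] graded_sub_mem[OF F ac(1)] graded_sub_mem[OF F Fa] pc', symmetric])
      moreover have "a \<otimes>\<^bsub>G n\<^esub> act i \<zeta> (n - i) a' \<in> F n"
        by (rule subgroup.m_closed[OF sg ac(1) Fa])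
      ultimately show ?case using IH(2,4) nm by blast
    qed
    obtain N where N: "\<And>n y. n \<in> I \<Longrightarrow> y \<in> carrier (G n) \<Longrightarrow> act_power i \<zeta> N n y = \<one>\<^bsub>G (n + N * i)\<^esub>"
      using locally_nilpotent_imp_nilpotent[OF \<zeta> nil[OF i \<zeta>]] by blast
    have "carrier (G n) \<subseteq> F n" if n: "b + N * i \<le> n" for n
    proof
      fix y assume "y \<in> carrier (G n)"
      from iterate[OF n this] obtain a m x where a: "a \<in> F n" "b \<le> m" "n = m + N * i" "x \<in> carrier (G m)"
        "y = a \<otimes>\<^bsub>G n\<^esub> act_power i \<zeta> N m x" by blast
      have "act_power i \<zeta> N m x = \<one>\<^bsub>G n\<^esub>" using N[OF b(1)[OF a(2)] a(4)] a(3) by simp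
      then show "y \<in> F n"
        using a(1,5) by (simp add: G_unit graded_sub_mem[OF F])
    qed
    then have "cobounded F"
      unfolding cobounded_def using graded_subD(3)[OF F] by (intro exI[of _ "b + N * i"]) blast
    then show False using ncF by simp
  qed
  obtain S where S: "finite S" "S \<subseteq> total (\<lambda>n. carrier (G n))"
    "\<And>F' n. graded_sub F' \<Longrightarrow> S \<subseteq> total F' \<Longrightarrow> n \<in> I \<Longrightarrow> carrier (G n) \<subseteq> F' n"
    using finite_generation[OF graded_sub_all] by blast
  let ?supp = "\<Union>s\<in>S. {n \<in> I. s n \<noteq> \<one>\<^bsub>G n\<^esub>}"
  have "finite ?supp" using S(1,2) by (auto simp: total_def E_simps)
  then obtain B where B: "\<And>n. n \<in> ?supp \<Longrightarrow> n \<le> B" by (meson finite_nat_set_iff_bounded_le)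
  have stable: "act i \<zeta> n y \<in> F (n + i)" if "i > 0" "\<zeta> \<in> Z i" "n \<in> I" "y \<in> carrier (G n)" for i \<zeta> n y
    using image_F[OF that(1,2) up[OF that(3), of "n + i"]] that(3,4) by (auto simp: op_image_def)
  \<comment> \<open>All of \<open>E\<close> up to degree \<open>B\<close> and \<open>F\<close> above; operators of positive degree end up in \<open>F\<close> anyway.\<close>
  have F'': "graded_sub (\<lambda>n. if n \<le> B \<and> n \<in> I then carrier (G n) else F n)"
    unfolding graded_sub_def
  proof (intro conjI allI ballI)
    fix n show "subgroup (if n \<le> B \<and> n \<in> I then carrier (G n) else F n) (G n)"
      using sg group.subgroup_self[OF group_G] by simp
    fix i \<zeta> y assume \<zeta>: "\<zeta> \<in> Z i" and y: "y \<in> (if n \<le> B \<and> n \<in> I then carrier (G n) else F n)"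
    have yc: "y \<in> carrier (G n)" using y graded_subD(3)[OF F] by (auto split: if_splits)
    show "act i \<zeta> n y \<in> (if n + i \<le> B \<and> n + i \<in> I then carrier (G (n + i)) else F (n + i))"
    proof (cases "n \<le> B \<and> n \<in> I \<and> i > 0")
      case True
      then show ?thesis using stable[OF _ \<zeta> _ yc] act_closed[OF \<zeta> yc] by simp
    next
      case False
      then show ?thesis
        using y graded_subD(2)[OF F \<zeta>, of y n] act_closed[OF \<zeta> yc] by (auto split: if_splits)
    qed
  qed
  have "S \<subseteq> total (\<lambda>n. if n \<le> B \<and> n \<in> I then carrier (G n) else F n)"
  proof
    fix s assume s: "s \<in> S"
    then have sE: "s \<in> carrier E" "\<And>n. n \<in> I \<Longrightarrow> s n \<in> carrier (G n)" using S(2) by (auto simp: total_def)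
    have "s n \<in> F n" if n: "n \<in> I" "\<not> n \<le> B" for n
    proof -
      have "s n = \<one>\<^bsub>G n\<^esub>" using B[of n] s n by blast
      then show ?thesis by (simp add: graded_subD(4)[OF F])
    qed
    then show "s \<in> total (\<lambda>n. if n \<le> B \<and> n \<in> I then carrier (G n) else F n)"
      using sE by (auto simp: total_def)
  qed
  from S(3)[OF F'' this] have "carrier (G n) \<subseteq> F n" if "n \<in> I" "B < n" for n
    using that by (metis linorder_not_le)
  then have "cobounded F"
    unfolding cobounded_def using graded_subD(3)[OF F] by (intro exI[of _ "Suc B"]) (auto simp: Suc_le_eq)
  then show False using ncF by simp
qed

end

section \<open>Arithmetic progressions of nonvanishing Ext groups\<close>

context hochschild_resolution begin

lemma act_one:
  assumes Q: "projective_complex A Q" and N: "left_module A N" and QN: "projective_resolution A N QN"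
    and y: "y \<in> carrier (Ext A Q N n)"
  shows "act Q QN N i \<one>\<^bsub>HH k A P i\<^esub> n y = \<one>\<^bsub>Ext A Q N (n + i)\<^esub>"
proof -
  interpret Z: comm_group "cocycle_group E P reg i" by (rule cocycle_comm_group[OF P_complex reg_left_module])
  interpret Z': comm_group "cocycle_group A Q N (n + i)" by (rule cocycle_comm_group[OF Q N])
  let ?z = "\<lambda>x\<in>carrier (res_mod P i). \<zero>\<^bsub>A\<^esub>"
  have z: "?z \<in> cocycles E P reg i" using Z.one_closed by (simp add: cocycle_group_simps)
  have one: "\<one>\<^bsub>HH k A P i\<^esub> = ext_class E P reg i ?z"
    using hom_one[OF ext_class_hom[OF P_complex reg_left_module] Z.is_group] comm_group.axioms(2)[OF Ext_comm_group[OF P_complex reg_left_module]]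
    by (simp add: HH_def cocycle_group_simps)
  obtain e where e: "e \<in> cocycles A Q N n" "y = ext_class A Q N n e" using y by (auto simp: carrier_Ext)
  obtain c where c: "c \<in> chain_lifts A Q n (TP N) e"
    using chain_lift_exists[OF Q TP_exact[OF N] cocyclesD(1)[OF e(1)] cocyclesD(3)[OF e(1)]] by blast
  have "act Q QN N i \<one>\<^bsub>HH k A P i\<^esub> n y =
      ext_class A Q N (n + i) (\<lambda>x\<in>carrier (res_mod Q (n + i)). eval_map N ?z (c i x))"
    unfolding act_def one e(2) by (rule HH_action[OF Q N QN z e(1) c])
  also have "(\<lambda>x\<in>carrier (res_mod Q (n + i)). eval_map N ?z (c i x)) = \<one>\<^bsub>cocycle_group A Q N (n + i)\<^esub>"
    unfolding cocycle_group_simps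
  proof (rule restrict_ext)
    fix x assume "x \<in> carrier (res_mod Q (n + i))"
    then show "eval_map N ?z (c i x) = \<zero>\<^bsub>N\<^esub>"
      using linear_map_closed[OF chain_liftsD(1)[OF c]]
      by (intro eval_map_zero[OF PM N cocycle_linear[OF z]]) (auto simp: tensor_resolution_simps)
  qed
  also have "ext_class A Q N (n + i) \<dots> = \<one>\<^bsub>Ext A Q N (n + i)\<^esub>"
    using hom_one[OF ext_class_hom[OF Q N] Z'.is_group] comm_group.axioms(2)[OF Ext_comm_group[OF Q N]] by simp
  finally show ?thesis .
qed

lemma Ext_from_graded_module:
  "Ext_from k A P Q N QN n0 = graded_module {n. n0 \<le> int n} (Ext A Q N) (act Q QN N)"
  by (simp only: Ext_from_def graded_module_def act_def Let_def mem_Collect_eq)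

lemma noetherian_graded_Ext:
  assumes Q: "projective_complex A Q" and N: "left_module A N" and QN: "projective_resolution A N QN"
    and noeth: "noetherian_module (HH_ring k A P) (Ext_from k A P Q N QN n0)"
  shows "noetherian_graded {n. n0 \<le> int n} (Ext A Q N) (\<lambda>i. carrier (HH k A P i)) (act Q QN N) (HH_ring k A P)"
proof (rule noetherian_graded.intro)
  have HH: "group (HH k A P i)" for i
    using comm_group.axioms(2)[OF Ext_comm_group[OF P_complex reg_left_module]] by (simp add: HH_def)
  have car: "carrier (HH_ring k A P) = {\<zeta> \<in> \<Pi>\<^sub>E i\<in>UNIV. carrier (HH k A P i). finite {i \<in> UNIV. \<zeta> i \<noteq> \<one>\<^bsub>HH k A P i\<^esub>}}"
    by (simp add: HH_ring_def Let_def carrier_sum_group HH)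
  show "\<And>n m. n \<in> {n. n0 \<le> int n} \<Longrightarrow> n \<le> m \<Longrightarrow> m \<in> {n. n0 \<le> int n}" by auto
  show "{n. n0 \<le> int n} \<noteq> {}"
  proof -
    have "nat n0 \<in> {n. n0 \<le> int n}" by simp
    then show ?thesis by blast
  qed
  show "comm_group (Ext A Q N n)" for n by (rule Ext_comm_group[OF Q N])
  show "\<And>\<zeta> i n. \<zeta> \<in> carrier (HH k A P i) \<Longrightarrow> act Q QN N i \<zeta> n \<in> hom (Ext A Q N n) (Ext A Q N (n + i))"
    by (rule act_hom[OF Q N QN])
  show "\<And>\<zeta> i \<xi> j y n. \<zeta> \<in> carrier (HH k A P i) \<Longrightarrow> \<xi> \<in> carrier (HH k A P j) \<Longrightarrow> y \<in> carrier (Ext A Q N n) \<Longrightarrow>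
      act Q QN N j \<xi> (n + i) (act Q QN N i \<zeta> n y) = act Q QN N i \<zeta> (n + j) (act Q QN N j \<xi> n y) \<or>
      act Q QN N j \<xi> (n + i) (act Q QN N i \<zeta> n y) =
        inv\<^bsub>Ext A Q N (n + i + j)\<^esub> act Q QN N i \<zeta> (n + j) (act Q QN N j \<xi> n y)"
    by (rule act_commute[OF Q N QN])
  show "\<And>\<zeta> i. \<zeta> \<in> carrier (HH_ring k A P) \<Longrightarrow> \<zeta> i \<in> carrier (HH k A P i)"
    by (auto simp: car)
  show "finite {i. \<exists>n. \<exists>y\<in>carrier (Ext A Q N n). act Q QN N i (\<zeta> i) n y \<noteq> \<one>\<^bsub>Ext A Q N (n + i)\<^esub>}"
    if "\<zeta> \<in> carrier (HH_ring k A P)" for \<zeta>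
    by (rule finite_subset[of _ "{i \<in> UNIV. \<zeta> i \<noteq> \<one>\<^bsub>HH k A P i\<^esub>}"])
       (use that act_one[OF Q N QN] in \<open>auto simp: car\<close>)
  show "noetherian_module (HH_ring k A P) (graded_module {n. n0 \<le> int n} (Ext A Q N) (act Q QN N))"
    using noeth by (simp add: Ext_from_graded_module)
qed

end

theorem theorem3p2:
  fixes k :: "'k ring" and A :: "('k, 'a) module"
    and M :: "('a, 'm) module" and N :: "('a, 'n) module"
    and P :: "(('a \<times> 'a \<Rightarrow>\<^sub>0 int) set, 'p, 'a) resolution"
    and QM :: "('a, 'q, 'm) resolution" and QN :: "('a, 'r, 'n) resolution"
    and n0 :: int
  assumes "fin_dim_algebra k A"
    and "left_module A M" and "finitely_generated A M"
    and "left_module A N" and "finitely_generated A N"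
    and "projective_resolution (enveloping_algebra k A) (regular_bimodule A) P"
    and "projective_resolution A M QM"
    and "projective_resolution A N QN"
    and "noetherian_module (HH_ring k A P) (Ext_from k A P QM N QN n0)"
  shows "(\<exists>n1::nat. \<forall>n\<ge>n1. carrier (Ext A QM N n) = {\<one>\<^bsub>Ext A QM N n\<^esub>}) \<or>
    (\<exists>(d::nat) (m0::nat). 0 < d \<and>
       (\<exists>j::nat. j < d \<and>
          (\<forall>n\<ge>m0. [n = j] (mod d) \<longrightarrow> carrier (Ext A QM N n) \<noteq> {\<one>\<^bsub>Ext A QM N n\<^esub>})))"
proof -
  interpret hochschild_resolution k A P
    using assms(1,6) by (simp add: hochschild_resolution_def hochschild_resolution_axioms_def fd_algebra_def)
  have Q: "projective_complex A QM" by (rule projective_resolution_complex[OF assms(2,7)])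
  interpret G: noetherian_graded "{n. n0 \<le> int n}" "Ext A QM N" "\<lambda>i. carrier (HH k A P i)" "act QM QN N" "HH_ring k A P"
    by (rule noetherian_graded_Ext[OF Q assms(4,8,9)])
  show ?thesis
  proof (cases "G.cobounded (\<lambda>n. {\<one>\<^bsub>Ext A QM N n\<^esub>})")
    case True
    then obtain b where b: "\<And>n. n0 \<le> int n \<Longrightarrow> b \<le> n \<Longrightarrow> {\<one>\<^bsub>Ext A QM N n\<^esub>} = carrier (Ext A QM N n)"
      by (auto simp: G.cobounded_def)
    have "\<forall>n\<ge>max b (nat n0). carrier (Ext A QM N n) = {\<one>\<^bsub>Ext A QM N n\<^esub>}"
    proof (intro allI impI)
      fix n assume "max b (nat n0) \<le> n"
      then have "n0 \<le> int n" "b \<le> n" by auto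
      then show "carrier (Ext A QM N n) = {\<one>\<^bsub>Ext A QM N n\<^esub>}" by (rule b[symmetric])
    qed
    then show ?thesis by blast
  next
    case False
    then obtain d \<zeta> n y where d: "d > 0" and \<zeta>: "\<zeta> \<in> carrier (HH k A P d)"
      and y: "y \<in> carrier (Ext A QM N n)"
      and nz: "\<And>m. G.act_power d \<zeta> m n y \<noteq> \<one>\<^bsub>Ext A QM N (n + m * d)\<^esub>"
      using G.exists_non_nilpotent by blast
    have "carrier (Ext A QM N l) \<noteq> {\<one>\<^bsub>Ext A QM N l\<^esub>}" if l: "n \<le> l" "[l = n mod d] (mod d)" for l
    proof -
      have "[l = n] (mod d)" using l(2) by (simp add: cong_def)
      then have "d dvd l - n" using l(1) by (simp add: cong_altdef_nat)
      then obtain m where "l - n = d * m" by blast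
      then have "l = n + m * d" using l(1) by (metis le_add_diff_inverse mult.commute)
      then show ?thesis using nz[of m] G.act_power_closed[OF \<zeta> y, of m] by blast
    qed
    moreover have "n mod d < d" using d by simp
    ultimately show ?thesis using d by blast
  qed
qed

end
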